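(* Let $\mathbf{k}$ be a field, $A$ a unital $\mathbf{k}$-algebra and $e\in A$ an idempotent such that $eAe\cong\mathbf{k}$ and the multiplication map $(1-e)Ae\otimes_{\mathbf{k}} eA(1-e)\to(1-e)A(1-e)$ is injective. Let $\mathcal{C}=\mathcal{C}(A,e)$ be the associated monoidal category, and let $A''$, $\mathbb{B}_{1,0},\mathbb{B}_{0,1},\mathbb{B}_{1,1}(1)$ and $\mathrm{PB}_{m,n}$, $\mathbb{B}_f$ be as in the context. Then for all $m,n\ge 0$ the $\mathbf{k}$-vector space $\mathrm{Hom}_{\mathcal C}(X^{\otimes n},X^{\otimes m})$ has a basis of labeled diagrams $$\mathbb{B}_{m,n}=\bigsqcup_{f\in \mathrm{PB}_{m,n}}\mathbb{B}_f$$ and is naturally isomorphic to the space $$\bigoplus_{f\in \mathrm{PB}_{m,n}}\big((1-e)Ae\big)^{\otimes(m-|f|)}\otimes (A'')^{\otimes|f|}\otimes\big(eA(1-e)\big)^{\otimes(n-|f|)} .$$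
   Context: Choices. Let $A'\subset(1-e)A(1-e)$ be the image of the multiplication map $(1-e)Ae\otimes eA(1-e)\to(1-e)A(1-e)$. Choose a $\mathbf{k}$-vector subspace $A''$ with $(1-e)A(1-e)=A'\oplus A''$. Choose bases $\mathbb{B}_{1,0}$ of $(1-e)Ae$, $\mathbb{B}_{0,1}$ of $eA(1-e)$ and $\mathbb{B}_{1,1}(1)$ of $A''$. The category $\mathcal{C}=\mathcal{C}(A,e)$ is the $\mathbf{k}$-linear pre-additive strict monoidal category with objects $X^{\otimes n}$, $n\ge0$ ($X^{\otimes 0}=\mathbf{1}$ the unit object), generated by the following morphisms: a morphism $[a]:X\to X$ for each $a\in(1-e)A(1-e)$, $[b]:\mathbf{1}\to X$ for each $b\in(1-e)Ae$, $[c]:X\to\mathbf{1}$ for each $c\in eA(1-e)$, and $[h]:\mathbf{1}\to\mathbf{1}$ for each $h\in eAe\cong\mathbf{k}$. The defining relations (besides the axioms of a $\mathbf{k}$-linear strict monoidal category) are those coming from $A$: each assignment $u\mapsto[u]$ is $\mathbf{k}$-linear on each of the four spaces, $[u][v]=[uv]$ whenever the composition makes sense, $[1-e]=1_X$, and $[\lambda e]=\lambda\cdot 1_{\mathbf 1}$ for $\lambda\in\mathbf{k}$. Diagrammatically, $[a]$ is a long vertical strand carrying a dot labeled $a$, $[b]$ is a short top strand with floating endpoint labeled $b$, and $[c]$ is a short bottom strand with floating endpoint labeled $c$. $\mathrm{PB}_{m,n}$ is the set of partial order-preserving bijections $f:[1,n]\to[1,m]$, where $[1,n]=\{1,\dots,n\}$: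 that is, $f$ is an order-preserving bijection from a subset $L_f\subset[1,n]$ onto a subset $f(L_f)\subset[1,m]$. The width is $|f|:=|L_f|$. For $f\in\mathrm{PB}_{m,n}$, the set $\mathbb{B}_f$ consists of the labeled diagrams, parametrized by $(\mathbb{B}_{1,0})^{m-|f|}\times(\mathbb{B}_{1,1}(1))^{|f|}\times(\mathbb{B}_{0,1})^{n-|f|}$, in which $|f|$ long strands connect the bottom point $i\in L_f$ to the top point $f(i)$ and carry labels $a_1,\dots,a_{|f|}\in \mathbb{B}_{1,1}(1)$ from left to right, short bottom strands at the points $[1,n]\setminus L_f$ carry labels $c_1,\dots,c_{n-|f|}\in\mathbb{B}_{0,1}$ from left to right, and short top strands at the points $[1,m]\setminus f(L_f)$ carry labels $b_1,\dots,b_{m-|f|}\in\mathbb{B}_{1,0}$ from left to right. As a morphism, such a diagram is $T\circ M\circ S$, where $S:X^{\otimes n}\to X^{\otimes|f|}$ is the tensor product having $1_X$ at the positions in $L_f$ and $[c_1],\dots,[c_{n-|f|}]$ successively at the other positions, $M=[a_1]\otimes\cdots\otimes[a_{|f|}]$, and $T:X^{\otimes|f|}\to X^{\otimes m}$ is the tensor product having $1_X$ at the positions in $f(L_f)$ and $[b_1],\dots,[b_{m-|f|}]$ successively at the other positions. *)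

theory Defs
  imports
    "Jordan_Normal_Form.VS_Connect"
    "HOL-Library.Poly_Mapping"
    "HOL-Library.Disjoint_Sets"
    "HOL-Library.FuncSet"
begin

section \<open>Algebras over a field and the corners of an idempotent\<close>

locale k_algebra = vector_space scale
  for scale :: "'k::field \<Rightarrow> 'a::ring_1 \<Rightarrow> 'a" +
  assumes scale_mult_left: "scale c x * y = scale c (x * y)"
    and scale_mult_right: "x * scale c y = scale c (x * y)"

text \<open>The indices 0 and 1 stand for \<open>e\<close> and \<open>1 - e\<close>, which correspond to the objects
  \<open>\<one> = X\<^bsup>\<otimes>0\<^esup>\<close> and \<open>X = X\<^bsup>\<otimes>1\<^esup>\<close>. Thus \<open>corner e 1 0\<close> is \<open>(1-e)Ae\<close>, and so on.\<close>

definition block_idem :: "'a::ring_1 \<Rightarrow> nat \<Rightarrow> 'a" where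
  "block_idem e i = (if i = 0 then e else 1 - e)"

definition corner :: "'a::ring_1 \<Rightarrow> nat \<Rightarrow> nat \<Rightarrow> 'a set" where
  "corner e i j = {block_idem e i * x * block_idem e j | x. True}"

text \<open>\<open>eAe \<cong> k\<close> as unital \<open>k\<close>-algebras; the unit of \<open>eAe\<close> is \<open>e\<close>.\<close>

definition corner_iso_field :: "('k::field \<Rightarrow> 'a::ring_1 \<Rightarrow> 'a) \<Rightarrow> 'a \<Rightarrow> bool" where
  "corner_iso_field scale e \<longleftrightarrow>
     (\<exists>\<phi> :: 'k \<Rightarrow> 'a. bij_betw \<phi> UNIV (corner e 0 0) \<and> \<phi> 1 = e \<and>
        (\<forall>x y. \<phi> (x + y) = \<phi> x + \<phi> y) \<and>
        (\<forall>x y. \<phi> (x * y) = \<phi> x * \<phi> y) \<and>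
        (\<forall>c x. \<phi> (c * x) = scale c (\<phi> x)))"

definition basis_of :: "('k::field \<Rightarrow> 'a::ab_group_add \<Rightarrow> 'a) \<Rightarrow> 'a set \<Rightarrow> 'a set \<Rightarrow> bool" where
  "basis_of scale B U \<longleftrightarrow>
     \<not> Modules.module.dependent scale B \<and> Modules.module.span scale B = U"


section \<open>Quotients, direct sums and tensor products of vector spaces\<close>

text \<open>Vector spaces that are not types are module records over \<open>class_ring\<close>; as for other
  such records, the ring fields \<open>mult\<close> and \<open>one\<close> are irrelevant.\<close>

definition quotient_space ::
    "'v set \<Rightarrow> ('v \<times> 'v) set \<Rightarrow> ('v \<Rightarrow> 'v \<Rightarrow> 'v) \<Rightarrow> 'v \<Rightarrow> ('k \<Rightarrow> 'v \<Rightarrow> 'v) \<Rightarrow> ('k, 'v set) module" where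
  "quotient_space S r add0 zero0 smult0 =
     \<lparr>carrier = S // r, mult = undefined, one = undefined,
      zero = r `` {zero0},
      add = (\<lambda>X Y. \<Union>x\<in>X. \<Union>y\<in>Y. r `` {add0 x y}),
      smult = (\<lambda>c X. \<Union>x\<in>X. r `` {smult0 c x})\<rparr>"

definition direct_sum_space :: "'i set \<Rightarrow> ('i \<Rightarrow> ('k, 'v) module) \<Rightarrow> ('k, 'i \<Rightarrow> 'v) module" where
  "direct_sum_space I V =
     \<lparr>carrier = {x \<in> (\<Pi>\<^sub>E i\<in>I. carrier (V i)). finite {i \<in> I. x i \<noteq> \<zero>\<^bsub>V i\<^esub>}},
      mult = undefined, one = undefined,
      zero = (\<lambda>i\<in>I. \<zero>\<^bsub>V i\<^esub>),
      add = (\<lambda>x y. \<lambda>i\<in>I. x i \<oplus>\<^bsub>V i\<^esub> y i),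
      smult = (\<lambda>c x. \<lambda>i\<in>I. c \<odot>\<^bsub>V i\<^esub> x i)\<rparr>"

definition summand_inj :: "'i set \<Rightarrow> ('i \<Rightarrow> ('k, 'v) module) \<Rightarrow> 'i \<Rightarrow> 'v \<Rightarrow> 'i \<Rightarrow> 'v" where
  "summand_inj I V i v = (\<lambda>j\<in>I. if j = i then v else \<zero>\<^bsub>V j\<^esub>)"

text \<open>The tensor product over \<open>k\<close> of a list of subspaces \<open>U\<^sub>1, \<dots>, U\<^sub>r\<close> of one space: the free
  vector space on the tuples \<open>(u\<^sub>1, \<dots>, u\<^sub>r)\<close> with \<open>u\<^sub>i \<in> U\<^sub>i\<close>, modulo multilinearity.
  The tensor product of the empty list is \<open>k\<close>.\<close>

definition free_scale :: "'k::field \<Rightarrow> ('b \<Rightarrow>\<^sub>0 'k) \<Rightarrow> ('b \<Rightarrow>\<^sub>0 'k)" where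
  "free_scale c = Poly_Mapping.map ((*) c)"

definition multilinear_relators ::
    "('k::field \<Rightarrow> 'a::ab_group_add \<Rightarrow> 'a) \<Rightarrow> 'a set list \<Rightarrow> ('a list \<Rightarrow>\<^sub>0 'k) set" where
  "multilinear_relators scale Us =
     {Poly_Mapping.single (us[i := x + y]) 1
        - Poly_Mapping.single (us[i := x]) 1 - Poly_Mapping.single (us[i := y]) 1
      | us i x y. us \<in> listset Us \<and> i < length Us \<and> x \<in> Us ! i \<and> y \<in> Us ! i} \<union>
     {Poly_Mapping.single (us[i := scale c x]) 1 - Poly_Mapping.single (us[i := x]) c
      | us i c x. us \<in> listset Us \<and> i < length Us \<and> x \<in> Us ! i}"

definition tensor_rel ::
    "('k::field \<Rightarrow> 'a::ab_group_add \<Rightarrow> 'a) \<Rightarrow> 'a set list \<Rightarrow> (('a list \<Rightarrow>\<^sub>0 'k) \<times> ('a list \<Rightarrow>\<^sub>0 'k)) set" where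
  "tensor_rel scale Us =
     {(p, q). Poly_Mapping.keys p \<subseteq> listset Us \<and> Poly_Mapping.keys q \<subseteq> listset Us \<and>
        p - q \<in> Modules.module.span free_scale (multilinear_relators scale Us)}"

definition tensor_space ::
    "('k::field \<Rightarrow> 'a::ab_group_add \<Rightarrow> 'a) \<Rightarrow> 'a set list \<Rightarrow> ('k, ('a list \<Rightarrow>\<^sub>0 'k) set) module" where
  "tensor_space scale Us =
     quotient_space {p. Poly_Mapping.keys p \<subseteq> listset Us} (tensor_rel scale Us) (+) 0 free_scale"

definition pure_tensor ::
    "('k::field \<Rightarrow> 'a::ab_group_add \<Rightarrow> 'a) \<Rightarrow> 'a set list \<Rightarrow> 'a list \<Rightarrow> ('a list \<Rightarrow>\<^sub>0 'k) set" where
  "pure_tensor scale Us us = tensor_rel scale Us `` {Poly_Mapping.single us 1}"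

text \<open>The linear map induced by \<open>u\<^sub>1 \<otimes> \<dots> \<otimes> u\<^sub>r \<mapsto> u\<^sub>1 \<cdots> u\<^sub>r\<close>. The inner sum is constant on
  the members of a class, because multiplication is multilinear.\<close>

definition mult_map :: "('k::field \<Rightarrow> 'a::ring_1 \<Rightarrow> 'a) \<Rightarrow> ('a list \<Rightarrow>\<^sub>0 'k) set \<Rightarrow> 'a" where
  "mult_map scale Z =
     the_elem ((\<lambda>p. \<Sum>us\<in>Poly_Mapping.keys p. scale (Poly_Mapping.lookup p us) (prod_list us)) ` Z)"

abbreviation corner_tensor ::
    "('k::field \<Rightarrow> 'a::ring_1 \<Rightarrow> 'a) \<Rightarrow> 'a \<Rightarrow> ('k, ('a list \<Rightarrow>\<^sub>0 'k) set) module" where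
  "corner_tensor scale e \<equiv> tensor_space scale [corner e 1 0, corner e 0 1]"


section \<open>The category \<open>C(A,e)\<close>\<close>

text \<open>The object \<open>X\<^bsup>\<otimes>n\<^esup>\<close> is the number \<open>n\<close>. Morphisms are expressions in the generators modulo the
  congruence generated by the axioms of a \<open>k\<close>-linear strict monoidal category and the relations
  coming from \<open>A\<close>. The generator \<open>Gen i j u\<close> is \<open>[u] : X\<^bsup>\<otimes>j\<^esup> \<rightarrow> X\<^bsup>\<otimes>i\<^esup>\<close>, where \<open>i, j \<in> {0,1}\<close> and
  \<open>u \<in> corner e i j\<close>, so it covers the four kinds of generators.
  Composition is written in the usual order: \<open>Comp g f\<close> is \<open>g \<circ> f\<close>.\<close>

datatype ('k, 'a) expr =
    Id nat
  | Gen nat nat 'a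
  | Comp "('k, 'a) expr" "('k, 'a) expr"
  | Tens "('k, 'a) expr" "('k, 'a) expr"
  | Zero nat nat
  | Add "('k, 'a) expr" "('k, 'a) expr"
  | Scal 'k "('k, 'a) expr"

text \<open>\<open>arr e t n m\<close> means that \<open>t\<close> is a well-formed expression from \<open>n\<close> to \<open>m\<close>.\<close>

inductive arr :: "'a::ring_1 \<Rightarrow> ('k, 'a) expr \<Rightarrow> nat \<Rightarrow> nat \<Rightarrow> bool" for e where
  "arr e (Id n) n n"
| "i \<le> 1 \<Longrightarrow> j \<le> 1 \<Longrightarrow> u \<in> corner e i j \<Longrightarrow> arr e (Gen i j u) j i"
| "arr e g m p \<Longrightarrow> arr e f n m \<Longrightarrow> arr e (Comp g f) n p"
| "arr e f n m \<Longrightarrow> arr e g n' m' \<Longrightarrow> arr e (Tens f g) (n + n') (m + m')"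
| "arr e (Zero n m) n m"
| "arr e f n m \<Longrightarrow> arr e g n m \<Longrightarrow> arr e (Add f g) n m"
| "arr e f n m \<Longrightarrow> arr e (Scal c f) n m"

inductive hom_eq ::
    "('k::field \<Rightarrow> 'a::ring_1 \<Rightarrow> 'a) \<Rightarrow> 'a \<Rightarrow> nat \<Rightarrow> nat \<Rightarrow> ('k, 'a) expr \<Rightarrow> ('k, 'a) expr \<Rightarrow> bool"
  for scale e where
  refl: "arr e f n m \<Longrightarrow> hom_eq scale e n m f f"
| sym: "hom_eq scale e n m f g \<Longrightarrow> hom_eq scale e n m g f"
| trans: "hom_eq scale e n m f g \<Longrightarrow> hom_eq scale e n m g h \<Longrightarrow> hom_eq scale e n m f h"
| comp_cong: "hom_eq scale e m p g g' \<Longrightarrow> hom_eq scale e n m f f' \<Longrightarrow>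
    hom_eq scale e n p (Comp g f) (Comp g' f')"
| tens_cong: "hom_eq scale e n m f f' \<Longrightarrow> hom_eq scale e n' m' g g' \<Longrightarrow>
    hom_eq scale e (n + n') (m + m') (Tens f g) (Tens f' g')"
| add_cong: "hom_eq scale e n m f f' \<Longrightarrow> hom_eq scale e n m g g' \<Longrightarrow>
    hom_eq scale e n m (Add f g) (Add f' g')"
| scal_cong: "hom_eq scale e n m f f' \<Longrightarrow> hom_eq scale e n m (Scal c f) (Scal c f')"
  \<comment> \<open>the hom-sets are vector spaces\<close>
| add_assoc: "arr e f n m \<Longrightarrow> arr e g n m \<Longrightarrow> arr e h n m \<Longrightarrow>
    hom_eq scale e n m (Add (Add f g) h) (Add f (Add g h))"
| add_comm: "arr e f n m \<Longrightarrow> arr e g n m \<Longrightarrow> hom_eq scale e n m (Add f g) (Add g f)"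
| add_zero: "arr e f n m \<Longrightarrow> hom_eq scale e n m (Add f (Zero n m)) f"
| scal_zero: "arr e f n m \<Longrightarrow> hom_eq scale e n m (Scal 0 f) (Zero n m)"
| scal_one: "arr e f n m \<Longrightarrow> hom_eq scale e n m (Scal 1 f) f"
| scal_scal: "arr e f n m \<Longrightarrow> hom_eq scale e n m (Scal c (Scal d f)) (Scal (c * d) f)"
| scal_add: "arr e f n m \<Longrightarrow> arr e g n m \<Longrightarrow>
    hom_eq scale e n m (Scal c (Add f g)) (Add (Scal c f) (Scal c g))"
| add_scal: "arr e f n m \<Longrightarrow>
    hom_eq scale e n m (Scal (c + d) f) (Add (Scal c f) (Scal d f))"
  \<comment> \<open>composition\<close>
| comp_assoc: "arr e h p q \<Longrightarrow> arr e g m p \<Longrightarrow> arr e f n m \<Longrightarrow>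
    hom_eq scale e n q (Comp (Comp h g) f) (Comp h (Comp g f))"
| id_comp: "arr e f n m \<Longrightarrow> hom_eq scale e n m (Comp (Id m) f) f"
| comp_id: "arr e f n m \<Longrightarrow> hom_eq scale e n m (Comp f (Id n)) f"
| comp_add_left: "arr e g m p \<Longrightarrow> arr e g' m p \<Longrightarrow> arr e f n m \<Longrightarrow>
    hom_eq scale e n p (Comp (Add g g') f) (Add (Comp g f) (Comp g' f))"
| comp_add_right: "arr e g m p \<Longrightarrow> arr e f n m \<Longrightarrow> arr e f' n m \<Longrightarrow>
    hom_eq scale e n p (Comp g (Add f f')) (Add (Comp g f) (Comp g f'))"
| comp_scal_left: "arr e g m p \<Longrightarrow> arr e f n m \<Longrightarrow>
    hom_eq scale e n p (Comp (Scal c g) f) (Scal c (Comp g f))"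
| comp_scal_right: "arr e g m p \<Longrightarrow> arr e f n m \<Longrightarrow>
    hom_eq scale e n p (Comp g (Scal c f)) (Scal c (Comp g f))"
  \<comment> \<open>strict monoidal structure\<close>
| tens_assoc: "arr e f n m \<Longrightarrow> arr e g n' m' \<Longrightarrow> arr e h n'' m'' \<Longrightarrow>
    hom_eq scale e (n + n' + n'') (m + m' + m'') (Tens (Tens f g) h) (Tens f (Tens g h))"
| unit_tens: "arr e f n m \<Longrightarrow> hom_eq scale e n m (Tens (Id 0) f) f"
| tens_unit: "arr e f n m \<Longrightarrow> hom_eq scale e n m (Tens f (Id 0)) f"
| tens_id: "hom_eq scale e (n + m) (n + m) (Tens (Id n) (Id m)) (Id (n + m))"
| interchange: "arr e g m p \<Longrightarrow> arr e f n m \<Longrightarrow> arr e g' m' p' \<Longrightarrow> arr e f' n' m' \<Longrightarrow>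
    hom_eq scale e (n + n') (p + p')
      (Tens (Comp g f) (Comp g' f')) (Comp (Tens g g') (Tens f f'))"
| tens_add_left: "arr e f n m \<Longrightarrow> arr e f' n m \<Longrightarrow> arr e g n' m' \<Longrightarrow>
    hom_eq scale e (n + n') (m + m') (Tens (Add f f') g) (Add (Tens f g) (Tens f' g))"
| tens_add_right: "arr e f n m \<Longrightarrow> arr e g n' m' \<Longrightarrow> arr e g' n' m' \<Longrightarrow>
    hom_eq scale e (n + n') (m + m') (Tens f (Add g g')) (Add (Tens f g) (Tens f g'))"
| tens_scal_left: "arr e f n m \<Longrightarrow> arr e g n' m' \<Longrightarrow>
    hom_eq scale e (n + n') (m + m') (Tens (Scal c f) g) (Scal c (Tens f g))"
| tens_scal_right: "arr e f n m \<Longrightarrow> arr e g n' m' \<Longrightarrow>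
    hom_eq scale e (n + n') (m + m') (Tens f (Scal c g)) (Scal c (Tens f g))"
  \<comment> \<open>relations coming from \<open>A\<close>\<close>
| gen_add: "i \<le> 1 \<Longrightarrow> j \<le> 1 \<Longrightarrow> u \<in> corner e i j \<Longrightarrow> v \<in> corner e i j \<Longrightarrow>
    hom_eq scale e j i (Gen i j (u + v)) (Add (Gen i j u) (Gen i j v))"
| gen_scal: "i \<le> 1 \<Longrightarrow> j \<le> 1 \<Longrightarrow> u \<in> corner e i j \<Longrightarrow>
    hom_eq scale e j i (Gen i j (scale c u)) (Scal c (Gen i j u))"
| gen_mult: "i \<le> 1 \<Longrightarrow> j \<le> 1 \<Longrightarrow> k \<le> 1 \<Longrightarrow> u \<in> corner e i j \<Longrightarrow> v \<in> corner e j k \<Longrightarrow>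
    hom_eq scale e k i (Comp (Gen i j u) (Gen j k v)) (Gen i k (u * v))"
| gen_id_X: "hom_eq scale e 1 1 (Gen 1 1 (1 - e)) (Id 1)"
| gen_id_unit: "hom_eq scale e 0 0 (Gen 0 0 (scale c e)) (Scal c (Id 0))"

definition hom_rel ::
    "('k::field \<Rightarrow> 'a::ring_1 \<Rightarrow> 'a) \<Rightarrow> 'a \<Rightarrow> nat \<Rightarrow> nat \<Rightarrow> (('k, 'a) expr \<times> ('k, 'a) expr) set" where
  "hom_rel scale e n m = {(f, g). hom_eq scale e n m f g}"

text \<open>\<open>hom_space scale e n m\<close> is \<open>Hom(X\<^bsup>\<otimes>n\<^esup>, X\<^bsup>\<otimes>m\<^esup>)\<close>.\<close>

definition hom_space ::
    "('k::field \<Rightarrow> 'a::ring_1 \<Rightarrow> 'a) \<Rightarrow> 'a \<Rightarrow> nat \<Rightarrow> nat \<Rightarrow> ('k, ('k, 'a) expr set) module" where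
  "hom_space scale e n m =
     quotient_space {f. arr e f n m} (hom_rel scale e n m) Add (Zero n m) Scal"


section \<open>Labeled diagrams\<close>

text \<open>A partial map is \<open>f : [1,n] \<rightharpoonup> [1,m]\<close> with \<open>L\<^sub>f = dom f\<close> and \<open>f(L\<^sub>f) = ran f\<close>; strict
  monotonicity makes it an order-preserving bijection between the two.\<close>

definition PB :: "nat \<Rightarrow> nat \<Rightarrow> (nat \<rightharpoonup> nat) set" where
  "PB m n = {f. dom f \<subseteq> {1..n} \<and> ran f \<subseteq> {1..m} \<and> strict_mono_on (dom f) (\<lambda>i. the (f i))}"

definition width :: "(nat \<rightharpoonup> nat) \<Rightarrow> nat" where
  "width f = card (dom f)"

definition tens_list :: "('k, 'a) expr list \<Rightarrow> ('k, 'a) expr" where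
  "tens_list fs = foldr Tens fs (Id 0)"

text \<open>The factors, from left to right, at the given points: \<open>1\<^sub>X\<close> at the points in \<open>L\<close>, and the
  short strands \<open>g c\<^sub>1, g c\<^sub>2, \<dots>\<close> successively at the other points.\<close>

fun row_factors ::
    "('a \<Rightarrow> ('k, 'a) expr) \<Rightarrow> nat set \<Rightarrow> nat list \<Rightarrow> 'a list \<Rightarrow> ('k, 'a) expr list" where
  "row_factors g L [] cs = []"
| "row_factors g L (i # is) cs =
     (if i \<in> L then Id 1 # row_factors g L is cs
      else g (hd cs) # row_factors g L is (tl cs))"

definition diagram_expr ::
    "nat \<Rightarrow> nat \<Rightarrow> (nat \<rightharpoonup> nat) \<Rightarrow> 'a list \<times> 'a list \<times> 'a list \<Rightarrow> ('k, 'a) expr" where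
  "diagram_expr m n f = (\<lambda>(bs, as, cs).
     Comp (tens_list (row_factors (Gen 1 0) (ran f) [1..<Suc m] bs))
       (Comp (tens_list (map (Gen 1 1) as))
         (tens_list (row_factors (Gen 0 1) (dom f) [1..<Suc n] cs))))"

definition diagram ::
    "('k::field \<Rightarrow> 'a::ring_1 \<Rightarrow> 'a) \<Rightarrow> 'a \<Rightarrow> nat \<Rightarrow> nat \<Rightarrow> (nat \<rightharpoonup> nat) \<Rightarrow>
      'a list \<times> 'a list \<times> 'a list \<Rightarrow> ('k, 'a) expr set" where
  "diagram scale e m n f l = hom_rel scale e n m `` {diagram_expr m n f l}"

text \<open>Triples \<open>(bs, as, cs)\<close> of labels for the short top, long, and short bottom strands.\<close>

definition labels ::
    "nat \<Rightarrow> nat \<Rightarrow> (nat \<rightharpoonup> nat) \<Rightarrow> 'a set \<Rightarrow> 'a set \<Rightarrow> 'a set \<Rightarrow> ('a list \<times> 'a list \<times> 'a list) set" where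
  "labels m n f B10 B11 B01 =
     listset (replicate (m - width f) B10) \<times> listset (replicate (width f) B11)
       \<times> listset (replicate (n - width f) B01)"

definition diagrams_of ::
    "('k::field \<Rightarrow> 'a::ring_1 \<Rightarrow> 'a) \<Rightarrow> 'a \<Rightarrow> 'a set \<Rightarrow> 'a set \<Rightarrow> 'a set \<Rightarrow> nat \<Rightarrow> nat \<Rightarrow>
      (nat \<rightharpoonup> nat) \<Rightarrow> ('k, 'a) expr set set" where
  "diagrams_of scale e B10 B11 B01 m n f = diagram scale e m n f ` labels m n f B10 B11 B01"

text \<open>The factors of \<open>((1-e)Ae)\<^bsup>\<otimes>(m-|f|)\<^esup> \<otimes> (A'')\<^bsup>\<otimes>|f|\<^esup> \<otimes> (eA(1-e))\<^bsup>\<otimes>(n-|f|)\<^esup>\<close>.\<close>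

definition strand_spaces ::
    "'a::ring_1 \<Rightarrow> 'a set \<Rightarrow> nat \<Rightarrow> nat \<Rightarrow> (nat \<rightharpoonup> nat) \<Rightarrow> 'a set list" where
  "strand_spaces e A'' m n f =
     replicate (m - width f) (corner e 1 0) @ replicate (width f) A''
       @ replicate (n - width f) (corner e 0 1)"

end

theory Submission
  imports Defs
begin

text \<open>
  Let \<open>B10\<close>, \<open>B01\<close> and \<open>B11\<close> be bases of \<open>(1-e)Ae\<close>, \<open>eA(1-e)\<close> and \<open>A''\<close>. Since the multiplication map
  is injective and \<open>A'\<close> and \<open>A''\<close> are complementary, the products \<open>b * c\<close> and the elements of \<open>B11\<close>
  together form a basis of \<open>(1-e)A(1-e)\<close> (\<open>dual_strand_basesI\<close>).

  Spanning. A word is a tensor product of generators \<open>\<one> \<rightarrow> X\<close>, \<open>X \<rightarrow> X\<close> and \<open>X \<rightarrow> \<one>\<close>. A composite of words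
  is a scalar multiple of a word (\<open>comp_words\<close>): the labels of strands that meet are multiplied, and
  a short bottom strand on a short top strand gives an element of \<open>eAe \<cong> k\<close>, which is a scalar. By
  linearity, labels may be restricted to bases; a long strand labelled \<open>b * c\<close> is the tensor
  product of two short strands, so that for long strands the labels in \<open>B11\<close> suffice (\<open>wspan_arr\<close>).
  Up to equivalence, a word is the labelled diagram that it describes (\<open>word_heq_diagram\<close>).

  Independence. Morphisms are told apart by their action on states. A state records a diagram with
  a fixed set of bottom points: the strands that arrive at its top points and the labels of the short
  bottom strands. An expression is put on top of the state, generator by generator. To avoid linear
  combinations of states, expressions act contravariantly on functions of states (\<open>sem\<close>). The relations
  of the category hold for the functions that are linear in each label and do not distinguish a
  long strand labelled \<open>b * c\<close> from the pair of short strands with labels \<open>b\<close> and \<open>c\<close> (\<open>sem_sound\<close>).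
  Such functions are the products of coordinates of labels with respect to the three bases
  (\<open>multilinear_state_coord\<close>), where a long strand may have to be cut and then contributes its
  coordinate at some \<open>b * c\<close>. Evaluated at the identity diagram, they are linear functionals on the hom space
  that are dual to the labelled diagrams (\<open>hom_dual_family\<close>).

  The isomorphism. The tensor products have bases of pure tensors, with dual functionals that are again
  products of coordinates. On both sides the coordinates are indexed by the labelled diagrams,
  and the coordinates of a pure tensor equal those of the diagram with the same labels,
  whether or not the labels are basis elements. Equality of coordinates therefore defines a linear
  bijection, and it sends pure tensors to diagrams (\<open>hom_direct_sum_iso\<close>).
\<close>

section \<open>Coordinates on vector spaces\<close>

text \<open>Finitely supported functions that vanish outside \<open>I\<close>.\<close>

definition finsupp_on :: "'i set \<Rightarrow> ('i \<Rightarrow> 'k::zero) set" where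
  "finsupp_on I = {g. finite {i. g i \<noteq> 0} \<and> {i. g i \<noteq> 0} \<subseteq> I}"

text \<open>A linear bijection onto the finitely supported functions on \<open>I\<close>, that is, the coordinates
  with respect to a basis indexed by \<open>I\<close>.\<close>

definition coordinate_map :: "('k::field, 'v) module \<Rightarrow> 'i set \<Rightarrow> ('v \<Rightarrow> 'i \<Rightarrow> 'k) \<Rightarrow> bool" where
  "coordinate_map V I c \<longleftrightarrow> bij_betw c (carrier V) (finsupp_on I) \<and>
     (\<forall>x\<in>carrier V. \<forall>y\<in>carrier V. \<forall>i. c (x \<oplus>\<^bsub>V\<^esub> y) i = c x i + c y i) \<and>
     (\<forall>a. \<forall>x\<in>carrier V. \<forall>i. c (a \<odot>\<^bsub>V\<^esub> x) i = a * c x i)"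

lemma field_class_ring: "field (class_ring :: 'k::field ring)"
  by (rule class_field.field_axioms)

text \<open>Vectors \<open>v i\<close> that span \<open>V\<close>, with linear functionals \<open>\<lambda>x. c x i\<close> dual to them. Such vectors form
  a basis, and \<open>c\<close> gives the coordinates with respect to it. The functionals with index outside \<open>I\<close>
  vanish, so that \<open>c x\<close> is supported in \<open>I\<close>.\<close>

locale dual_family = vectorspace class_ring V
  for V :: "('k::field, 'v) module" +
  fixes I :: "'i set" and v :: "'i \<Rightarrow> 'v" and c :: "'v \<Rightarrow> 'i \<Rightarrow> 'k"
  assumes v_closed: "i \<in> I \<Longrightarrow> v i \<in> carrier V"
    and c_add: "x \<in> carrier V \<Longrightarrow> y \<in> carrier V \<Longrightarrow> c (x \<oplus>\<^bsub>V\<^esub> y) i = c x i + c y i"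
    and c_smult: "x \<in> carrier V \<Longrightarrow> c (a \<odot>\<^bsub>V\<^esub> x) i = a * c x i"
    and c_dual: "i \<in> I \<Longrightarrow> j \<in> I \<Longrightarrow> c (v i) j = (if i = j then 1 else 0)"
    and c_outside: "x \<in> carrier V \<Longrightarrow> j \<notin> I \<Longrightarrow> c x j = 0"
    and spanning: "carrier V \<subseteq> span (v ` I)"
begin

lemma c_zero: "c \<zero>\<^bsub>V\<^esub> i = 0"
proof -
  have "0 \<odot>\<^bsub>V\<^esub> \<zero>\<^bsub>V\<^esub> = \<zero>\<^bsub>V\<^esub>" using smult_l_null[of "\<zero>\<^bsub>V\<^esub>"] by simp
  then show ?thesis using c_smult[of "\<zero>\<^bsub>V\<^esub>" 0 i] by simp
qed

lemma c_lincomb: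
  assumes "finite A" "A \<subseteq> carrier V"
  shows "c (lincomb a A) i = (\<Sum>w\<in>A. a w * c w i)"
  using assms
proof (induction A rule: finite_induct)
  case empty
  then show ?case by (simp add: lincomb_def c_zero)
next
  case (insert w A)
  have "lincomb a (insert w A) = a w \<odot>\<^bsub>V\<^esub> w \<oplus>\<^bsub>V\<^esub> lincomb a A"
    using insert lincomb_insert[of A a w] by simp
  moreover have "a w \<odot>\<^bsub>V\<^esub> w \<in> carrier V"
    using insert.prems by (intro smult_closed) simp_all
  moreover have "lincomb a A \<in> carrier V"
    using insert.prems by (intro lincomb_closed) simp_all
  ultimately show ?case using insert by (simp add: c_add c_smult)
qed

lemma inj_on_v: "inj_on v I"
proof (rule inj_onI)
  fix i j assume ij: "i \<in> I" "j \<in> I" "v i = v j"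
  then have "c (v j) i = 1" using c_dual[of i i] by simp
  then show "i = j" using ij c_dual[of j i] by (simp split: if_splits)
qed

lemma c_lincomb_v:
  assumes "finite J" "J \<subseteq> I"
  shows "c (lincomb a (v ` J)) i = (if i \<in> J then a (v i) else 0)"
proof -
  have sub: "v ` J \<subseteq> carrier V" using assms v_closed by auto
  have inj: "inj_on v J" using inj_on_v assms(2) by (rule inj_on_subset)
  have "c (lincomb a (v ` J)) i = (\<Sum>j\<in>J. a (v j) * c (v j) i)"
    using assms sub inj by (simp add: c_lincomb sum.reindex)
  also have "\<dots> = (if i \<in> J then a (v i) else 0)"
  proof (cases "i \<in> I")
    case True
    then have "(\<Sum>j\<in>J. a (v j) * c (v j) i) = (\<Sum>j\<in>J. if j = i then a (v j) else 0)"
      using assms by (intro sum.cong) (auto simp: c_dual subset_iff)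
    then show ?thesis using assms by simp
  next
    case False
    then show ?thesis using assms by (auto intro!: sum.neutral simp: c_outside v_closed subset_iff)
  qed
  finally show ?thesis .
qed

lemma basis_v: "basis (v ` I)"
proof -
  have sub: "v ` I \<subseteq> carrier V" using v_closed by auto
  have "lin_indpt (v ` I)"
  proof
    assume "lin_dep (v ` I)"
    then obtain A a w where A: "finite A" "A \<subseteq> v ` I" "lincomb a A = \<zero>\<^bsub>V\<^esub>" "w \<in> A"
      "a w \<noteq> \<zero>\<^bsub>class_ring\<^esub>"
      unfolding lin_dep_def by blast
    obtain J where J: "finite J" "J \<subseteq> I" "A = v ` J"
      using finite_subset_image[OF A(1,2)] by metis
    then obtain j where j: "j \<in> J" "w = v j" using A by auto
    have "a (v j) = c (lincomb a (v ` J)) j" using c_lincomb_v[OF J(1,2)] j by simp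
    then show False using A(3,5) J(3) j(2) c_zero by simp
  qed
  moreover have "span (v ` I) = carrier V" using spanning span_is_subset2[OF sub] by auto
  ultimately show ?thesis using sub unfolding basis_def by blast
qed

lemma coordinate_map: "coordinate_map V I c"
proof -
  have repr: "\<exists>J a. finite J \<and> J \<subseteq> I \<and> x = lincomb a (v ` J)" if x: "x \<in> carrier V" for x
  proof -
    obtain A a where A: "finite A" "A \<subseteq> v ` I" "x = lincomb a A"
    proof -
      have "x \<in> span (v ` I)" using x spanning by (rule subsetD[rotated])
      then show thesis unfolding span_def mem_Collect_eq by (elim exE conjE) (rule that; assumption)
    qed
    then show ?thesis using finite_subset_image[OF A(1,2)] by metis
  qed
  have "inj_on c (carrier V)"
  proof (rule inj_onI)
    fix x y assume xy: "x \<in> carrier V" "y \<in> carrier V" "c x = c y"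
    define z where "z = x \<oplus>\<^bsub>V\<^esub> (- 1) \<odot>\<^bsub>V\<^esub> y"
    have ny: "(- 1) \<odot>\<^bsub>V\<^esub> y = \<ominus>\<^bsub>V\<^esub> y"
      using smult_l_minus[of 1 y] smult_one[of y] xy(2) by (simp add: class_ring_simps)
    have z: "z \<in> carrier V" unfolding z_def ny using xy by auto
    have cz: "c z i = 0" for i
      unfolding z_def using xy by (simp add: c_add c_smult smult_closed)
    obtain J a where J: "finite J" "J \<subseteq> I" "z = lincomb a (v ` J)" using repr[OF z] by blast
    have "a w = 0" if w: "w \<in> v ` J" for w
    proof -
      obtain j where "j \<in> J" "w = v j" using w by blast
      then show ?thesis using c_lincomb_v[OF J(1,2), of a j] cz[of j] unfolding J(3) by simp
    qed
    moreover have "v ` J \<subseteq> carrier V" using J(2) v_closed by auto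
    ultimately have "a w \<odot>\<^bsub>V\<^esub> w = \<zero>\<^bsub>V\<^esub>" if "w \<in> v ` J" for w
      using smult_l_null[of w] that by auto
    then have "z = (\<Oplus>\<^bsub>V\<^esub>w\<in>v ` J. \<zero>\<^bsub>V\<^esub>)"
      unfolding J(3) lincomb_def by (intro finsum_cong') auto
    then have "z = \<zero>\<^bsub>V\<^esub>" by simp
    then show "x = y"
      unfolding z_def ny using xy by (metis M.minus_equality M.minus_minus M.a_inv_closed M.a_comm)
  qed
  moreover have "c ` carrier V = finsupp_on I"
  proof (intro equalityI subsetI)
    fix g assume "g \<in> c ` carrier V"
    then obtain x where x: "x \<in> carrier V" "g = c x" by blast
    obtain J a where J: "finite J" "J \<subseteq> I" "x = lincomb a (v ` J)" using repr[OF x(1)] by blast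
    have "{i. g i \<noteq> 0} \<subseteq> J" using c_lincomb_v[OF J(1,2)] x(2) J(3) by auto
    then show "g \<in> finsupp_on I"
      using J(2) finite_subset[OF _ J(1)] by (auto simp: finsupp_on_def)
  next
    fix g :: "'i \<Rightarrow> 'k" assume g: "g \<in> finsupp_on I"
    define J where "J = {i. g i \<noteq> 0}"
    have J: "finite J" "J \<subseteq> I" using g by (auto simp: finsupp_on_def J_def)
    define x where "x = lincomb (g \<circ> inv_into I v) (v ` J)"
    have "x \<in> carrier V" unfolding x_def using J v_closed
      by (intro lincomb_closed) auto
    moreover have "c x = g"
    proof
      fix i show "c x i = g i"
        proof (cases "i \<in> J")
        case True
        then show ?thesis unfolding x_def c_lincomb_v[OF J] using J(2) inj_on_v by auto
      next
        case False
        then show ?thesis unfolding x_def c_lincomb_v[OF J] by (simp add: J_def)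
      qed
    qed
    ultimately show "g \<in> c ` carrier V" by blast
  qed
  ultimately show ?thesis
    unfolding coordinate_map_def bij_betw_def using c_add c_smult by blast
qed

end

text \<open>Two spaces with coordinates in the same index set are identified by equality of coordinates.\<close>

lemma linear_map_of_coordinates:
  assumes V: "vectorspace class_ring V" and W: "vectorspace class_ring W"
    and b: "coordinate_map V I b" and c: "coordinate_map W I c"
  defines "\<Phi> \<equiv> \<lambda>x. inv_into (carrier W) c (b x)"
  shows "linear_map class_ring V W \<Phi>" "bij_betw \<Phi> (carrier V) (carrier W)"
    and "x \<in> carrier V \<Longrightarrow> y \<in> carrier W \<Longrightarrow> b x = c y \<Longrightarrow> \<Phi> x = y"
proof -
  interpret V: vectorspace "class_ring :: 'a ring" V by fact
  interpret W: vectorspace "class_ring :: 'a ring" W by fact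
  have bb: "bij_betw b (carrier V) (finsupp_on I)" and cb: "bij_betw c (carrier W) (finsupp_on I)"
    using b c by (auto simp: coordinate_map_def)
  show bij: "bij_betw \<Phi> (carrier V) (carrier W)"
    using bij_betw_trans[OF bb bij_betw_inv_into[OF cb]] by (simp add: \<Phi>_def comp_def)
  show char: "\<Phi> x = y" if "x \<in> carrier V" "y \<in> carrier W" "b x = c y" for x y
    unfolding \<Phi>_def that(3) using cb that(2) by (simp add: bij_betw_inv_into_left)
  have cl: "\<Phi> x \<in> carrier W" if "x \<in> carrier V" for x
    using bij that by (auto simp: bij_betw_def)
  have c\<Phi>: "c (\<Phi> x) = b x" if "x \<in> carrier V" for x
    unfolding \<Phi>_def using that bb cb by (auto simp: bij_betw_def intro!: f_inv_into_f)
  have "\<Phi> (x \<oplus>\<^bsub>V\<^esub> y) = \<Phi> x \<oplus>\<^bsub>W\<^esub> \<Phi> y" if "x \<in> carrier V" "y \<in> carrier V" for x y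
    using that b c cl c\<Phi> by (intro char) (auto simp: coordinate_map_def)
  moreover have "\<Phi> (a \<odot>\<^bsub>V\<^esub> x) = a \<odot>\<^bsub>W\<^esub> \<Phi> x" if "x \<in> carrier V" for a x
    using that b c cl c\<Phi>
    by (intro char V.smult_closed W.smult_closed) (auto simp: coordinate_map_def)
  ultimately have "\<Phi> \<in> LinearCombinations.module_hom class_ring V W"
    using cl by (auto simp: LinearCombinations.module_hom_def)
  then show "linear_map class_ring V W \<Phi>"
    using V W V.module_axioms W.module_axioms
    by (intro linear_map.intro mod_hom.intro mod_hom_axioms.intro)
qed

section \<open>Quotient spaces\<close>

text \<open>Vector space operations that satisfy the axioms up to an equivalence relation.\<close>

locale pre_vectorspace =
  fixes S :: "'v set" and r :: "('v \<times> 'v) set" and add0 :: "'v \<Rightarrow> 'v \<Rightarrow> 'v" and zero0 :: 'v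
    and smult0 :: "'k::field \<Rightarrow> 'v \<Rightarrow> 'v"
  assumes equiv: "equiv S r"
    and zero_in: "zero0 \<in> S"
    and add_in: "x \<in> S \<Longrightarrow> y \<in> S \<Longrightarrow> add0 x y \<in> S"
    and smult_in: "x \<in> S \<Longrightarrow> smult0 a x \<in> S"
    and add_resp: "(x, x') \<in> r \<Longrightarrow> (y, y') \<in> r \<Longrightarrow> (add0 x y, add0 x' y') \<in> r"
    and smult_resp: "(x, x') \<in> r \<Longrightarrow> (smult0 a x, smult0 a x') \<in> r"
    and assoc: "x \<in> S \<Longrightarrow> y \<in> S \<Longrightarrow> z \<in> S \<Longrightarrow> (add0 (add0 x y) z, add0 x (add0 y z)) \<in> r"
    and comm: "x \<in> S \<Longrightarrow> y \<in> S \<Longrightarrow> (add0 x y, add0 y x) \<in> r"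
    and add_zero: "x \<in> S \<Longrightarrow> (add0 x zero0, x) \<in> r"
    and smult_zero: "x \<in> S \<Longrightarrow> (smult0 0 x, zero0) \<in> r"
    and smult_one: "x \<in> S \<Longrightarrow> (smult0 1 x, x) \<in> r"
    and smult_smult: "x \<in> S \<Longrightarrow> (smult0 (a * b) x, smult0 a (smult0 b x)) \<in> r"
    and smult_add: "x \<in> S \<Longrightarrow> y \<in> S \<Longrightarrow> (smult0 a (add0 x y), add0 (smult0 a x) (smult0 a y)) \<in> r"
    and add_smult: "x \<in> S \<Longrightarrow> (smult0 (a + b) x, add0 (smult0 a x) (smult0 b x)) \<in> r"
begin

abbreviation "Q \<equiv> quotient_space S r add0 zero0 smult0"
abbreviation "cls x \<equiv> r `` {x}"

lemma cls_eq: "(x, y) \<in> r \<Longrightarrow> cls x = cls y"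
  using equiv by (rule equiv_class_eq)

lemma cls_in: "x \<in> S \<Longrightarrow> cls x \<in> carrier Q"
  by (simp add: quotient_space_def quotientI)

lemma cls_cases:
  assumes "X \<in> carrier Q"
  obtains x where "x \<in> S" "X = cls x"
  using assms by (auto simp: quotient_space_def elim: quotientE)

lemma zero_cls: "\<zero>\<^bsub>Q\<^esub> = cls zero0"
  by (simp add: quotient_space_def)

lemma add_cls:
  assumes "x \<in> S" "y \<in> S"
  shows "cls x \<oplus>\<^bsub>Q\<^esub> cls y = cls (add0 x y)"
proof -
  have "congruent2 r r (\<lambda>x y. cls (add0 x y))"
    using equiv by (intro congruent2I') (auto intro!: cls_eq[OF add_resp])
  then show ?thesis
    using UN_equiv_class2[OF equiv equiv] assms by (simp add: quotient_space_def)
qed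

lemma smult_cls:
  assumes "x \<in> S"
  shows "a \<odot>\<^bsub>Q\<^esub> cls x = cls (smult0 a x)"
proof -
  have "congruent r (\<lambda>x. cls (smult0 a x))"
    by (intro congruentI) (auto intro!: cls_eq[OF smult_resp])
  then show ?thesis
    using UN_equiv_class[OF equiv] assms by (simp add: quotient_space_def)
qed

lemmas cls_simps = add_cls smult_cls zero_cls add_in smult_in zero_in cls_in

lemma vectorspace_quotient: "vectorspace class_ring Q"
proof (rule vs_criteria)
  show "\<forall>x\<in>carrier Q. \<exists>y\<in>carrier Q. x \<oplus>\<^bsub>Q\<^esub> y = \<zero>\<^bsub>Q\<^esub>"
  proof
    fix X assume "X \<in> carrier Q"
    then obtain x where x: "x \<in> S" "X = cls x" by (rule cls_cases)
    have "cls (add0 x (smult0 (- 1) x)) = cls x \<oplus>\<^bsub>Q\<^esub> cls (smult0 (- 1) x)"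
      using x by (simp add: add_cls smult_in)
    also have "\<dots> = cls (add0 (smult0 1 x) (smult0 (- 1) x))"
      using x cls_eq[OF smult_one[OF x(1)]] by (simp add: add_cls[symmetric] smult_in)
    also have "\<dots> = cls (smult0 (1 + - 1) x)"
      by (rule cls_eq[OF add_smult[OF x(1)], symmetric])
    also have "\<dots> = cls zero0"
      by (simp only: add.right_inverse) (rule cls_eq[OF smult_zero[OF x(1)]])
    finally have "cls (add0 x (smult0 (- 1) x)) = cls zero0" .
    then show "\<exists>y\<in>carrier Q. X \<oplus>\<^bsub>Q\<^esub> y = \<zero>\<^bsub>Q\<^esub>"
      using x by (intro bexI[of _ "cls (smult0 (- 1) x)"]) (simp_all add: cls_simps)
  qed
  show "\<forall>x y. x \<in> carrier Q \<and> y \<in> carrier Q \<longrightarrow> x \<oplus>\<^bsub>Q\<^esub> y = y \<oplus>\<^bsub>Q\<^esub> x"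
    by (clarsimp elim!: cls_cases simp: cls_simps) (rule cls_eq, rule comm; assumption)
  show "\<forall>x y z. x \<in> carrier Q \<and> y \<in> carrier Q \<and> z \<in> carrier Q \<longrightarrow>
      x \<oplus>\<^bsub>Q\<^esub> y \<oplus>\<^bsub>Q\<^esub> z = x \<oplus>\<^bsub>Q\<^esub> (y \<oplus>\<^bsub>Q\<^esub> z)"
    by (clarsimp elim!: cls_cases simp: cls_simps) (rule cls_eq, rule assoc; assumption)
  show "\<forall>x\<in>carrier Q. x \<oplus>\<^bsub>Q\<^esub> \<zero>\<^bsub>Q\<^esub> = x"
    by (clarsimp elim!: cls_cases simp: cls_simps) (rule cls_eq, rule add_zero; assumption)
  show "\<forall>a b x. a \<in> carrier class_ring \<and> b \<in> carrier class_ring \<and> x \<in> carrier Q \<longrightarrow>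
      a \<otimes>\<^bsub>class_ring\<^esub> b \<odot>\<^bsub>Q\<^esub> x = a \<odot>\<^bsub>Q\<^esub> (b \<odot>\<^bsub>Q\<^esub> x)"
    by (clarsimp elim!: cls_cases simp: cls_simps) (rule cls_eq, rule smult_smult; assumption)
  show "\<forall>x\<in>carrier Q. \<one>\<^bsub>class_ring\<^esub> \<odot>\<^bsub>Q\<^esub> x = x"
    by (clarsimp elim!: cls_cases simp: cls_simps) (rule cls_eq, rule smult_one; assumption)
  show "\<forall>a b x. a \<in> carrier class_ring \<and> b \<in> carrier class_ring \<and> x \<in> carrier Q \<longrightarrow>
      (a \<oplus>\<^bsub>class_ring\<^esub> b) \<odot>\<^bsub>Q\<^esub> x = a \<odot>\<^bsub>Q\<^esub> x \<oplus>\<^bsub>Q\<^esub> b \<odot>\<^bsub>Q\<^esub> x"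
    by (clarsimp elim!: cls_cases simp: cls_simps) (rule cls_eq, rule add_smult; assumption)
  show "\<forall>a x y. a \<in> carrier class_ring \<and> x \<in> carrier Q \<and> y \<in> carrier Q \<longrightarrow>
      a \<odot>\<^bsub>Q\<^esub> (x \<oplus>\<^bsub>Q\<^esub> y) = a \<odot>\<^bsub>Q\<^esub> x \<oplus>\<^bsub>Q\<^esub> a \<odot>\<^bsub>Q\<^esub> y"
    by (clarsimp elim!: cls_cases simp: cls_simps) (rule cls_eq, rule smult_add; assumption)
  show "field (class_ring :: 'k ring)" by (rule field_class_ring)
  show "\<forall>x y. x \<in> carrier Q \<and> y \<in> carrier Q \<longrightarrow> x \<oplus>\<^bsub>Q\<^esub> y \<in> carrier Q"
    by (clarify, elim cls_cases) (simp add: cls_simps)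
  show "\<forall>a x. a \<in> carrier class_ring \<and> x \<in> carrier Q \<longrightarrow> a \<odot>\<^bsub>Q\<^esub> x \<in> carrier Q"
    by (clarify, elim cls_cases) (simp add: cls_simps)
  show "\<zero>\<^bsub>Q\<^esub> \<in> carrier Q"
    unfolding zero_cls by (rule cls_in) (rule zero_in)
qed

end

section \<open>Direct sums\<close>

lemma coordinate_map_zero:
  assumes "vectorspace class_ring V" "coordinate_map V I c"
  shows "c \<zero>\<^bsub>V\<^esub> i = 0"
proof -
  interpret vectorspace class_ring V by fact
  have "0 \<odot>\<^bsub>V\<^esub> \<zero>\<^bsub>V\<^esub> = \<zero>\<^bsub>V\<^esub>" using smult_l_null[of "\<zero>\<^bsub>V\<^esub>"] by simp
  moreover have "c (0 \<odot>\<^bsub>V\<^esub> \<zero>\<^bsub>V\<^esub>) i = 0 * c \<zero>\<^bsub>V\<^esub> i"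
    using assms(2) M.zero_closed unfolding coordinate_map_def by blast
  ultimately show ?thesis by simp
qed

lemma coordinate_map_reindex:
  fixes V :: "('k::field, 'v) module" and I :: "'i set" and J :: "'j set"
  assumes c: "coordinate_map V I c" and h: "bij_betw h J I"
  shows "coordinate_map V J (\<lambda>x j. if j \<in> J then c x (h j) else 0)"
proof -
  have bij: "bij_betw c (carrier V) (finsupp_on I)" using c by (simp add: coordinate_map_def)
  define r where "r = (\<lambda>(g :: 'i \<Rightarrow> 'k) j. if j \<in> J then g (h j) else 0)"
  define r' where "r' = (\<lambda>(g :: 'j \<Rightarrow> 'k) i. if i \<in> I then g (inv_into J h i) else 0)"
  have "bij_betw r (finsupp_on I) (finsupp_on J)"
  proof (rule bij_betwI[where g = r'])
    have "r g \<in> finsupp_on J" if g: "g \<in> finsupp_on I" for g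
    proof -
      have "{j. r g j \<noteq> 0} \<subseteq> inv_into J h ` {i. g i \<noteq> 0}"
        using h by (force simp: r_def bij_betw_def image_iff split: if_splits)
      then have "finite {j. r g j \<noteq> 0}"
        using g finite_subset[OF _ finite_imageI] by (auto simp: finsupp_on_def)
      then show ?thesis by (auto simp: finsupp_on_def r_def split: if_splits)
    qed
    then show "r \<in> finsupp_on I \<rightarrow> finsupp_on J" by auto
    have "r' g \<in> finsupp_on I" if g: "g \<in> finsupp_on J" for g
    proof -
      have "{i. r' g i \<noteq> 0} \<subseteq> h ` {j. g j \<noteq> 0}"
        using h by (force simp: r'_def bij_betw_def image_iff f_inv_into_f split: if_splits)
      then have "finite {i. r' g i \<noteq> 0}"
        using g finite_subset[OF _ finite_imageI] by (auto simp: finsupp_on_def)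
      then show ?thesis by (auto simp: finsupp_on_def r'_def split: if_splits)
    qed
    then show "r' \<in> finsupp_on J \<rightarrow> finsupp_on I" by auto
    show "r' (r g) = g" if "g \<in> finsupp_on I" for g
    proof
      fix i show "r' (r g) i = g i"
        using that h by (cases "i \<in> I")
          (auto simp: r_def r'_def finsupp_on_def bij_betw_def f_inv_into_f inv_into_into)
    qed
    show "r (r' g) = g" if "g \<in> finsupp_on J" for g
    proof
      fix j show "r (r' g) j = g j"
        using that h by (cases "j \<in> J") (auto simp: r_def r'_def finsupp_on_def bij_betw_def)
    qed
  qed
  from bij_betw_trans[OF bij this]
  have "bij_betw (\<lambda>x j. if j \<in> J then c x (h j) else 0) (carrier V) (finsupp_on J)"
    by (simp add: comp_def r_def)
  then show ?thesis using c by (simp add: coordinate_map_def)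
qed

lemma direct_sum_simps:
  "x \<in> carrier (direct_sum_space I V) \<longleftrightarrow>
     x \<in> (\<Pi>\<^sub>E i\<in>I. carrier (V i)) \<and> finite {i \<in> I. x i \<noteq> \<zero>\<^bsub>V i\<^esub>}"
  "\<zero>\<^bsub>direct_sum_space I V\<^esub> = (\<lambda>i\<in>I. \<zero>\<^bsub>V i\<^esub>)"
  "x \<oplus>\<^bsub>direct_sum_space I V\<^esub> y = (\<lambda>i\<in>I. x i \<oplus>\<^bsub>V i\<^esub> y i)"
  "a \<odot>\<^bsub>direct_sum_space I V\<^esub> x = (\<lambda>i\<in>I. a \<odot>\<^bsub>V i\<^esub> x i)"
  by (simp_all add: direct_sum_space_def)

lemma vectorspace_direct_sum:
  fixes V :: "'i \<Rightarrow> ('k::field, 'v) module"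
  assumes V: "\<And>i. i \<in> I \<Longrightarrow> vectorspace class_ring (V i)"
  shows "vectorspace class_ring (direct_sum_space I V)"
proof -
  let ?D = "direct_sum_space I V"
  have module: "module class_ring (V i)" if "i \<in> I" for i
    using V[OF that] by (simp add: vectorspace_def)
  have ag: "abelian_group (V i)" if "i \<in> I" for i
    by (rule module.axioms(2)[OF module[OF that]])
  note am = abelian_group.axioms(1)[OF ag]
  have zero: "\<zero>\<^bsub>V i\<^esub> \<in> carrier (V i)" if "i \<in> I" for i
    using abelian_monoid.zero_closed[OF am[OF that]] .
  have add: "x \<oplus>\<^bsub>V i\<^esub> y \<in> carrier (V i)" if "i \<in> I" "x \<in> carrier (V i)" "y \<in> carrier (V i)" for i x y
    using abelian_monoid.a_closed[OF am[OF that(1)] that(2,3)] .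
  have smult: "a \<odot>\<^bsub>V i\<^esub> x \<in> carrier (V i)" if "i \<in> I" "x \<in> carrier (V i)" for i x a
    using module.smult_closed[OF module[OF that(1)] _ that(2)] by simp
  have zero_add: "\<zero>\<^bsub>V i\<^esub> \<oplus>\<^bsub>V i\<^esub> x = x" "x \<oplus>\<^bsub>V i\<^esub> \<zero>\<^bsub>V i\<^esub> = x" if "i \<in> I" "x \<in> carrier (V i)" for i x
    using abelian_monoid.l_zero[OF am[OF that(1)] that(2)] abelian_monoid.r_zero[OF am[OF that(1)] that(2)] .
  have smult_zero: "a \<odot>\<^bsub>V i\<^esub> \<zero>\<^bsub>V i\<^esub> = \<zero>\<^bsub>V i\<^esub>" if "i \<in> I" for i a
    using module.smult_r_null[OF module[OF that], of a] by simp
  have null: "0 \<odot>\<^bsub>V i\<^esub> x = \<zero>\<^bsub>V i\<^esub>" if "i \<in> I" "x \<in> carrier (V i)" for i x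
    using module.smult_l_null[OF module[OF that(1)] that(2)] by simp
  have one: "1 \<odot>\<^bsub>V i\<^esub> x = x" if "i \<in> I" "x \<in> carrier (V i)" for i x
    using module.smult_one[OF module[OF that(1)] that(2)] by simp
  have add_smult: "(a + b) \<odot>\<^bsub>V i\<^esub> x = a \<odot>\<^bsub>V i\<^esub> x \<oplus>\<^bsub>V i\<^esub> b \<odot>\<^bsub>V i\<^esub> x"
    if "i \<in> I" "x \<in> carrier (V i)" for i x a b
    using module.smult_l_distr[OF module[OF that(1)], of a b x] that(2) by simp
  have smult_add: "a \<odot>\<^bsub>V i\<^esub> (x \<oplus>\<^bsub>V i\<^esub> y) = a \<odot>\<^bsub>V i\<^esub> x \<oplus>\<^bsub>V i\<^esub> a \<odot>\<^bsub>V i\<^esub> y"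
    if "i \<in> I" "x \<in> carrier (V i)" "y \<in> carrier (V i)" for i x y a
    using module.smult_r_distr[OF module[OF that(1)], of a x y] that(2,3) by simp
  have smult_smult: "(a * b) \<odot>\<^bsub>V i\<^esub> x = a \<odot>\<^bsub>V i\<^esub> (b \<odot>\<^bsub>V i\<^esub> x)" if "i \<in> I" "x \<in> carrier (V i)" for i x a b
    using module.smult_assoc1[OF module[OF that(1)], of a b x] that(2) by simp
  have mem: "i \<in> I \<Longrightarrow> x \<in> carrier ?D \<Longrightarrow> x i \<in> carrier (V i)" for x i
    by (auto simp: direct_sum_simps)
  have add_closed: "x \<oplus>\<^bsub>?D\<^esub> y \<in> carrier ?D" if xy: "x \<in> carrier ?D" "y \<in> carrier ?D" for x y
  proof -
    have "{i \<in> I. x i \<oplus>\<^bsub>V i\<^esub> y i \<noteq> \<zero>\<^bsub>V i\<^esub>} \<subseteq> {i \<in> I. x i \<noteq> \<zero>\<^bsub>V i\<^esub>} \<union> {i \<in> I. y i \<noteq> \<zero>\<^bsub>V i\<^esub>}"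
    proof
      fix i assume i: "i \<in> {i \<in> I. x i \<oplus>\<^bsub>V i\<^esub> y i \<noteq> \<zero>\<^bsub>V i\<^esub>}"
      then have "x i \<noteq> \<zero>\<^bsub>V i\<^esub> \<or> y i \<noteq> \<zero>\<^bsub>V i\<^esub>" using zero_add(1)[of i] zero[of i] by auto
      then show "i \<in> {i \<in> I. x i \<noteq> \<zero>\<^bsub>V i\<^esub>} \<union> {i \<in> I. y i \<noteq> \<zero>\<^bsub>V i\<^esub>}" using i by blast
    qed
    moreover have "finite ({i \<in> I. x i \<noteq> \<zero>\<^bsub>V i\<^esub>} \<union> {i \<in> I. y i \<noteq> \<zero>\<^bsub>V i\<^esub>})"
      using xy by (simp add: direct_sum_simps(1))
    ultimately have "finite {i \<in> I. x i \<oplus>\<^bsub>V i\<^esub> y i \<noteq> \<zero>\<^bsub>V i\<^esub>}" by (rule finite_subset)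
    moreover have "{i \<in> I. (x \<oplus>\<^bsub>?D\<^esub> y) i \<noteq> \<zero>\<^bsub>V i\<^esub>} = {i \<in> I. x i \<oplus>\<^bsub>V i\<^esub> y i \<noteq> \<zero>\<^bsub>V i\<^esub>}"
      by (auto simp: direct_sum_simps(3))
    moreover have "x \<oplus>\<^bsub>?D\<^esub> y \<in> (\<Pi>\<^sub>E i\<in>I. carrier (V i))"
      unfolding direct_sum_simps(3) using add mem xy by simp
    ultimately show ?thesis by (simp only: direct_sum_simps(1))
  qed
  have smult_closed: "a \<odot>\<^bsub>?D\<^esub> x \<in> carrier ?D" if x: "x \<in> carrier ?D" for a x
  proof -
    have "{i \<in> I. a \<odot>\<^bsub>V i\<^esub> x i \<noteq> \<zero>\<^bsub>V i\<^esub>} \<subseteq> {i \<in> I. x i \<noteq> \<zero>\<^bsub>V i\<^esub>}"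
      using smult_zero by auto
    moreover have "finite {i \<in> I. x i \<noteq> \<zero>\<^bsub>V i\<^esub>}"
      using x by (simp add: direct_sum_simps(1))
    ultimately have "finite {i \<in> I. a \<odot>\<^bsub>V i\<^esub> x i \<noteq> \<zero>\<^bsub>V i\<^esub>}" by (rule finite_subset)
    moreover have "{i \<in> I. (a \<odot>\<^bsub>?D\<^esub> x) i \<noteq> \<zero>\<^bsub>V i\<^esub>} = {i \<in> I. a \<odot>\<^bsub>V i\<^esub> x i \<noteq> \<zero>\<^bsub>V i\<^esub>}"
      by (auto simp: direct_sum_simps(4))
    moreover have "a \<odot>\<^bsub>?D\<^esub> x \<in> (\<Pi>\<^sub>E i\<in>I. carrier (V i))"
      unfolding direct_sum_simps(4) using smult mem x by simp
    ultimately show ?thesis by (simp only: direct_sum_simps(1))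
  qed
  have zero_closed: "\<zero>\<^bsub>?D\<^esub> \<in> carrier ?D"
  proof -
    have "{i \<in> I. \<zero>\<^bsub>?D\<^esub> i \<noteq> \<zero>\<^bsub>V i\<^esub>} = {}" by (auto simp: direct_sum_simps(2))
    moreover have "\<zero>\<^bsub>?D\<^esub> \<in> (\<Pi>\<^sub>E i\<in>I. carrier (V i))"
      unfolding direct_sum_simps(2) using zero by simp
    ultimately show ?thesis by (simp only: direct_sum_simps(1) finite.emptyI simp_thms)
  qed
  have eqI: "x = y" if "x \<in> extensional I" "y \<in> extensional I" "\<And>i. i \<in> I \<Longrightarrow> x i = y i" for x y :: "'i \<Rightarrow> 'v"
    using extensionalityI[OF that(1,2)] that(3) by auto
  have ext: "x \<in> carrier ?D \<Longrightarrow> x \<in> extensional I" for x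
    by (auto simp: direct_sum_simps PiE_def)
  show ?thesis
  proof (rule vs_criteria)
    show "field (class_ring :: 'k ring)" by (rule field_class_ring)
    show "\<zero>\<^bsub>?D\<^esub> \<in> carrier ?D" by (rule zero_closed)
    show "\<forall>x y. x \<in> carrier ?D \<and> y \<in> carrier ?D \<longrightarrow> x \<oplus>\<^bsub>?D\<^esub> y \<in> carrier ?D"
      using add_closed by blast
    show "\<forall>a x. a \<in> carrier class_ring \<and> x \<in> carrier ?D \<longrightarrow> a \<odot>\<^bsub>?D\<^esub> x \<in> carrier ?D"
      using smult_closed by blast
    show "\<forall>x\<in>carrier ?D. \<exists>y\<in>carrier ?D. x \<oplus>\<^bsub>?D\<^esub> y = \<zero>\<^bsub>?D\<^esub>"
    proof
      fix x assume x: "x \<in> carrier ?D"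
      have "x i \<oplus>\<^bsub>V i\<^esub> (- 1) \<odot>\<^bsub>V i\<^esub> x i = \<zero>\<^bsub>V i\<^esub>" if "i \<in> I" for i
        using add_smult[OF that mem[OF that x], of 1 "- 1"] one[OF that mem[OF that x]]
          null[OF that mem[OF that x]] by simp
      then have "x \<oplus>\<^bsub>?D\<^esub> (- 1) \<odot>\<^bsub>?D\<^esub> x = \<zero>\<^bsub>?D\<^esub>"
        by (intro eqI) (simp_all add: direct_sum_simps)
      then show "\<exists>y\<in>carrier ?D. x \<oplus>\<^bsub>?D\<^esub> y = \<zero>\<^bsub>?D\<^esub>" using smult_closed[OF x] by blast
    qed
    show "\<forall>x y. x \<in> carrier ?D \<and> y \<in> carrier ?D \<longrightarrow> x \<oplus>\<^bsub>?D\<^esub> y = y \<oplus>\<^bsub>?D\<^esub> x"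
      using abelian_monoid.a_comm[OF am] mem
      by (clarify, intro eqI) (simp_all add: direct_sum_simps(2-4))
    show "\<forall>x y z. x \<in> carrier ?D \<and> y \<in> carrier ?D \<and> z \<in> carrier ?D \<longrightarrow>
        x \<oplus>\<^bsub>?D\<^esub> y \<oplus>\<^bsub>?D\<^esub> z = x \<oplus>\<^bsub>?D\<^esub> (y \<oplus>\<^bsub>?D\<^esub> z)"
      using abelian_monoid.a_assoc[OF am] mem
      by (clarify, intro eqI) (simp_all add: direct_sum_simps(2-4))
    show "\<forall>x\<in>carrier ?D. x \<oplus>\<^bsub>?D\<^esub> \<zero>\<^bsub>?D\<^esub> = x"
      using zero_add mem ext by (clarify, intro eqI) (simp_all add: direct_sum_simps(2-4))
    show "\<forall>a b x. a \<in> carrier class_ring \<and> b \<in> carrier class_ring \<and> x \<in> carrier ?D \<longrightarrow>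
        a \<otimes>\<^bsub>class_ring\<^esub> b \<odot>\<^bsub>?D\<^esub> x = a \<odot>\<^bsub>?D\<^esub> (b \<odot>\<^bsub>?D\<^esub> x)"
      using smult_smult mem by (clarify, intro eqI) (simp_all add: direct_sum_simps(2-4))
    show "\<forall>x\<in>carrier ?D. \<one>\<^bsub>class_ring\<^esub> \<odot>\<^bsub>?D\<^esub> x = x"
      using one mem ext by (clarify, intro eqI) (simp_all add: direct_sum_simps(2-4))
    show "\<forall>a b x. a \<in> carrier class_ring \<and> b \<in> carrier class_ring \<and> x \<in> carrier ?D \<longrightarrow>
        (a \<oplus>\<^bsub>class_ring\<^esub> b) \<odot>\<^bsub>?D\<^esub> x = a \<odot>\<^bsub>?D\<^esub> x \<oplus>\<^bsub>?D\<^esub> b \<odot>\<^bsub>?D\<^esub> x"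
      using add_smult mem by (clarify, intro eqI) (simp_all add: direct_sum_simps(2-4))
    show "\<forall>a x y. a \<in> carrier class_ring \<and> x \<in> carrier ?D \<and> y \<in> carrier ?D \<longrightarrow>
        a \<odot>\<^bsub>?D\<^esub> (x \<oplus>\<^bsub>?D\<^esub> y) = a \<odot>\<^bsub>?D\<^esub> x \<oplus>\<^bsub>?D\<^esub> a \<odot>\<^bsub>?D\<^esub> y"
      using smult_add mem by (clarify, intro eqI) (simp_all add: direct_sum_simps(2-4))
  qed
qed

text \<open>The coordinates of a direct sum are the coordinates of all components, indexed by the disjoint
  union of the index sets.\<close>

lemma coordinate_map_direct_sum:
  fixes V :: "'i \<Rightarrow> ('k::field, 'v) module" and c :: "'i \<Rightarrow> 'v \<Rightarrow> 'j \<Rightarrow> 'k"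
  assumes V: "\<And>i. i \<in> I \<Longrightarrow> vectorspace class_ring (V i)"
    and c: "\<And>i. i \<in> I \<Longrightarrow> coordinate_map (V i) (K i) (c i)"
  shows "coordinate_map (direct_sum_space I V) (SIGMA i:I. K i) (\<lambda>x (i, k). if i \<in> I then c i (x i) k else 0)"
    (is "coordinate_map ?D ?K ?c")
proof -
  have bij: "bij_betw (c i) (carrier (V i)) (finsupp_on (K i))" if "i \<in> I" for i
    using c[OF that] by (simp add: coordinate_map_def)
  have zero: "c i \<zero>\<^bsub>V i\<^esub> k = 0" if "i \<in> I" for i k
    using coordinate_map_zero[OF V c] that by blast
  have zero_closed: "\<zero>\<^bsub>V i\<^esub> \<in> carrier (V i)" if "i \<in> I" for i
  proof -
    interpret vectorspace class_ring "V i" using V[OF that] .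
    show ?thesis by simp
  qed
  have mem: "i \<in> I \<Longrightarrow> x \<in> carrier ?D \<Longrightarrow> x i \<in> carrier (V i)" for x i
    by (auto simp: direct_sum_simps)
  have "inj_on ?c (carrier ?D)"
  proof (rule inj_onI)
    fix x y assume xy: "x \<in> carrier ?D" "y \<in> carrier ?D" "?c x = ?c y"
    have "x i = y i" if "i \<in> I" for i
    proof -
      have "c i (x i) k = c i (y i) k" for k using fun_cong[OF xy(3), of "(i, k)"] that by simp
      then have "c i (x i) = c i (y i)" by blast
      then show ?thesis using bij[OF that] mem that xy by (auto simp: bij_betw_def inj_on_def)
    qed
    then show "x = y" using xy by (auto simp: direct_sum_simps PiE_def intro: extensionalityI)
  qed
  moreover have "?c ` carrier ?D = finsupp_on ?K"
  proof (intro equalityI subsetI)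
    fix g assume "g \<in> ?c ` carrier ?D"
    then obtain x where x: "x \<in> carrier ?D" "g = ?c x" by blast
    let ?S = "{i \<in> I. x i \<noteq> \<zero>\<^bsub>V i\<^esub>}"
    have fin: "finite {k. c i (x i) k \<noteq> 0} \<and> {k. c i (x i) k \<noteq> 0} \<subseteq> K i" if "i \<in> I" for i
      using bij[OF that] mem[OF that x(1)] by (auto simp: bij_betw_def finsupp_on_def)
    have "{d. g d \<noteq> 0} \<subseteq> (SIGMA i:?S. {k. c i (x i) k \<noteq> 0})"
      using zero by (auto simp: x(2) split: if_splits)
    moreover have "finite (SIGMA i:?S. {k. c i (x i) k \<noteq> 0})"
      using x(1) fin by (intro finite_SigmaI) (auto simp: direct_sum_simps)
    ultimately have "finite {d. g d \<noteq> 0}" by (rule finite_subset)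
    moreover have "{d. g d \<noteq> 0} \<subseteq> ?K" using fin by (fastforce simp: x(2) split: if_splits)
    ultimately show "g \<in> finsupp_on ?K" by (simp add: finsupp_on_def)
  next
    fix g :: "'i \<times> 'j \<Rightarrow> 'k" assume g: "g \<in> finsupp_on ?K"
    have gi: "(\<lambda>k. g (i, k)) \<in> finsupp_on (K i)" for i
    proof -
      have "{k. g (i, k) \<noteq> 0} \<subseteq> snd ` {d. g d \<noteq> 0}" by force
      moreover have "finite (snd ` {d. g d \<noteq> 0})" using g by (simp add: finsupp_on_def)
      ultimately have "finite {k. g (i, k) \<noteq> 0}" by (rule finite_subset)
      then show ?thesis using g by (auto simp: finsupp_on_def)
    qed
    define x where "x = (\<lambda>i\<in>I. inv_into (carrier (V i)) (c i) (\<lambda>k. g (i, k)))"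
    have xi: "x i \<in> carrier (V i) \<and> c i (x i) = (\<lambda>k. g (i, k))" if "i \<in> I" for i
      using bij[OF that] gi[of i] that unfolding x_def bij_betw_def
      by (auto intro: inv_into_into f_inv_into_f)
    have "{i \<in> I. x i \<noteq> \<zero>\<^bsub>V i\<^esub>} \<subseteq> fst ` {d. g d \<noteq> 0}"
    proof
      fix i assume i: "i \<in> {i \<in> I. x i \<noteq> \<zero>\<^bsub>V i\<^esub>}"
      have "\<exists>k. g (i, k) \<noteq> 0"
      proof (rule ccontr)
        assume "\<not> (\<exists>k. g (i, k) \<noteq> 0)"
        then have "c i (x i) = c i \<zero>\<^bsub>V i\<^esub>" using xi[of i] zero[of i] i by auto
        then have "x i = \<zero>\<^bsub>V i\<^esub>"
          using bij[of i] xi[of i] zero_closed[of i] i by (auto simp: bij_betw_def inj_on_def)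
        then show False using i by simp
      qed
      then show "i \<in> fst ` {d. g d \<noteq> 0}" by force
    qed
    moreover have "finite (fst ` {d. g d \<noteq> 0})" using g by (simp add: finsupp_on_def)
    ultimately have "finite {i \<in> I. x i \<noteq> \<zero>\<^bsub>V i\<^esub>}" by (rule finite_subset)
    moreover have "x \<in> (\<Pi>\<^sub>E i\<in>I. carrier (V i))" using xi by (auto simp: x_def)
    ultimately have "x \<in> carrier ?D" by (simp add: direct_sum_simps)
    moreover have "?c x d = g d" for d
      using xi g by (cases d) (auto simp: finsupp_on_def)
    ultimately show "g \<in> ?c ` carrier ?D" by (auto intro!: image_eqI[of _ _ x])
  qed
  ultimately show ?thesis
    unfolding coordinate_map_def bij_betw_def
    using c mem by (auto simp: direct_sum_simps(2-4) coordinate_map_def)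
qed

section \<open>Corners of an idempotent\<close>

locale idempotent_algebra = k_algebra scale
  for scale :: "'k::field \<Rightarrow> 'a::ring_1 \<Rightarrow> 'a" +
  fixes e :: 'a
  assumes idem: "e * e = e"
begin

lemma block_idem_idem [simp]: "block_idem e i * block_idem e i = block_idem e i"
  by (simp add: block_idem_def idem algebra_simps)

lemma mem_corner_iff: "x \<in> corner e i j \<longleftrightarrow> block_idem e i * x * block_idem e j = x"
proof
  assume "x \<in> corner e i j"
  then obtain y where "x = block_idem e i * y * block_idem e j" by (auto simp: corner_def)
  then show "block_idem e i * x * block_idem e j = x"
    by (metis block_idem_idem mult.assoc)
qed (metis (mono_tags, lifting) corner_def mem_Collect_eq)

lemma corner_left: "x \<in> corner e i j \<Longrightarrow> block_idem e i * x = x"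
  by (metis block_idem_idem mem_corner_iff mult.assoc)

lemma corner_right: "x \<in> corner e i j \<Longrightarrow> x * block_idem e j = x"
  by (metis block_idem_idem mem_corner_iff mult.assoc)

lemma corner_mult:
  assumes "x \<in> corner e i j" "y \<in> corner e j k"
  shows "x * y \<in> corner e i k"
  unfolding mem_corner_iff using corner_left[OF assms(1)] corner_right[OF assms(2)]
  by (metis mult.assoc)

lemma corner_zero [simp]: "0 \<in> corner e i j"
  by (simp add: mem_corner_iff)

lemma corner_add: "x \<in> corner e i j \<Longrightarrow> y \<in> corner e i j \<Longrightarrow> x + y \<in> corner e i j"
  by (simp add: mem_corner_iff distrib_left distrib_right)

lemma corner_scale: "x \<in> corner e i j \<Longrightarrow> scale a x \<in> corner e i j"
  by (simp add: mem_corner_iff scale_mult_left scale_mult_right)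

lemma subspace_corner: "subspace (corner e i j)"
  by (rule subspaceI) (auto intro: corner_add corner_scale)

lemma block_idem_in_corner: "block_idem e i \<in> corner e i i"
  by (simp add: mem_corner_iff)

lemma e_in_corner: "e \<in> corner e 0 0"
  using block_idem_in_corner[of 0] by (simp add: block_idem_def)

lemma unit_in_corner: "1 - e \<in> corner e 1 1" "1 - e \<in> corner e (Suc 0) (Suc 0)"
  using block_idem_in_corner[of 1] by (simp_all add: block_idem_def)

section \<open>Hom spaces as quotients of expressions\<close>

abbreviation "heq \<equiv> hom_eq scale e"
abbreviation harr :: "('k, 'a) expr \<Rightarrow> nat \<Rightarrow> nat \<Rightarrow> bool" where "harr \<equiv> arr e"

lemma heq_arr: "heq n m f g \<Longrightarrow> arr e f n m \<and> arr e g n m"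
proof (induction rule: hom_eq.induct)
  case (tens_assoc f n m g n' m' h n'' m'')
  have "arr e (Tens (Tens f g) h) (n + n' + n'') (m + m' + m'')"
    "arr e (Tens f (Tens g h)) (n + (n' + n'')) (m + (m' + m''))"
    using tens_assoc by (blast intro: arr.intros)+
  then show ?case by (simp add: add.assoc)
next
  case (unit_tens f n m)
  then show ?case using arr.intros(4)[OF arr.intros(1)[of e 0], of f n m] by simp
next
  case (tens_unit f n m)
  then show ?case using arr.intros(4)[OF _ arr.intros(1)[of e 0], of f n m] by simp
qed (auto simp del: One_nat_def intro: arr.intros corner_add corner_scale corner_mult unit_in_corner e_in_corner)

lemmas heq_arr1 = heq_arr[THEN conjunct1] and heq_arr2 = heq_arr[THEN conjunct2]

lemmas [trans] = hom_eq.trans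

lemma equiv_hom_rel: "equiv {f. arr e f n m} (hom_rel scale e n m)"
proof (rule equivI)
  show "hom_rel scale e n m \<subseteq> {f. arr e f n m} \<times> {f. arr e f n m}"
    by (auto simp: hom_rel_def dest: heq_arr)
qed (auto simp: hom_rel_def refl_on_def sym_def trans_def
    intro: hom_eq.refl hom_eq.sym hom_eq.trans)

sublocale hom: pre_vectorspace "{f. arr e f n m}" "hom_rel scale e n m" Add "Zero n m" Scal for n m
proof
  show "equiv {f. arr e f n m} (hom_rel scale e n m)" by (rule equiv_hom_rel)
qed (auto simp: hom_rel_def intro: arr.intros hom_eq.intros intro: hom_eq.sym)

lemma hom_space_eq: "hom_space scale e n m = hom.Q n m"
  by (simp add: hom_space_def)

lemma vectorspace_hom: "vectorspace class_ring (hom_space scale e n m)"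
  unfolding hom_space_eq by (rule hom.vectorspace_quotient)

text \<open>Expressions that are equivalent to linear combinations of members of \<open>S\<close>.\<close>

inductive hom_span :: "nat \<Rightarrow> nat \<Rightarrow> ('k, 'a) expr set \<Rightarrow> ('k, 'a) expr \<Rightarrow> bool" for n m S where
  base: "s \<in> S \<Longrightarrow> arr e s n m \<Longrightarrow> hom_span n m S s"
| zero: "hom_span n m S (Zero n m)"
| add: "hom_span n m S f \<Longrightarrow> hom_span n m S g \<Longrightarrow> hom_span n m S (Add f g)"
| scal: "hom_span n m S f \<Longrightarrow> hom_span n m S (Scal a f)"
| heq: "hom_span n m S f \<Longrightarrow> heq n m f g \<Longrightarrow> hom_span n m S g"

lemma hom_span_arr: "hom_span n m S f \<Longrightarrow> arr e f n m"
  by (induction rule: hom_span.induct) (auto intro: arr.intros dest: heq_arr2)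

lemma hom_span_heq: "heq n m f g \<Longrightarrow> hom_span n m S g \<Longrightarrow> hom_span n m S f"
  by (blast intro: hom_span.heq hom_eq.sym)

lemma comp_zero_left: "arr e f n m \<Longrightarrow> heq n p (Comp (Zero m p) f) (Zero n p)"
proof -
  assume f: "arr e f n m"
  have z: "arr e (Zero m p) m p" by (rule arr.intros)
  have "heq n p (Comp (Zero m p) f) (Comp (Scal 0 (Zero m p)) f)"
    by (rule hom_eq.comp_cong[OF hom_eq.sym[OF hom_eq.scal_zero[OF z]] hom_eq.refl[OF f]])
  also have "heq n p \<dots> (Scal 0 (Comp (Zero m p) f))" by (rule hom_eq.comp_scal_left[OF z f])
  also have "heq n p \<dots> (Zero n p)" by (rule hom_eq.scal_zero[OF arr.intros(3)[OF z f]])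
  finally show ?thesis .
qed

lemma comp_zero_right: "arr e g m p \<Longrightarrow> heq n p (Comp g (Zero n m)) (Zero n p)"
proof -
  assume g: "arr e g m p"
  have z: "arr e (Zero n m) n m" by (rule arr.intros)
  have "heq n p (Comp g (Zero n m)) (Comp g (Scal 0 (Zero n m)))"
    by (rule hom_eq.comp_cong[OF hom_eq.refl[OF g] hom_eq.sym[OF hom_eq.scal_zero[OF z]]])
  also have "heq n p \<dots> (Scal 0 (Comp g (Zero n m)))" by (rule hom_eq.comp_scal_right[OF g z])
  also have "heq n p \<dots> (Zero n p)" by (rule hom_eq.scal_zero[OF arr.intros(3)[OF g z]])
  finally show ?thesis .
qed

lemma tens_zero_left: "arr e g n' m' \<Longrightarrow> heq (n + n') (m + m') (Tens (Zero n m) g) (Zero (n + n') (m + m'))"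
proof -
  assume g: "arr e g n' m'"
  have z: "arr e (Zero n m) n m" by (rule arr.intros)
  have "heq (n + n') (m + m') (Tens (Zero n m) g) (Tens (Scal 0 (Zero n m)) g)"
    by (rule hom_eq.tens_cong[OF hom_eq.sym[OF hom_eq.scal_zero[OF z]] hom_eq.refl[OF g]])
  also have "heq (n + n') (m + m') \<dots> (Scal 0 (Tens (Zero n m) g))"
    by (rule hom_eq.tens_scal_left[OF z g])
  also have "heq (n + n') (m + m') \<dots> (Zero (n + n') (m + m'))"
    by (intro hom_eq.scal_zero arr.intros z g)
  finally show ?thesis .
qed

lemma tens_zero_right: "arr e f n m \<Longrightarrow> heq (n + n') (m + m') (Tens f (Zero n' m')) (Zero (n + n') (m + m'))"
proof -
  assume f: "arr e f n m"
  have z: "arr e (Zero n' m') n' m'" by (rule arr.intros)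
  have "heq (n + n') (m + m') (Tens f (Zero n' m')) (Tens f (Scal 0 (Zero n' m')))"
    by (rule hom_eq.tens_cong[OF hom_eq.refl[OF f] hom_eq.sym[OF hom_eq.scal_zero[OF z]]])
  also have "heq (n + n') (m + m') \<dots> (Scal 0 (Tens f (Zero n' m')))"
    by (rule hom_eq.tens_scal_right[OF f z])
  also have "heq (n + n') (m + m') \<dots> (Zero (n + n') (m + m'))"
    by (intro hom_eq.scal_zero arr.intros z f)
  finally show ?thesis .
qed

text \<open>Spanning sets of the factors give a spanning set for composites, because composition is
  bilinear up to equivalence; and likewise for tensor products.\<close>

lemma hom_span_comp:
  assumes g: "hom_span m p S g" and f: "hom_span n m T f"
    and gen: "\<And>s t. s \<in> S \<Longrightarrow> t \<in> T \<Longrightarrow> arr e s m p \<Longrightarrow> arr e t n m \<Longrightarrow> hom_span n p U (Comp s t)"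
  shows "hom_span n p U (Comp g f)"
proof -
  have 1: "hom_span n p U (Comp s f)" if s: "s \<in> S" "arr e s m p" for s
    using f
  proof induction
    case zero
    then show ?case using s by (blast intro: hom_span_heq comp_zero_right hom_span.zero)
  next
    case (add f g)
    then show ?case
      using s by (blast intro: hom_span_heq hom_eq.comp_add_right hom_span.add hom_span_arr)
  next
    case (scal f)
    then show ?case
      using s by (blast intro: hom_span_heq hom_eq.comp_scal_right hom_span.scal hom_span_arr)
  next
    case (heq f g)
    then show ?case using s by (blast intro: hom_span.heq hom_eq.comp_cong hom_eq.refl)
  qed (use s gen in blast)
  have farr: "arr e f n m" using f by (rule hom_span_arr)
  show ?thesis
    using g
  proof induction
    case zero
    then show ?case using farr by (blast intro: hom_span_heq comp_zero_left hom_span.zero)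
  next
    case (add g g')
    then show ?case
      using farr by (blast intro: hom_span_heq hom_eq.comp_add_left hom_span.add hom_span_arr)
  next
    case (scal g)
    then show ?case
      using farr by (blast intro: hom_span_heq hom_eq.comp_scal_left hom_span.scal hom_span_arr)
  next
    case (heq g g')
    then show ?case using farr by (blast intro: hom_span.heq hom_eq.comp_cong hom_eq.refl)
  qed (rule 1)
qed

lemma hom_span_tens:
  assumes g: "hom_span n m S g" and f: "hom_span n' m' T f"
    and gen: "\<And>s t. s \<in> S \<Longrightarrow> t \<in> T \<Longrightarrow> arr e s n m \<Longrightarrow> arr e t n' m' \<Longrightarrow>
      hom_span (n + n') (m + m') U (Tens s t)"
  shows "hom_span (n + n') (m + m') U (Tens g f)"
proof -
  have 1: "hom_span (n + n') (m + m') U (Tens s f)" if s: "s \<in> S" "arr e s n m" for s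
    using f
  proof induction
    case zero
    then show ?case using s by (blast intro: hom_span_heq tens_zero_right hom_span.zero)
  next
    case (add f g)
    then show ?case
      using s by (blast intro: hom_span_heq hom_eq.tens_add_right hom_span.add hom_span_arr)
  next
    case (scal f)
    then show ?case
      using s by (blast intro: hom_span_heq hom_eq.tens_scal_right hom_span.scal hom_span_arr)
  next
    case (heq f g)
    then show ?case using s by (blast intro: hom_span.heq hom_eq.tens_cong hom_eq.refl)
  qed (use s gen in blast)
  have farr: "arr e f n' m'" using f by (rule hom_span_arr)
  show ?thesis
    using g
  proof induction
    case zero
    then show ?case using farr by (blast intro: hom_span_heq tens_zero_left hom_span.zero)
  next
    case (add g g')
    then show ?case
      using farr by (blast intro: hom_span_heq hom_eq.tens_add_left hom_span.add hom_span_arr)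
  next
    case (scal g)
    then show ?case
      using farr by (blast intro: hom_span_heq hom_eq.tens_scal_left hom_span.scal hom_span_arr)
  next
    case (heq g g')
    then show ?case using farr by (blast intro: hom_span.heq hom_eq.tens_cong hom_eq.refl)
  qed (rule 1)
qed

text \<open>Linearity of \<open>u \<mapsto> [u]\<close> on a corner.\<close>

lemma hom_span_gen:
  assumes ij: "i \<le> 1" "j \<le> 1" and B: "B \<subseteq> corner e i j" and u: "u \<in> span B"
    and gen: "\<And>b. b \<in> B \<Longrightarrow> hom_span j i S (Gen i j b)"
  shows "hom_span j i S (Gen i j u)"
proof -
  have "u \<in> corner e i j \<and> hom_span j i S (Gen i j u)"
    using u
  proof (induction rule: span_induct_alt)
    case base
    have "heq j i (Gen i j (scale 0 0)) (Scal 0 (Gen i j 0))"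
      using ij by (intro hom_eq.gen_scal) auto
    also have "heq j i \<dots> (Zero j i)"
      using ij by (intro hom_eq.scal_zero arr.intros) auto
    finally show ?case by (auto intro: hom_span_heq hom_span.zero)
  next
    case (step c x y)
    then have x: "x \<in> corner e i j" using B by auto
    have "heq j i (Gen i j (scale c x + y)) (Add (Gen i j (scale c x)) (Gen i j y))"
      using ij x step by (intro hom_eq.gen_add corner_scale) auto
    moreover have "hom_span j i S (Gen i j (scale c x))"
      using step x ij by (blast intro: hom_span_heq hom_eq.gen_scal hom_span.scal gen)
    ultimately show ?case
      using step x by (blast intro: hom_span_heq hom_span.add corner_add corner_scale)
  qed
  then show ?thesis ..
qed

end

text \<open>The rules of the category mention the object \<open>X\<close> as the numeral 1, which is kept in this form.\<close>

declare One_nat_def [simp del]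

section \<open>Words of strands\<close>

text \<open>A tensor product of generators \<open>\<one> \<rightarrow> X\<close>, \<open>X \<rightarrow> X\<close> and \<open>X \<rightarrow> \<one>\<close>, as a list of labelled strands:
  short top strands, long strands and short bottom strands.\<close>

datatype 'a strand = Top 'a | Thru 'a | Bot 'a

primrec strand_expr :: "'a strand \<Rightarrow> ('k, 'a) expr" where
  "strand_expr (Top b) = Gen 1 0 b"
| "strand_expr (Thru a) = Gen 1 1 a"
| "strand_expr (Bot c) = Gen 0 1 c"

text \<open>The numbers of bottom and of top points of a strand, and then of a word.\<close>

primrec strand_bot :: "'a strand \<Rightarrow> nat" where
  "strand_bot (Top b) = 0"
| "strand_bot (Thru a) = 1"
| "strand_bot (Bot c) = 1"

primrec strand_top :: "'a strand \<Rightarrow> nat" where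
  "strand_top (Top b) = 1"
| "strand_top (Thru a) = 1"
| "strand_top (Bot c) = 0"

definition word_expr :: "'a strand list \<Rightarrow> ('k, 'a) expr" where
  "word_expr w = tens_list (map strand_expr w)"

definition word_bot :: "'a strand list \<Rightarrow> nat" where
  "word_bot w = sum_list (map strand_bot w)"

definition word_top :: "'a strand list \<Rightarrow> nat" where
  "word_top w = sum_list (map strand_top w)"

text \<open>The labels of short top, long and short bottom strands are in \<open>P\<close>, \<open>Q\<close> and \<open>R\<close>, respectively.\<close>

primrec strand_in :: "'a set \<Rightarrow> 'a set \<Rightarrow> 'a set \<Rightarrow> 'a strand \<Rightarrow> bool" where
  "strand_in P Q R (Top b) \<longleftrightarrow> b \<in> P"
| "strand_in P Q R (Thru a) \<longleftrightarrow> a \<in> Q"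
| "strand_in P Q R (Bot c) \<longleftrightarrow> c \<in> R"

abbreviation word_in :: "'a set \<Rightarrow> 'a set \<Rightarrow> 'a set \<Rightarrow> 'a strand list \<Rightarrow> bool" where
  "word_in P Q R \<equiv> list_all (strand_in P Q R)"

lemma word_expr_simps [simp]:
  "word_expr [] = Id 0" "word_expr (s # w) = Tens (strand_expr s) (word_expr w)"
  by (simp_all add: word_expr_def tens_list_def)

lemma word_bot_simps [simp]:
  "word_bot [] = 0" "word_bot (s # w) = strand_bot s + word_bot w"
  "word_bot (v @ w) = word_bot v + word_bot w"
  by (simp_all add: word_bot_def)

lemma word_top_simps [simp]:
  "word_top [] = 0" "word_top (s # w) = strand_top s + word_top w"
  "word_top (v @ w) = word_top v + word_top w"
  by (simp_all add: word_top_def)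

lemma strand_in_mono:
  "strand_in P Q R s \<Longrightarrow> P \<subseteq> P' \<Longrightarrow> Q \<subseteq> Q' \<Longrightarrow> R \<subseteq> R' \<Longrightarrow> strand_in P' Q' R' s"
  by (cases s) auto

lemma word_in_mono:
  "word_in P Q R w \<Longrightarrow> P \<subseteq> P' \<Longrightarrow> Q \<subseteq> Q' \<Longrightarrow> R \<subseteq> R' \<Longrightarrow> word_in P' Q' R' w"
  by (auto simp: list_all_iff intro: strand_in_mono)

text \<open>The functional \<open>\<kappa>\<close> restricts to the isomorphism \<open>eAe \<cong> k\<close>.\<close>

locale field_corner_algebra = idempotent_algebra scale e
  for scale :: "'k::field \<Rightarrow> 'a::ring_1 \<Rightarrow> 'a" and e +
  fixes \<kappa> :: "'a \<Rightarrow> 'k"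
  assumes kappa_add: "\<kappa> (x + y) = \<kappa> x + \<kappa> y"
    and kappa_scale: "\<kappa> (scale a x) = a * \<kappa> x"
    and kappa_e: "\<kappa> e = 1"
    and kappa_corner: "x \<in> corner e 0 0 \<Longrightarrow> scale (\<kappa> x) e = x"
begin

abbreviation "good_strand \<equiv> strand_in (corner e 1 0) (corner e 1 1) (corner e 0 1)"
abbreviation "good_word \<equiv> word_in (corner e 1 0) (corner e 1 1) (corner e 0 1)"

lemma arr_strand: "good_strand s \<Longrightarrow> harr (strand_expr s) (strand_bot s) (strand_top s)"
  by (cases s) (auto intro: arr.intros)

lemma arr_word: "good_word w \<Longrightarrow> harr (word_expr w) (word_bot w) (word_top w)"
  by (induction w) (auto intro: arr.intros arr_strand)

lemma heq_id_tens: "harr f n m \<Longrightarrow> heq n m f (Tens (Id 0) f)"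
  by (rule hom_eq.sym) (rule hom_eq.unit_tens)

lemma heq_tens_id: "harr f n m \<Longrightarrow> heq n m f (Tens f (Id 0))"
  by (rule hom_eq.sym) (rule hom_eq.tens_unit)

lemma word_append_heq:
  assumes "good_word v" "good_word w"
  shows "heq (word_bot (v @ w)) (word_top (v @ w)) (word_expr (v @ w)) (Tens (word_expr v) (word_expr w))"
  using assms(1)
proof (induction v)
  case Nil
  then show ?case using arr_word[OF assms(2)] by (simp add: heq_id_tens)
next
  case (Cons s v)
  let ?n = "word_bot (s # v @ w)" and ?m = "word_top (s # v @ w)"
  have s: "harr (strand_expr s) (strand_bot s) (strand_top s)"
    and v: "harr (word_expr v) (word_bot v) (word_top v)"
    and w: "harr (word_expr w) (word_bot w) (word_top w)"
    using Cons.prems assms by (auto intro: arr_strand arr_word)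
  have "heq ?n ?m (word_expr (s # v @ w)) (Tens (strand_expr s) (Tens (word_expr v) (word_expr w)))"
    using hom_eq.tens_cong[OF hom_eq.refl[OF s] Cons.IH] Cons.prems by simp
  also have "heq ?n ?m \<dots> (Tens (word_expr (s # v)) (word_expr w))"
    using hom_eq.sym[OF hom_eq.tens_assoc[OF s v w]] by (simp add: add.assoc)
  finally show ?case by simp
qed

text \<open>Composites in which one factor is extended by a strand that does not meet the other.\<close>

lemma comp_tens_top:
  assumes b: "harr b 0 m" and v: "harr v p q" and w: "harr w n p"
  shows "heq n (m + q) (Comp (Tens b v) w) (Tens b (Comp v w))"
proof -
  have i: "harr (Id 0) 0 0" by (rule arr.intros)
  have bv: "harr (Tens b v) p (m + q)" using arr.intros(4)[OF b v] by simp
  have "heq n (m + q) (Comp (Tens b v) w) (Comp (Tens b v) (Tens (Id 0) w))"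
    by (rule hom_eq.comp_cong[OF hom_eq.refl[OF bv] heq_id_tens[OF w]])
  also have "heq n (m + q) \<dots> (Tens (Comp b (Id 0)) (Comp v w))"
    using hom_eq.sym[OF hom_eq.interchange[OF b i v w]] by simp
  also have "heq n (m + q) \<dots> (Tens b (Comp v w))"
    using hom_eq.tens_cong[OF hom_eq.comp_id[OF b] hom_eq.refl[OF arr.intros(3)[OF v w]]] by simp
  finally show ?thesis .
qed

lemma comp_tens_bot:
  assumes c: "harr c m 0" and v: "harr v p q" and w: "harr w n p"
  shows "heq (m + n) q (Comp v (Tens c w)) (Tens c (Comp v w))"
proof -
  have i: "harr (Id 0) 0 0" by (rule arr.intros)
  have cw: "harr (Tens c w) (m + n) p" using arr.intros(4)[OF c w] by simp
  have "heq (m + n) q (Comp v (Tens c w)) (Comp (Tens (Id 0) v) (Tens c w))"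
    by (rule hom_eq.comp_cong[OF heq_id_tens[OF v] hom_eq.refl[OF cw]])
  also have "heq (m + n) q \<dots> (Tens (Comp (Id 0) c) (Comp v w))"
    using hom_eq.sym[OF hom_eq.interchange[OF i c v w]] by simp
  also have "heq (m + n) q \<dots> (Tens c (Comp v w))"
    using hom_eq.tens_cong[OF hom_eq.id_comp[OF c] hom_eq.refl[OF arr.intros(3)[OF v w]]] by simp
  finally show ?thesis .
qed

lemma heq_gen_unit:
  assumes "h \<in> corner e 0 0"
  shows "heq 0 0 (Gen 0 0 h) (Scal (\<kappa> h) (Id 0))"
  using hom_eq.gen_id_unit[of scale e "\<kappa> h"] kappa_corner[OF assms] by simp

text \<open>Two strands that meet compose to a single strand, or to a scalar.\<close>

lemma comp_strands:
  assumes s: "good_strand s" "strand_bot s = 1" and t: "good_strand t" "strand_top t = 1"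
  shows "\<exists>a u. good_word u \<and> word_bot u = strand_bot t \<and> word_top u = strand_top s \<and>
    heq (strand_bot t) (strand_top s) (Comp (strand_expr s) (strand_expr t)) (Scal a (word_expr u))"
proof -
  have strand: ?thesis
    if r: "good_strand r" "strand_bot r = strand_bot t" "strand_top r = strand_top s"
      and h: "heq (strand_bot t) (strand_top s) (Comp (strand_expr s) (strand_expr t)) (strand_expr r)"
    for r
  proof (intro exI[of _ 1] exI[of _ "[r]"] conjI)
    have ar: "harr (strand_expr r) (strand_bot t) (strand_top s)"
      using arr_strand[OF r(1)] r by simp
    note h
    also have "heq (strand_bot t) (strand_top s) (strand_expr r) (word_expr [r])"
      using heq_tens_id[OF ar] by simp
    also have "heq (strand_bot t) (strand_top s) (word_expr [r]) (Scal 1 (word_expr [r]))"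
      using hom_eq.sym[OF hom_eq.scal_one] calculation heq_arr2 by blast
    finally show "heq (strand_bot t) (strand_top s) (Comp (strand_expr s) (strand_expr t))
      (Scal 1 (word_expr [r]))" .
  qed (use r in auto)
  show ?thesis
  proof (cases s)
    case (Thru a)
    show ?thesis
    proof (cases t)
      case (Top b)
      then show ?thesis
        using s t Thru by (intro strand[of "Top (a * b)"])
          (auto intro: hom_eq.gen_mult corner_mult)
    next
      case (Thru a')
      then show ?thesis
        using s t \<open>s = Thru a\<close> by (intro strand[of "Thru (a * a')"])
          (auto intro: hom_eq.gen_mult corner_mult)
    qed (use t in auto)
  next
    case (Bot c)
    show ?thesis
    proof (cases t)
      case (Top b)
      have h: "c * b \<in> corner e 0 0" using s t Top Bot by (auto intro: corner_mult)
      have "heq 0 0 (Comp (Gen 0 1 c) (Gen 1 0 b)) (Gen 0 0 (c * b))"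
        using s t Top Bot by (intro hom_eq.gen_mult) auto
      also have "heq 0 0 \<dots> (Scal (\<kappa> (c * b)) (word_expr []))"
        using heq_gen_unit[OF h] by simp
      finally show ?thesis using Top Bot by (intro exI[of _ "\<kappa> (c * b)"] exI[of _ "[]"]) auto
    next
      case (Thru a)
      then show ?thesis
        using s t Bot by (intro strand[of "Bot (c * a)"])
          (auto intro: hom_eq.gen_mult corner_mult)
    qed (use t in auto)
  qed (use s in auto)
qed

text \<open>A composite of two words is a scalar multiple of a word. The words are compared from the left: a
  short top strand of the upper word and a short bottom strand of the lower word are not involved in
  the composition, and otherwise the first strands meet.\<close>

lemma comp_words:
  assumes "good_word v" "good_word w" "word_bot v = word_top w"
  shows "\<exists>a u. good_word u \<and> word_bot u = word_bot w \<and> word_top u = word_top v \<and>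
    heq (word_bot w) (word_top v) (Comp (word_expr v) (word_expr w)) (Scal a (word_expr u))"
  using assms
proof (induction "length v + length w" arbitrary: v w rule: less_induct)
  case less
  let ?thesis' = "\<exists>a u. good_word u \<and> word_bot u = word_bot w \<and> word_top u = word_top v \<and>
    heq (word_bot w) (word_top v) (Comp (word_expr v) (word_expr w)) (Scal a (word_expr u))"
  have av: "harr (word_expr v) (word_top w) (word_top v)"
    and aw: "harr (word_expr w) (word_bot w) (word_top w)"
    using arr_word[of v] arr_word[of w] less.prems by simp_all
  have scal: "heq n m (Tens f (Scal a g)) (Scal a (Tens f g))"
    if "harr f n1 m1" "harr g n2 m2" "n = n1 + n2" "m = m1 + m2" for f g n1 m1 n2 m2 n m a
    using that by (auto intro: hom_eq.tens_scal_right)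
  consider (nil) "v = []" "w = []"
    | (top) b v' where "v = Top b # v'"
    | (bot) c w' where "w = Bot c # w'"
    | (meet) s v' t w' where "v = s # v'" "w = t # w'" "strand_bot s = 1" "strand_top t = 1"
  proof (cases v)
    case Nil
    then show thesis
    proof (cases w)
      case (Cons t w')
      then show thesis using less.prems Nil bot by (cases t) auto
    qed (use nil in auto)
  next
    case (Cons s v')
    then show thesis
    proof (cases w)
      case Nil
      then show thesis using less.prems Cons top by (cases s) auto
    next
      case (Cons t w')
      then show thesis using \<open>v = s # v'\<close> top bot meet by (cases s; cases t) auto
    qed
  qed
  then show ?thesis'
  proof cases
    case nil
    have i: "harr (Id 0) 0 0" by (rule arr.intros)
    have "heq 0 0 (Comp (Id 0) (Id 0)) (Scal 1 (Id 0))"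
      using hom_eq.trans[OF hom_eq.id_comp[OF i] hom_eq.sym[OF hom_eq.scal_one[OF i]]] .
    then show ?thesis' using nil by (intro exI[of _ 1] exI[of _ "[]"]) auto
  next
    case top
    have gb: "good_strand (Top b)" and gv: "good_word v'" and ew: "word_bot v' = word_top w"
      using less.prems top by auto
    have ab: "harr (Gen 1 0 b) 0 1" using arr_strand[OF gb] by simp
    have av': "harr (word_expr v') (word_top w) (word_top v')" using arr_word[OF gv] ew by simp
    obtain a u where u: "good_word u" "word_bot u = word_bot w" "word_top u = word_top v'"
      "heq (word_bot w) (word_top v') (Comp (word_expr v') (word_expr w)) (Scal a (word_expr u))"
    proof -
      have "length v' + length w < length v + length w" using top by simp
      from less.hyps[OF this gv less.prems(2) ew] show thesis by (elim exE conjE) (rule that)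
    qed
    have "heq (word_bot w) (word_top v) (Comp (word_expr v) (word_expr w))
        (Tens (Gen 1 0 b) (Comp (word_expr v') (word_expr w)))"
      using comp_tens_top[OF ab av' aw] top by simp
    also have "heq (word_bot w) (word_top v) \<dots> (Tens (Gen 1 0 b) (Scal a (word_expr u)))"
      using hom_eq.tens_cong[OF hom_eq.refl[OF ab] u(4)] top by simp
    also have "heq (word_bot w) (word_top v) \<dots> (Scal a (word_expr (Top b # u)))"
      using scal[OF ab arr_word[OF u(1)], of "word_bot w" "word_top v" a] u top by simp
    finally show ?thesis'
      using u gb top by (intro exI[of _ a] exI[of _ "Top b # u"]) auto
  next
    case bot
    have gc: "good_strand (Bot c)" and gw: "good_word w'" and ev: "word_top w' = word_bot v"
      using less.prems bot by auto
    have ac: "harr (Gen 0 1 c) 1 0" using arr_strand[OF gc] by simp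
    have aw': "harr (word_expr w') (word_bot w') (word_top w)"
      using arr_word[OF gw] ev less.prems by simp
    obtain a u where u: "good_word u" "word_bot u = word_bot w'" "word_top u = word_top v"
      "heq (word_bot w') (word_top v) (Comp (word_expr v) (word_expr w')) (Scal a (word_expr u))"
    proof -
      have "length v + length w' < length v + length w" using bot by simp
      from less.hyps[OF this less.prems(1) gw ev[symmetric]] show thesis
        by (elim exE conjE) (rule that)
    qed
    have "heq (word_bot w) (word_top v) (Comp (word_expr v) (word_expr w))
        (Tens (Gen 0 1 c) (Comp (word_expr v) (word_expr w')))"
      using comp_tens_bot[OF ac av aw'] bot by simp
    also have "heq (word_bot w) (word_top v) \<dots> (Tens (Gen 0 1 c) (Scal a (word_expr u)))"
      using hom_eq.tens_cong[OF hom_eq.refl[OF ac] u(4)] bot by simp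
    also have "heq (word_bot w) (word_top v) \<dots> (Scal a (word_expr (Bot c # u)))"
      using scal[OF ac arr_word[OF u(1)], of "word_bot w" "word_top v" a] u bot by simp
    finally show ?thesis'
      using u gc bot by (intro exI[of _ a] exI[of _ "Bot c # u"]) auto
  next
    case meet
    have gs: "good_strand s" "good_word v'" and gt: "good_strand t" "good_word w'"
      and ew: "word_bot v' = word_top w'"
      using less.prems meet by auto
    have as: "harr (strand_expr s) 1 (strand_top s)" and at: "harr (strand_expr t) (strand_bot t) 1"
      and av': "harr (word_expr v') (word_top w') (word_top v')"
      and aw': "harr (word_expr w') (word_bot w') (word_top w')"
      using arr_strand[OF gs(1)] arr_strand[OF gt(1)] arr_word[OF gs(2)] arr_word[OF gt(2)] meet ew
      by simp_all
    obtain a u where u: "good_word u" "word_bot u = word_bot w'" "word_top u = word_top v'"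
      "heq (word_bot w') (word_top v') (Comp (word_expr v') (word_expr w')) (Scal a (word_expr u))"
    proof -
      have "length v' + length w' < length v + length w" using meet by simp
      from less.hyps[OF this gs(2) gt(2) ew] show thesis by (elim exE conjE) (rule that)
    qed
    obtain a0 u0 where u0: "good_word u0" "word_bot u0 = strand_bot t" "word_top u0 = strand_top s"
      "heq (strand_bot t) (strand_top s) (Comp (strand_expr s) (strand_expr t)) (Scal a0 (word_expr u0))"
      using comp_strands[OF gs(1) meet(3) gt(1) meet(4)] by blast
    have au: "harr (word_expr u) (word_bot w') (word_top v')"
      and au0: "harr (word_expr u0) (strand_bot t) (strand_top s)"
      using arr_word[OF u(1)] arr_word[OF u0(1)] u u0 by simp_all
    let ?n = "word_bot w" and ?m = "word_top v"
    have n: "?n = strand_bot t + word_bot w'" and m: "?m = strand_top s + word_top v'"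
      using meet by simp_all
    have "heq ?n ?m (Comp (word_expr v) (word_expr w))
        (Tens (Comp (strand_expr s) (strand_expr t)) (Comp (word_expr v') (word_expr w')))"
      unfolding n m using hom_eq.sym[OF hom_eq.interchange[OF as at av' aw']] meet by simp
    also have "heq ?n ?m \<dots> (Tens (Scal a0 (word_expr u0)) (Scal a (word_expr u)))"
      unfolding n m by (rule hom_eq.tens_cong[OF u0(4) u(4)])
    also have "heq ?n ?m \<dots> (Scal a0 (Tens (word_expr u0) (Scal a (word_expr u))))"
      unfolding n m by (rule hom_eq.tens_scal_left[OF au0 arr.intros(7)[OF au]])
    also have "heq ?n ?m \<dots> (Scal a0 (Scal a (Tens (word_expr u0) (word_expr u))))"
      unfolding n m by (rule hom_eq.scal_cong[OF hom_eq.tens_scal_right[OF au0 au]])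
    also have "heq ?n ?m \<dots> (Scal (a0 * a) (Tens (word_expr u0) (word_expr u)))"
      unfolding n m by (rule hom_eq.scal_scal[OF arr.intros(4)[OF au0 au]])
    also have "heq ?n ?m \<dots> (Scal (a0 * a) (word_expr (u0 @ u)))"
      using hom_eq.scal_cong[OF hom_eq.sym[OF word_append_heq[OF u0(1) u(1)]]] u u0
      unfolding n m by simp
    finally show ?thesis'
      using u u0 n m by (intro exI[of _ "a0 * a"] exI[of _ "u0 @ u"]) auto
  qed
qed

end

section \<open>Words span the hom spaces\<close>

text \<open>Spanning sets for the labels. The label of a long strand need not be in \<open>B11\<close> if it is a product
  \<open>b * c\<close>, because \<open>[b * c] = [b] \<circ> [c] = [b] \<otimes> [c]\<close> is then a pair of short strands.\<close>

locale strand_bases = field_corner_algebra scale e \<kappa>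
  for scale :: "'k::field \<Rightarrow> 'a::ring_1 \<Rightarrow> 'a" and e \<kappa> +
  fixes B10 B01 B11 :: "'a set"
  assumes span_B10: "span B10 = corner e 1 0"
    and span_B01: "span B01 = corner e 0 1"
    and span_B11: "span ({b * c | b c. b \<in> B10 \<and> c \<in> B01} \<union> B11) = corner e 1 1"
begin

lemma B10_subset: "B10 \<subseteq> corner e 1 0"
  using span_superset[of B10] span_B10 by simp

lemma B01_subset: "B01 \<subseteq> corner e 0 1"
  using span_superset[of B01] span_B01 by simp

lemma B11_subset: "B11 \<subseteq> corner e 1 1"
  using span_superset[of "{b * c | b c. b \<in> B10 \<and> c \<in> B01} \<union> B11"] unfolding span_B11 by auto

abbreviation "basis_word \<equiv> word_in B10 B11 B01"

lemma good_basis_word: "basis_word w \<Longrightarrow> good_word w"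
  by (rule word_in_mono[OF _ B10_subset B11_subset B01_subset])

text \<open>Words from \<open>n\<close> to \<open>m\<close> with labels in the chosen sets.\<close>

definition basis_words :: "nat \<Rightarrow> nat \<Rightarrow> ('k, 'a) expr set" where
  "basis_words n m = {word_expr w | w. basis_word w \<and> word_bot w = n \<and> word_top w = m}"

abbreviation "wspan n m \<equiv> hom_span n m (basis_words n m)"

lemma wspan_word: "basis_word w \<Longrightarrow> wspan (word_bot w) (word_top w) (word_expr w)"
  using arr_word[OF good_basis_word, of w] by (intro hom_span.base) (auto simp: basis_words_def)

lemma wspan_tens:
  assumes "wspan n m f" "wspan n' m' g"
  shows "wspan (n + n') (m + m') (Tens f g)"
  using assms
proof (rule hom_span_tens)
  fix s t assume "s \<in> basis_words n m" "t \<in> basis_words n' m'"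
  then obtain v w where v: "s = word_expr v" "basis_word v" "word_bot v = n" "word_top v = m"
    and w: "t = word_expr w" "basis_word w" "word_bot w = n'" "word_top w = m'"
    by (auto simp: basis_words_def)
  have "wspan (n + n') (m + m') (word_expr (v @ w))" using wspan_word[of "v @ w"] v w by simp
  moreover have "heq (n + n') (m + m') (word_expr (v @ w)) (Tens s t)"
    using word_append_heq[of v w] v w good_basis_word by simp
  ultimately show "wspan (n + n') (m + m') (Tens s t)" by (rule hom_span.heq)
qed

lemma wspan_basis_strand:
  assumes "strand_in B10 B11 B01 s"
  shows "wspan (strand_bot s) (strand_top s) (strand_expr s)"
proof -
  have "good_word [s]" using good_basis_word[of "[s]"] assms by simp
  then have "heq (strand_bot s) (strand_top s) (word_expr [s]) (strand_expr s)"
    using hom_eq.tens_unit[OF arr_strand] by simp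
  then show ?thesis using wspan_word[of "[s]"] assms by (auto intro: hom_span.heq)
qed

text \<open>The object \<open>\<one>\<close> is the empty tensor product, so that \<open>[b] \<circ> [c]\<close> equals \<open>[b] \<otimes> [c]\<close>.\<close>

lemma gen_mult_tens:
  assumes "b \<in> corner e 1 0" "c \<in> corner e 0 1"
  shows "heq 1 1 (Gen 1 1 (b * c)) (Tens (Gen 1 0 b) (Gen 0 1 c))"
proof -
  have i: "harr (Id 0) 0 0" by (rule arr.intros)
  have b: "harr (Gen 1 0 b) 0 1" and c: "harr (Gen 0 1 c) 1 0"
    using assms by (auto intro: arr.intros)
  have "heq 1 1 (Gen 1 1 (b * c)) (Comp (Gen 1 0 b) (Gen 0 1 c))"
    using assms by (intro hom_eq.sym[OF hom_eq.gen_mult]) auto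
  also have "heq 1 1 \<dots> (Comp (Tens (Gen 1 0 b) (Id 0)) (Gen 0 1 c))"
    by (rule hom_eq.comp_cong[OF heq_tens_id[OF b] hom_eq.refl[OF c]])
  also have "heq 1 1 \<dots> (Tens (Gen 1 0 b) (Comp (Id 0) (Gen 0 1 c)))"
    using comp_tens_top[OF b i c] by simp
  also have "heq 1 1 \<dots> (Tens (Gen 1 0 b) (Gen 0 1 c))"
    using hom_eq.tens_cong[OF hom_eq.refl[OF b] hom_eq.id_comp[OF c]] by simp
  finally show ?thesis .
qed

lemma wspan_strand:
  assumes "good_strand s"
  shows "wspan (strand_bot s) (strand_top s) (strand_expr s)"
proof (cases s)
  case (Top b)
  have "wspan 0 1 (Gen 1 0 b)"
  proof (rule hom_span_gen[OF _ _ B10_subset])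
    show "b \<in> span B10" using assms Top span_B10 by simp
    show "wspan 0 1 (Gen 1 0 x)" if "x \<in> B10" for x
      using wspan_basis_strand[of "Top x"] that by simp
  qed simp_all
  then show ?thesis using Top by simp
next
  case (Bot c)
  have "wspan 1 0 (Gen 0 1 c)"
  proof (rule hom_span_gen[OF _ _ B01_subset])
    show "c \<in> span B01" using assms Bot span_B01 by simp
    show "wspan 1 0 (Gen 0 1 x)" if "x \<in> B01" for x
      using wspan_basis_strand[of "Bot x"] that by simp
  qed simp_all
  then show ?thesis using Bot by simp
next
  case (Thru a)
  let ?B = "{b * c | b c. b \<in> B10 \<and> c \<in> B01} \<union> B11"
  have sub: "?B \<subseteq> corner e 1 1" using span_superset[of ?B] unfolding span_B11 .
  have "wspan 1 1 (Gen 1 1 x)" if x: "x \<in> ?B" for x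
  proof (cases "x \<in> B11")
    case True
    then show ?thesis using wspan_basis_strand[of "Thru x"] by simp
  next
    case False
    then obtain b c where bc: "b \<in> B10" "c \<in> B01" "x = b * c" using x by auto
    have "wspan 1 1 (Tens (Gen 1 0 b) (Gen 0 1 c))"
      using wspan_tens[OF wspan_basis_strand[of "Top b"] wspan_basis_strand[of "Bot c"]] bc by simp
    moreover have "heq 1 1 (Gen 1 1 x) (Tens (Gen 1 0 b) (Gen 0 1 c))"
      unfolding bc(3) by (rule gen_mult_tens[OF subsetD[OF B10_subset bc(1)] subsetD[OF B01_subset bc(2)]])
    ultimately show ?thesis by (rule hom_span_heq[rotated])
  qed
  note gen = this
  have "a \<in> span ?B" using assms Thru unfolding span_B11 by simp
  from hom_span_gen[OF _ _ sub this gen] have "wspan 1 1 (Gen 1 1 a)" by simp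
  then show ?thesis using Thru by simp
qed

lemma wspan_good_word: "good_word w \<Longrightarrow> wspan (word_bot w) (word_top w) (word_expr w)"
proof (induction w)
  case Nil
  show ?case using wspan_word[of "[]"] by simp
next
  case (Cons s w)
  then show ?case by (auto intro: wspan_tens wspan_strand)
qed

lemma wspan_comp:
  assumes "wspan m p g" "wspan n m f"
  shows "wspan n p (Comp g f)"
  using assms
proof (rule hom_span_comp)
  fix s t assume "s \<in> basis_words m p" "t \<in> basis_words n m"
  then obtain v w where v: "s = word_expr v" "basis_word v" "word_bot v = m" "word_top v = p"
    and w: "t = word_expr w" "basis_word w" "word_bot w = n" "word_top w = m"
    by (auto simp: basis_words_def)
  have "word_bot v = word_top w" using v w by simp
  from comp_words[OF good_basis_word[OF v(2)] good_basis_word[OF w(2)] this]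
  obtain a u where u: "good_word u" "word_bot u = n" "word_top u = p"
    "heq n p (Comp s t) (Scal a (word_expr u))"
    unfolding v(1,4) w(1,3) by (elim exE conjE)
  have "wspan n p (Scal a (word_expr u))"
    using hom_span.scal[OF wspan_good_word[OF u(1)]] u by simp
  then show "wspan n p (Comp s t)" using u(4) by (rule hom_span_heq[rotated])
qed

lemma wspan_id: "wspan n n (Id n)"
proof (induction n)
  case 0
  show ?case using wspan_word[of "[]"] by simp
next
  case (Suc n)
  have "wspan 1 1 (Gen 1 1 (1 - e))"
    using wspan_strand[of "Thru (1 - e)"] unit_in_corner by simp
  then have "wspan 1 1 (Id 1)" using hom_eq.gen_id_X by (rule hom_span.heq)
  then have "wspan (1 + n) (1 + n) (Tens (Id 1) (Id n))" using Suc by (rule wspan_tens)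
  then have "wspan (1 + n) (1 + n) (Id (1 + n))" using hom_eq.tens_id by (rule hom_span.heq)
  then show ?case by (simp only: plus_1_eq_Suc)
qed

text \<open>The expressions whose classes are spanned by words contain the generators and are closed under all operations.\<close>

theorem wspan_arr: "harr f n m \<Longrightarrow> wspan n m f"
proof (induction rule: arr.induct)
  case (2 i j u)
  then consider "i = 0" "j = 0" | "i = 0" "j = 1" | "i = 1" "j = 0" | "i = 1" "j = 1" by linarith
  then show ?case
  proof cases
    case 1
    then show ?thesis
      using heq_gen_unit[of u] 2 wspan_id[of 0] by (auto intro: hom_span_heq hom_span.scal)
  next
    case 2
    then show ?thesis using wspan_strand[of "Bot u"] \<open>u \<in> corner e i j\<close> by simp
  next
    case 3
    then show ?thesis using wspan_strand[of "Top u"] \<open>u \<in> corner e i j\<close> by simp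
  next
    case 4
    then show ?thesis using wspan_strand[of "Thru u"] \<open>u \<in> corner e i j\<close> by simp
  qed
qed (blast intro: hom_span.zero hom_span.add hom_span.scal wspan_id wspan_comp wspan_tens)+

end

section \<open>Words and diagrams\<close>

text \<open>The partial bijection of a word, when its bottom points are numbered from \<open>k\<close> and its top points
  from \<open>j\<close>: a bottom point goes to the top point on the same long strand.\<close>

fun word_map :: "'a strand list \<Rightarrow> nat \<Rightarrow> nat \<Rightarrow> nat \<rightharpoonup> nat" where
  "word_map [] k j = Map.empty"
| "word_map (Top b # w) k j = word_map w k (Suc j)"
| "word_map (Thru a # w) k j = (word_map w (Suc k) (Suc j))(k \<mapsto> j)"
| "word_map (Bot c # w) k j = word_map w (Suc k) j"

text \<open>The labels of the three kinds of strands, from left to right.\<close>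

fun top_labels :: "'a strand list \<Rightarrow> 'a list" where
  "top_labels [] = []"
| "top_labels (Top b # w) = b # top_labels w"
| "top_labels (Thru a # w) = top_labels w"
| "top_labels (Bot c # w) = top_labels w"

fun thru_labels :: "'a strand list \<Rightarrow> 'a list" where
  "thru_labels [] = []"
| "thru_labels (Top b # w) = thru_labels w"
| "thru_labels (Thru a # w) = a # thru_labels w"
| "thru_labels (Bot c # w) = thru_labels w"

fun bot_labels :: "'a strand list \<Rightarrow> 'a list" where
  "bot_labels [] = []"
| "bot_labels (Top b # w) = bot_labels w"
| "bot_labels (Thru a # w) = bot_labels w"
| "bot_labels (Bot c # w) = c # bot_labels w"

lemma word_induct [case_names Nil Top Thru Bot]:
  assumes "P []" "\<And>b w. P w \<Longrightarrow> P (Top b # w)" "\<And>a w. P w \<Longrightarrow> P (Thru a # w)"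
    "\<And>c w. P w \<Longrightarrow> P (Bot c # w)"
  shows "P w"
proof (induction w)
  case (Cons s w)
  then show ?case using assms(2-) by (cases s) auto
qed (rule assms(1))

definition word_labels :: "'a strand list \<Rightarrow> 'a list \<times> 'a list \<times> 'a list" where
  "word_labels w = (top_labels w, thru_labels w, bot_labels w)"

text \<open>A word without its labels.\<close>

abbreviation shape :: "'a strand list \<Rightarrow> unit strand list" where
  "shape w \<equiv> map (map_strand (\<lambda>_. ())) w"

lemma dom_word_map: "dom (word_map w k j) \<subseteq> {k..<k + word_bot w}"
proof (induction w arbitrary: k j rule: word_induct)
  case (Top b w)
  show ?case using Top[of k "Suc j"] by simp
next
  case (Thru a w)
  show ?case using Thru[of "Suc k" "Suc j"] by (simp add: subset_iff) force
next
  case (Bot c w)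
  show ?case using Bot[of "Suc k" j] by auto
qed simp

lemma word_map_None [simp]: "word_map w (Suc k) j k = None"
  using dom_word_map[of w "Suc k" j] by auto

lemma dom_word_map_Thru:
  "dom (word_map (Thru a # w) k j) = insert k (dom (word_map w (Suc k) (Suc j)))"
  unfolding word_map.simps dom_fun_upd by simp

lemma ran_word_map_Thru:
  "ran (word_map (Thru a # w) k j) = insert j (ran (word_map w (Suc k) (Suc j)))"
  unfolding word_map.simps by (rule ran_map_upd) (rule word_map_None)

lemma ran_word_map: "ran (word_map w k j) \<subseteq> {j..<j + word_top w}"
proof (induction w arbitrary: k j rule: word_induct)
  case (Top b w)
  show ?case using Top[of k "Suc j"] by auto
next
  case (Thru a w)
  show ?case unfolding ran_word_map_Thru using Thru[of "Suc k" "Suc j"] by auto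
next
  case (Bot c w)
  show ?case using Bot[of "Suc k" j] by simp
qed simp

lemma strict_mono_on_map_upd:
  fixes f :: "nat \<rightharpoonup> nat"
  assumes "strict_mono_on (dom f) (\<lambda>i. the (f i))" "\<And>i p. f i = Some p \<Longrightarrow> k < i \<and> j < p"
  shows "strict_mono_on (dom (f(k \<mapsto> j))) (\<lambda>i. the ((f(k \<mapsto> j)) i))"
proof (rule strict_mono_onI)
  fix p q assume pq: "p \<in> dom (f(k \<mapsto> j))" "q \<in> dom (f(k \<mapsto> j))" "p < q"
  have "q \<noteq> k"
  proof
    assume "q = k"
    then obtain p' where "f p = Some p'" using pq(1,3) by (cases "p = k") auto
    then have "k < p" using assms(2) by blast
    then show False using pq(3) \<open>q = k\<close> by simp
  qed
  then obtain q' where q: "f q = Some q'" using pq by (auto split: if_splits)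
  show "the ((f(k \<mapsto> j)) p) < the ((f(k \<mapsto> j)) q)"
  proof (cases "p = k")
    case True
    then show ?thesis using q assms(2)[OF q] \<open>q \<noteq> k\<close> by simp
  next
    case False
    then have "p \<in> dom f" using pq by (auto split: if_splits)
    then show ?thesis using strict_mono_onD[OF assms(1), of p q] pq(3) q False \<open>q \<noteq> k\<close> by auto
  qed
qed

lemma strict_mono_word_map: "strict_mono_on (dom (word_map w k j)) (\<lambda>i. the (word_map w k j i))"
proof (induction w arbitrary: k j rule: word_induct)
  case (Thru a w)
  have "k < i \<and> j < p" if "word_map w (Suc k) (Suc j) i = Some p" for i p
  proof -
    have "i \<in> dom (word_map w (Suc k) (Suc j))" "p \<in> ran (word_map w (Suc k) (Suc j))"
      using that by (auto intro: ranI)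
    then show ?thesis
      using dom_word_map[of w "Suc k" "Suc j"] ran_word_map[of w "Suc k" "Suc j"] by force
  qed
  from strict_mono_on_map_upd[OF Thru[of "Suc k" "Suc j"] this] show ?case
    unfolding word_map.simps .
qed (simp_all add: strict_mono_on_def)

lemma word_map_in_PB:
  assumes "word_bot w = n" "word_top w = m"
  shows "word_map w 1 1 \<in> PB m n"
proof -
  have "{1..<1 + n} = {1..n}" "{1..<1 + m} = {1..m}" by auto
  then show ?thesis
    using dom_word_map[of w 1 1] ran_word_map[of w 1 1] strict_mono_word_map[of w 1 1] assms
    by (simp add: PB_def)
qed

lemma width_word_map: "width (word_map w k j) = length (thru_labels w)"
proof (induction w arbitrary: k j rule: word_induct)
  case (Thru a w)
  have "finite (dom (word_map w (Suc k) (Suc j)))"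
    by (rule finite_subset[OF dom_word_map]) simp
  moreover have "k \<notin> dom (word_map w (Suc k) (Suc j))" by (simp add: domIff)
  ultimately show ?case
    using Thru[of "Suc k" "Suc j"] unfolding width_def dom_word_map_Thru by simp
qed (simp_all add: width_def)

lemma word_top_eq: "word_top w = length (top_labels w) + length (thru_labels w)"
  by (induction w rule: word_induct) auto

lemma word_bot_eq: "word_bot w = length (bot_labels w) + length (thru_labels w)"
  by (induction w rule: word_induct) auto

lemma word_in_iff:
  "word_in P Q R w \<longleftrightarrow> set (top_labels w) \<subseteq> P \<and> set (thru_labels w) \<subseteq> Q \<and> set (bot_labels w) \<subseteq> R"
  by (induction w rule: word_induct) auto

lemma mem_listset_replicate: "xs \<in> listset (replicate n A) \<longleftrightarrow> length xs = n \<and> set xs \<subseteq> A"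
proof (induction n arbitrary: xs)
  case (Suc n)
  then show ?case by (cases xs) (auto simp: set_Cons_def)
qed auto

lemma word_labels_in:
  assumes "word_in P Q R w" "word_bot w = n" "word_top w = m"
  shows "word_labels w \<in> labels m n (word_map w 1 1) P Q R"
  using assms
  by (auto simp: word_labels_def labels_def mem_listset_replicate width_word_map word_in_iff
      word_top_eq word_bot_eq)

lemma word_bot_shape [simp]: "word_bot (shape w) = word_bot w"
  by (induction w rule: word_induct) auto

lemma word_top_shape [simp]: "word_top (shape w) = word_top w"
  by (induction w rule: word_induct) auto

lemma word_map_shape [simp]: "word_map (shape w) k j = word_map w k j"
  by (induction w arbitrary: k j rule: word_induct) auto

lemma word_of_shape:
  fixes s :: "unit strand list"
  assumes "length bs = length (top_labels s)" "length as = length (thru_labels s)"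
    "length cs = length (bot_labels s)"
  shows "\<exists>w. shape w = s \<and> word_labels w = (bs, as, cs)"
  using assms
proof (induction s arbitrary: bs as cs)
  case (Cons x s)
  show ?case
  proof (cases x)
    case (Top u)
    then obtain b bs' where b: "bs = b # bs'" using Cons.prems by (cases bs) auto
    obtain w where "shape w = s" "word_labels w = (bs', as, cs)"
      using Cons.IH[of bs' as cs] Cons.prems Top b by auto
    then show ?thesis using Top b by (intro exI[of _ "strand.Top b # w"]) (simp add: word_labels_def)
  next
    case (Thru u)
    then obtain a as' where a: "as = a # as'" using Cons.prems by (cases as) auto
    obtain w where "shape w = s" "word_labels w = (bs, as', cs)"
      using Cons.IH[of bs as' cs] Cons.prems Thru a by auto
    then show ?thesis using Thru a by (intro exI[of _ "strand.Thru a # w"]) (simp add: word_labels_def)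
  next
    case (Bot u)
    then obtain c cs' where c: "cs = c # cs'" using Cons.prems by (cases cs) auto
    obtain w where "shape w = s" "word_labels w = (bs, as, cs')"
      using Cons.IH[of bs as cs'] Cons.prems Bot c by auto
    then show ?thesis using Bot c by (intro exI[of _ "strand.Bot c # w"]) (simp add: word_labels_def)
  qed
qed (simp add: word_labels_def)

text \<open>Every partial order-preserving bijection is read off from a word: in the planar diagram, the
  short bottom strands are drawn before the short top strands between two long strands.\<close>

lemma shape_of_map:
  assumes "dom f \<subseteq> {k..<k + n}" "ran f \<subseteq> {j..<j + m}" "strict_mono_on (dom f) (\<lambda>i. the (f i))"
  shows "\<exists>s :: unit strand list. word_map s k j = f \<and> word_bot s = n \<and> word_top s = m"
  using assms
proof (induction "n + m" arbitrary: n m k j f rule: less_induct)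
  case less
  consider "n = 0" "m = 0" | "n > 0" "k \<notin> dom f" | "m > 0" "j \<notin> ran f"
    | "n > 0" "m > 0" "k \<in> dom f" "j \<in> ran f"
  proof -
    have "j \<notin> ran f" if "n = 0"
      using less.prems(1) that by simp
    moreover have "k \<notin> dom f" if "m = 0"
      using less.prems(2) that by (auto simp: ran_def)
    ultimately show thesis using that by (metis gr0I)
  qed
  then show ?case
  proof cases
    case 1
    then have "f = Map.empty" using less.prems(1) by auto
    then show ?thesis using 1 by (intro exI[of _ "[]"]) simp
  next
    case 2
    have "dom f \<subseteq> {Suc k..<Suc k + (n - 1)}"
    proof
      fix i assume i: "i \<in> dom f"
      then have "i \<noteq> k" "i \<in> {k..<k + n}" using 2 less.prems(1) by blast+
      then show "i \<in> {Suc k..<Suc k + (n - 1)}" using 2 by simp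
    qed
    then obtain s :: "unit strand list" where
      "word_map s (Suc k) j = f" "word_bot s = n - 1" "word_top s = m"
      using less.hyps[of "n - 1" m f "Suc k" j] less.prems(2,3) 2 by auto
    then show ?thesis using 2 by (intro exI[of _ "Bot () # s"]) simp
  next
    case 3
    have "ran f \<subseteq> {Suc j..<Suc j + (m - 1)}"
    proof
      fix i assume i: "i \<in> ran f"
      then have "i \<noteq> j" "i \<in> {j..<j + m}" using 3 less.prems(2) by blast+
      then show "i \<in> {Suc j..<Suc j + (m - 1)}" using 3 by simp
    qed
    then obtain s :: "unit strand list" where
      "word_map s k (Suc j) = f" "word_bot s = n" "word_top s = m - 1"
      using less.hyps[of n "m - 1" f k "Suc j"] less.prems(1,3) 3 by auto
    then show ?thesis using 3 by (intro exI[of _ "Top () # s"]) simp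
  next
    case 4
    obtain i where i: "f i = Some j" using 4(4) by (auto simp: ran_def)
    obtain q where q: "f k = Some q" using 4(3) by auto
    have jq: "j \<le> q" using q less.prems(2) by (auto simp: ran_def)
    have ki: "k \<le> i" using i less.prems(1) by auto
    \<comment> \<open>the least point of the domain goes to the least point of the range\<close>
    have "i = k"
    proof (rule ccontr)
      assume "i \<noteq> k"
      then have "the (f k) < the (f i)"
        using strict_mono_onD[OF less.prems(3), of k i] ki i q by auto
      then show False using i q jq by simp
    qed
    then have fk: "f k = Some j" using i by simp
    have gt: "j < p" if "f i = Some p" "i \<noteq> k" for i p
    proof -
      have "i \<in> dom f" using that by auto
      then have "k < i" using that less.prems(1) by (auto simp: order_less_le)
      then have "the (f k) < the (f i)"
        using strict_mono_onD[OF less.prems(3), of k i] that fk by auto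
      then show ?thesis using fk that by simp
    qed
    define g where "g = f(k := None)"
    have "dom g \<subseteq> {Suc k..<Suc k + (n - 1)}"
    proof
      fix i assume "i \<in> dom g"
      then have "i \<noteq> k" "i \<in> {k..<k + n}" using less.prems(1) by (auto simp: g_def split: if_splits)
      then show "i \<in> {Suc k..<Suc k + (n - 1)}" using 4 by simp
    qed
    moreover have "ran g \<subseteq> {Suc j..<Suc j + (m - 1)}"
    proof
      fix p assume "p \<in> ran g"
      then obtain i where "f i = Some p" "i \<noteq> k" by (auto simp: g_def ran_def split: if_splits)
      then have "j < p" "p \<in> {j..<j + m}" using gt less.prems(2) by (auto simp: ran_def)
      then show "p \<in> {Suc j..<Suc j + (m - 1)}" using 4 by simp
    qed
    moreover have "strict_mono_on (dom g) (\<lambda>i. the (g i))"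
      using less.prems(3) by (auto simp: strict_mono_on_def g_def)
    ultimately obtain s :: "unit strand list" where
      "word_map s (Suc k) (Suc j) = g" "word_bot s = n - 1" "word_top s = m - 1"
      using less.hyps[of "n - 1" "m - 1" g "Suc k" "Suc j"] 4 by auto
    moreover have "g(k \<mapsto> j) = f" using fk by (auto simp: g_def)
    ultimately show ?thesis using 4 by (intro exI[of _ "Thru () # s"]) simp
  qed
qed

text \<open>Diagrams of one partial bijection have words of one shape. Words of different shapes may have the
  same partial bijection, since short top and short bottom strands commute.\<close>

lemma PB_shape:
  assumes "f \<in> PB m n"
  obtains s :: "unit strand list" where "\<And>P Q R (l :: 'a list \<times> 'a list \<times> 'a list). l \<in> labels m n f P Q R \<Longrightarrow>
    \<exists>w. shape w = s \<and> word_map w 1 1 = f \<and> word_labels w = l \<and> word_in P Q R w \<and>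
      word_bot w = n \<and> word_top w = m"
proof -
  have "dom f \<subseteq> {1..<1 + n}" "ran f \<subseteq> {1..<1 + m}" "strict_mono_on (dom f) (\<lambda>i. the (f i))"
    using assms by (auto simp: PB_def subset_iff)
  from shape_of_map[OF this] obtain s :: "unit strand list"
    where s: "word_map s 1 1 = f" "word_bot s = n" "word_top s = m" by blast
  have len: "length (thru_labels s) = width f" "length (top_labels s) = m - width f"
    "length (bot_labels s) = n - width f"
    using width_word_map[of s 1 1] word_top_eq[of s] word_bot_eq[of s] s by auto
  show thesis
  proof (rule that)
    fix P Q R and l :: "'a list \<times> 'a list \<times> 'a list" assume l: "l \<in> labels m n f P Q R"
    obtain bs as cs where bs: "l = (bs, as, cs)" by (cases l)
    have "length bs = m - width f" "length as = width f" "length cs = n - width f"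
      and sub: "set bs \<subseteq> P" "set as \<subseteq> Q" "set cs \<subseteq> R"
      using l by (auto simp: bs labels_def mem_listset_replicate)
    then obtain w where w: "shape w = s" "word_labels w = l"
      using word_of_shape[of bs s as cs] len bs by auto
    moreover have "word_in P Q R w"
      using sub w(2) bs by (simp add: word_in_iff word_labels_def)
    ultimately show "\<exists>w. shape w = s \<and> word_map w 1 1 = f \<and> word_labels w = l \<and> word_in P Q R w \<and>
      word_bot w = n \<and> word_top w = m"
      using s word_bot_shape[of w] word_top_shape[of w] word_map_shape[of w 1 1] by (intro exI[of _ w]) simp
  qed
qed

lemma row_factors_insert:
  "x \<notin> set is \<Longrightarrow> row_factors g (insert x L) is cs = row_factors g L is cs"
  by (induction "is" arbitrary: cs) auto

lemma tens_list_Cons: "tens_list (x # xs) = Tens x (tens_list xs)"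
  by (simp add: tens_list_def)

text \<open>The three rows of the diagram that a word describes, from top to bottom; \<open>k\<close> and \<open>j\<close> are the
  numbers of the first bottom and top points.\<close>

definition top_row :: "'a strand list \<Rightarrow> nat \<Rightarrow> nat \<Rightarrow> ('k, 'a) expr" where
  "top_row w k j = tens_list
     (row_factors (Gen 1 0) (ran (word_map w k j)) [j..<j + word_top w] (top_labels w))"

definition mid_row :: "'a strand list \<Rightarrow> ('k, 'a) expr" where
  "mid_row w = tens_list (map (Gen 1 1) (thru_labels w))"

definition bot_row :: "'a strand list \<Rightarrow> nat \<Rightarrow> nat \<Rightarrow> ('k, 'a) expr" where
  "bot_row w k j = tens_list
     (row_factors (Gen 0 1) (dom (word_map w k j)) [k..<k + word_bot w] (bot_labels w))"

lemma diagram_expr_word: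
  "diagram_expr (word_top w) (word_bot w) (word_map w 1 1) (word_labels w) =
     Comp (top_row w 1 1) (Comp (mid_row w) (bot_row w 1 1))"
  unfolding diagram_expr_def word_labels_def top_row_def mid_row_def bot_row_def
  by (simp only: case_prod_conv plus_1_eq_Suc)

lemma upt_Cons: "[k..<k + (1 + n)] = k # [Suc k..<Suc k + n]"
proof -
  have "[k..<Suc k + n] = k # [Suc k..<Suc k + n]" by (rule upt_conv_Cons) simp
  moreover have "k + (1 + n) = Suc k + n" by simp
  ultimately show ?thesis by (simp only:)
qed

lemma top_row_simps:
  "top_row [] k j = Id 0"
  "top_row (Top b # w) k j = Tens (Gen 1 0 b) (top_row w k (Suc j))"
  "top_row (Thru a # w) k j = Tens (Id 1) (top_row w (Suc k) (Suc j))"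
  "top_row (Bot c # w) k j = top_row w (Suc k) j"
proof -
  have "j \<notin> ran (word_map w k (Suc j))" using ran_word_map[of w k "Suc j"] by auto
  then show "top_row (Top b # w) k j = Tens (Gen 1 0 b) (top_row w k (Suc j))"
    by (simp add: top_row_def upt_Cons tens_list_Cons del: upt_Suc)
  show "top_row (Thru a # w) k j = Tens (Id 1) (top_row w (Suc k) (Suc j))"
    unfolding top_row_def ran_word_map_Thru
    by (simp add: upt_Cons tens_list_Cons row_factors_insert del: upt_Suc)
qed (simp_all add: top_row_def tens_list_def)

lemma mid_row_simps:
  "mid_row [] = Id 0"
  "mid_row (Top b # w) = mid_row w"
  "mid_row (Thru a # w) = Tens (Gen 1 1 a) (mid_row w)"
  "mid_row (Bot c # w) = mid_row w"
  by (simp_all add: mid_row_def tens_list_def)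

lemma bot_row_simps:
  "bot_row [] k j = Id 0"
  "bot_row (Top b # w) k j = bot_row w k (Suc j)"
  "bot_row (Thru a # w) k j = Tens (Id 1) (bot_row w (Suc k) (Suc j))"
  "bot_row (Bot c # w) k j = Tens (Gen 0 1 c) (bot_row w (Suc k) j)"
proof -
  have "k \<notin> dom (word_map w (Suc k) j)" by (simp add: domIff word_map_None)
  then show "bot_row (Bot c # w) k j = Tens (Gen 0 1 c) (bot_row w (Suc k) j)"
    by (simp add: bot_row_def upt_Cons tens_list_Cons del: upt_Suc)
  show "bot_row (Thru a # w) k j = Tens (Id 1) (bot_row w (Suc k) (Suc j))"
    unfolding bot_row_def dom_word_map_Thru
    by (simp add: upt_Cons tens_list_Cons row_factors_insert del: upt_Suc)
qed (simp_all add: bot_row_def tens_list_def)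

context field_corner_algebra begin

lemma harr_rows:
  assumes "good_word w"
  shows "harr (top_row w k j) (length (thru_labels w)) (word_top w)"
    and "harr (mid_row w) (length (thru_labels w)) (length (thru_labels w))"
    and "harr (bot_row w k j) (word_bot w) (length (thru_labels w))"
proof -
  have "harr (top_row w k j) (length (thru_labels w)) (word_top w) \<and>
    harr (mid_row w) (length (thru_labels w)) (length (thru_labels w)) \<and>
    harr (bot_row w k j) (word_bot w) (length (thru_labels w))"
    using assms
  proof (induction w arbitrary: k j)
    case Nil
    show ?case by (auto simp: top_row_simps mid_row_simps bot_row_simps intro: arr.intros)
  next
    case (Cons s w)
    note gen = arr.intros(2)[where e = e]
    show ?case
    proof (cases s)
      case (Top b)
      have "harr (Gen 1 0 b) 0 1" using Cons.prems Top by (intro gen) auto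
      from arr.intros(4)[OF this, of "top_row w k (Suc j)"] show ?thesis
        using Cons.IH[of k "Suc j"] Cons.prems Top
        by (simp add: top_row_simps mid_row_simps bot_row_simps)
    next
      case (Thru a)
      have a: "harr (Gen 1 1 a) 1 1" using Cons.prems Thru by (intro gen) auto
      have i: "harr (Id 1) 1 1" by (rule arr.intros)
      show ?thesis
        using Cons.IH[of "Suc k" "Suc j"] Cons.prems Thru arr.intros(4)[OF a, of "mid_row w"]
          arr.intros(4)[OF i, of "top_row w (Suc k) (Suc j)"]
          arr.intros(4)[OF i, of "bot_row w (Suc k) (Suc j)"]
        by (simp add: plus_1_eq_Suc top_row_simps mid_row_simps bot_row_simps)
    next
      case (Bot c)
      have "harr (Gen 0 1 c) 1 0" using Cons.prems Bot by (intro gen) auto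
      from arr.intros(4)[OF this, of "bot_row w (Suc k) j"] show ?thesis
        using Cons.IH[of "Suc k" j] Cons.prems Bot
        by (simp add: top_row_simps mid_row_simps bot_row_simps)
    qed
  qed
  then show "harr (top_row w k j) (length (thru_labels w)) (word_top w)"
    and "harr (mid_row w) (length (thru_labels w)) (length (thru_labels w))"
    and "harr (bot_row w k j) (word_bot w) (length (thru_labels w))"
    by auto
qed

lemma word_heq_rows:
  assumes "good_word w"
  shows "heq (word_bot w) (word_top w) (Comp (top_row w k j) (Comp (mid_row w) (bot_row w k j)))
    (word_expr w)"
  using assms
proof (induction w arbitrary: k j)
  case Nil
  have i: "harr (Id 0) 0 0" by (rule arr.intros)
  have "heq 0 0 (Comp (Id 0) (Comp (Id 0) (Id 0))) (Comp (Id 0) (Id 0))"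
    by (rule hom_eq.id_comp[OF arr.intros(3)[OF i i]])
  also have "heq 0 0 \<dots> (Id 0)" by (rule hom_eq.id_comp[OF i])
  finally show ?case by (simp add: top_row_simps mid_row_simps bot_row_simps)
next
  case (Cons s w)
  have s: "good_strand s" and w: "good_word w" using Cons.prems by auto
  note rows = harr_rows[OF w]
  let ?n = "word_bot (s # w)" and ?m = "word_top (s # w)"
  show ?case
  proof (cases s)
    case (Top b)
    have b: "harr (Gen 1 0 b) 0 1" using arr_strand[OF s] Top by simp
    have "heq ?n ?m (Comp (Tens (Gen 1 0 b) (top_row w k (Suc j))) (Comp (mid_row w) (bot_row w k (Suc j))))
        (Tens (Gen 1 0 b) (Comp (top_row w k (Suc j)) (Comp (mid_row w) (bot_row w k (Suc j)))))"
      using comp_tens_top[OF b rows(1)[of k "Suc j"] arr.intros(3)[OF rows(2) rows(3)[of k "Suc j"]]]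
        Top by simp
    also have "heq ?n ?m \<dots> (Tens (Gen 1 0 b) (word_expr w))"
      using hom_eq.tens_cong[OF hom_eq.refl[OF b] Cons.IH[OF w, of k "Suc j"]] Top by simp
    finally show ?thesis using Top by (simp add: top_row_simps mid_row_simps bot_row_simps)
  next
    case (Bot c)
    have c: "harr (Gen 0 1 c) 1 0" using arr_strand[OF s] Bot by simp
    let ?T = "top_row w (Suc k) j" and ?M = "mid_row w" and ?S = "bot_row w (Suc k) j"
    note rows = rows(1,3)[of "Suc k" j] rows(2)
    have "heq ?n ?m (Comp ?T (Comp ?M (Tens (Gen 0 1 c) ?S))) (Comp ?T (Tens (Gen 0 1 c) (Comp ?M ?S)))"
      using hom_eq.comp_cong[OF hom_eq.refl[OF rows(1)] comp_tens_bot[OF c rows(3,2)]] Bot by simp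
    also have "heq ?n ?m \<dots> (Tens (Gen 0 1 c) (Comp ?T (Comp ?M ?S)))"
      using comp_tens_bot[OF c rows(1) arr.intros(3)[OF rows(3,2)]] Bot by simp
    also have "heq ?n ?m \<dots> (Tens (Gen 0 1 c) (word_expr w))"
      using hom_eq.tens_cong[OF hom_eq.refl[OF c] Cons.IH[OF w, of "Suc k" j]] Bot by simp
    finally show ?thesis using Bot by (simp add: top_row_simps mid_row_simps bot_row_simps)
  next
    case (Thru a)
    have a: "harr (Gen 1 1 a) 1 1" using arr_strand[OF s] Thru by simp
    have i: "harr (Id 1) 1 1" by (rule arr.intros)
    let ?T = "top_row w (Suc k) (Suc j)" and ?M = "mid_row w" and ?S = "bot_row w (Suc k) (Suc j)"
    note rows = rows(1,3)[of "Suc k" "Suc j"] rows(2)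
    note iT = arr.intros(4)[OF i rows(1)]
    note MS = arr.intros(3)[OF rows(3,2)]
    have "heq ?n ?m (Comp (Tens (Id 1) ?T) (Comp (Tens (Gen 1 1 a) ?M) (Tens (Id 1) ?S)))
       (Comp (Tens (Id 1) ?T) (Tens (Comp (Gen 1 1 a) (Id 1)) (Comp ?M ?S)))"
      using hom_eq.comp_cong[OF hom_eq.refl[OF iT]
          hom_eq.sym[OF hom_eq.interchange[OF a i rows(3,2)]]] Thru by simp
    also have "heq ?n ?m \<dots> (Tens (Comp (Id 1) (Comp (Gen 1 1 a) (Id 1))) (Comp ?T (Comp ?M ?S)))"
      using hom_eq.sym[OF hom_eq.interchange[OF i arr.intros(3)[OF a i] rows(1) MS]] Thru by simp
    also have "heq ?n ?m \<dots> (Tens (Gen 1 1 a) (word_expr w))"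
      using hom_eq.tens_cong[OF hom_eq.trans[OF hom_eq.id_comp[OF arr.intros(3)[OF a i]] hom_eq.comp_id[OF a]]
          Cons.IH[OF w, of "Suc k" "Suc j"]] Thru by simp
    finally show ?thesis using Thru by (simp add: top_row_simps mid_row_simps bot_row_simps)
  qed
qed

text \<open>A word is equivalent to the labelled diagram that is read off from it.\<close>

lemma word_heq_diagram:
  assumes "good_word w" "word_bot w = n" "word_top w = m"
  shows "heq n m (diagram_expr m n (word_map w 1 1) (word_labels w)) (word_expr w)"
  using word_heq_rows[OF assms(1), of 1 1] assms(2,3) by (simp flip: diagram_expr_word)

end

section \<open>The action of morphisms on states\<close>

text \<open>A state is a diagram from a fixed set of bottom points. It is given by the strands at its top
  points, from left to right, and by the labels of its short bottom strands: \<open>(None, b)\<close> is a short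
  top strand, \<open>(Some i, a)\<close> is a long strand from the bottom point \<open>i\<close>, and \<open>\<beta> i\<close> is the label of
  the short strand at the bottom point \<open>i\<close>, with an irrelevant value if \<open>i\<close> is the end of a long
  strand.\<close>

type_synonym 'a letter = "nat option \<times> 'a"

text \<open>The bottom ends of the long strands.\<close>

fun ends :: "'a letter list \<Rightarrow> nat list" where
  "ends [] = []"
| "ends ((None, x) # w) = ends w"
| "ends ((Some i, x) # w) = i # ends w"

lemma ends_append [simp]: "ends (v @ w) = ends v @ ends w"
  by (induction v rule: ends.induct) auto

text \<open>The label of the strand \<open>(d, x)\<close> is in the corner \<open>corner e 1 (column d)\<close>.\<close>

definition column :: "nat option \<Rightarrow> nat" where
  "column d = (case d of None \<Rightarrow> 0 | Some i \<Rightarrow> 1)"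

lemma column_simps [simp]: "column None = 0" "column (Some i) = 1"
  by (simp_all add: column_def)

text \<open>The strand that results from putting the generator \<open>[u]\<close> on top of \<open>m\<close>, which is empty or
  a single strand.\<close>

definition put_on :: "'a::times \<Rightarrow> 'a letter list \<Rightarrow> 'a letter" where
  "put_on u m = (case m of [] \<Rightarrow> (None, u) | (d, x) # _ \<Rightarrow> (d, u * x))"

lemma put_on_simps [simp]: "put_on u [] = (None, u)" "put_on u ((d, x) # w) = (d, u * x)"
  by (simp_all add: put_on_def)

text \<open>The number of top points of a well-formed expression.\<close>

fun target :: "('k, 'a) expr \<Rightarrow> nat" where
  "target (Id n) = n"
| "target (Gen i j u) = i"
| "target (Comp g f) = target g"
| "target (Tens f g) = target f + target g"
| "target (Zero n m) = m"
| "target (Add f g) = target f"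
| "target (Scal a f) = target f"

lemma target_arr: "arr e f n m \<Longrightarrow> target f = m"
  by (induction rule: arr.induct) auto

context field_corner_algebra begin

text \<open>Functions that are linear on the subspace \<open>C\<close>; nothing is said about other arguments.\<close>

definition linear_on :: "'a set \<Rightarrow> ('a \<Rightarrow> 'k) \<Rightarrow> bool" where
  "linear_on C f \<longleftrightarrow> (\<forall>x\<in>C. \<forall>y\<in>C. f (x + y) = f x + f y) \<and> (\<forall>a. \<forall>x\<in>C. f (scale a x) = a * f x)"

lemma linear_on_mult_const: "linear_on C f \<Longrightarrow> linear_on C (\<lambda>x. s * f x)"
  by (simp add: linear_on_def algebra_simps)

lemma linear_on_kappa: "linear_on C (\<lambda>x. \<kappa> x * s)"
  by (simp add: linear_on_def kappa_add kappa_scale algebra_simps)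

lemma linear_on_lmult:
  "linear_on (corner e i k) f \<Longrightarrow> u \<in> corner e i j \<Longrightarrow> linear_on (corner e j k) (\<lambda>x. f (u * x))"
  by (simp add: linear_on_def distrib_left scale_mult_right corner_mult[of u i j _ k])

lemma linear_on_add: "linear_on C f \<Longrightarrow> linear_on C g \<Longrightarrow> linear_on C (\<lambda>x. f x + g x)"
  by (simp add: linear_on_def algebra_simps)

lemma linear_on_zero: "linear_on C (\<lambda>x. 0)"
  by (simp add: linear_on_def)

text \<open>An observable is a function of states, with values in the field.\<close>

type_synonym ('b, 'c) observable = "'b letter list \<Rightarrow> (nat \<Rightarrow> 'b) \<Rightarrow> 'c"

text \<open>The value of an observable at the state that results when the strand \<open>(d, y)\<close> is put between
  \<open>p\<close> and \<open>q\<close>, where \<open>y\<close> is in \<open>(1-e)A\<close> if \<open>i = 1\<close> and in \<open>eA\<close> if \<open>i = 0\<close>. In the second case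
  there is no top point: the strand is a scalar or a short bottom strand.\<close>

definition emit :: "nat \<Rightarrow> ('a, 'k) observable \<Rightarrow> 'a letter list \<Rightarrow> 'a letter \<Rightarrow> 'a letter list \<Rightarrow>
    (nat \<Rightarrow> 'a) \<Rightarrow> 'k" where
  "emit i \<phi> p L q \<beta> = (if i = 0
     then (case fst L of None \<Rightarrow> \<kappa> (snd L) * \<phi> (p @ q) \<beta> | Some k \<Rightarrow> \<phi> (p @ q) (\<beta>(k := snd L)))
     else \<phi> (p @ L # q) \<beta>)"

lemma emit_simps [simp]:
  "emit 0 \<phi> p (None, y) q \<beta> = \<kappa> y * \<phi> (p @ q) \<beta>"
  "emit 0 \<phi> p (Some k, y) q \<beta> = \<phi> (p @ q) (\<beta>(k := y))"
  "emit 1 \<phi> p L q \<beta> = \<phi> (p @ L # q) \<beta>"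
  by (simp_all add: emit_def)

text \<open>Expressions act on observables: \<open>sem f l \<phi>\<close> is the value of \<open>\<phi>\<close> after \<open>f\<close> has been put on top
  of the state, with \<open>l\<close> free top points on its left. So the action reverses composition. If the state has too few
  top points for a generator, then the value 0 is a default.\<close>

fun sem :: "('k, 'a) expr \<Rightarrow> nat \<Rightarrow> ('a, 'k) observable \<Rightarrow> ('a, 'k) observable" where
  "sem (Id n) l \<phi> = \<phi>"
| "sem (Gen i j u) l \<phi> = (\<lambda>\<tau> \<beta>. if l + j \<le> length \<tau>
     then emit i \<phi> (take l \<tau>) (put_on u (take j (drop l \<tau>))) (drop (l + j) \<tau>) \<beta> else 0)"
| "sem (Comp g f) l \<phi> = sem f l (sem g l \<phi>)"
| "sem (Tens f g) l \<phi> = sem f l (sem g (l + target f) \<phi>)"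
| "sem (Zero n m) l \<phi> = (\<lambda>\<tau> \<beta>. 0)"
| "sem (Add f g) l \<phi> = (\<lambda>\<tau> \<beta>. sem f l \<phi> \<tau> \<beta> + sem g l \<phi> \<tau> \<beta>)"
| "sem (Scal a f) l \<phi> = (\<lambda>\<tau> \<beta>. a * sem f l \<phi> \<tau> \<beta>)"

lemma sem_Gen:
  assumes "length p = l" "length m = j"
  shows "sem (Gen i j u) l \<phi> (p @ m @ q) \<beta> = emit i \<phi> p (put_on u m) q \<beta>"
  using assms by simp

declare sem.simps(2) [simp del]

lemma sem_Gen_short: "length \<tau> < l + j \<Longrightarrow> sem (Gen i j u) l \<phi> \<tau> \<beta> = 0"
  by (simp add: sem.simps(2))

lemma sem_add: "sem f l (\<lambda>\<tau> \<beta>. \<phi> \<tau> \<beta> + \<psi> \<tau> \<beta>) = (\<lambda>\<tau> \<beta>. sem f l \<phi> \<tau> \<beta> + sem f l \<psi> \<tau> \<beta>)"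
proof (induction f arbitrary: l \<phi> \<psi>)
  case (Gen i j u)
  show ?case by (auto simp: fun_eq_iff sem.simps(2) emit_def algebra_simps split: option.split)
qed (simp_all add: algebra_simps)

lemma sem_scal: "sem f l (\<lambda>\<tau> \<beta>. a * \<phi> \<tau> \<beta>) = (\<lambda>\<tau> \<beta>. a * sem f l \<phi> \<tau> \<beta>)"
proof (induction f arbitrary: l \<phi>)
  case (Gen i j u)
  show ?case by (auto simp: fun_eq_iff sem.simps(2) emit_def algebra_simps split: option.split)
qed (simp_all add: algebra_simps)

lemma sem_zero: "sem f l (\<lambda>\<tau> \<beta>. 0) = (\<lambda>\<tau> \<beta>. 0)"
  using sem_scal[of f l 0 "\<lambda>\<tau> \<beta>. 0"] by simp

context
  fixes P :: "nat set"
begin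

text \<open>The parameter \<open>P\<close> is the set of bottom points. A state is valid if its labels are in the corners that
  they should be in, and each bottom point is on at most one long strand.\<close>

definition valid :: "'a letter list \<Rightarrow> (nat \<Rightarrow> 'a) \<Rightarrow> bool" where
  "valid \<tau> \<beta> \<longleftrightarrow> distinct (ends \<tau>) \<and> set (ends \<tau>) \<subseteq> P \<and>
     (\<forall>(d, x)\<in>set \<tau>. x \<in> corner e 1 (column d)) \<and> (\<forall>i. \<beta> i \<in> corner e 0 1)"

text \<open>The observables of interest are linear in each label, and do not distinguish a long strand
  with label \<open>b * c\<close> from a short top strand with label \<open>b\<close> and a short bottom strand with
  label \<open>c\<close>.\<close>

definition multilinear :: "('a, 'k) observable \<Rightarrow> bool" where
  "multilinear \<phi> \<longleftrightarrow>
     (\<forall>p d q \<beta>. valid (p @ (d, 0) # q) \<beta> \<longrightarrow>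
        linear_on (corner e 1 (column d)) (\<lambda>x. \<phi> (p @ (d, x) # q) \<beta>)) \<and>
     (\<forall>\<tau> \<beta> i. valid \<tau> \<beta> \<longrightarrow> i \<in> P - set (ends \<tau>) \<longrightarrow>
        linear_on (corner e 0 1) (\<lambda>c. \<phi> \<tau> (\<beta>(i := c)))) \<and>
     (\<forall>p i b c q \<beta>. valid (p @ (Some i, 0) # q) \<beta> \<longrightarrow> b \<in> corner e 1 0 \<longrightarrow> c \<in> corner e 0 1 \<longrightarrow>
        \<phi> (p @ (Some i, b * c) # q) \<beta> = \<phi> (p @ (None, b) # q) (\<beta>(i := c)))"

text \<open>Equality of observables on valid states with at least \<open>N\<close> top points. The bound excludes the default
  values of the action.\<close>

definition agree :: "nat \<Rightarrow> ('a, 'k) observable \<Rightarrow> ('a, 'k) observable \<Rightarrow> bool" where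
  "agree N \<phi> \<psi> \<longleftrightarrow> (\<forall>\<tau> \<beta>. valid \<tau> \<beta> \<longrightarrow> N \<le> length \<tau> \<longrightarrow> \<phi> \<tau> \<beta> = \<psi> \<tau> \<beta>)"

lemma multilinear_top:
  "multilinear \<phi> \<Longrightarrow> valid (p @ (d, 0) # q) \<beta> \<Longrightarrow>
     linear_on (corner e 1 (column d)) (\<lambda>x. \<phi> (p @ (d, x) # q) \<beta>)"
  unfolding multilinear_def by blast

lemma multilinear_bot:
  "multilinear \<phi> \<Longrightarrow> valid \<tau> \<beta> \<Longrightarrow> i \<in> P \<Longrightarrow> i \<notin> set (ends \<tau>) \<Longrightarrow>
     linear_on (corner e 0 1) (\<lambda>c. \<phi> \<tau> (\<beta>(i := c)))"
  unfolding multilinear_def by blast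

lemma multilinear_cut:
  "multilinear \<phi> \<Longrightarrow> valid (p @ (Some i, 0) # q) \<beta> \<Longrightarrow> b \<in> corner e 1 0 \<Longrightarrow> c \<in> corner e 0 1 \<Longrightarrow>
     \<phi> (p @ (Some i, b * c) # q) \<beta> = \<phi> (p @ (None, b) # q) (\<beta>(i := c))"
  unfolding multilinear_def by blast

lemma multilinear_zero: "multilinear (\<lambda>\<tau> \<beta>. 0)"
  by (simp add: multilinear_def linear_on_zero)

lemma multilinear_add: "multilinear \<phi> \<Longrightarrow> multilinear \<psi> \<Longrightarrow> multilinear (\<lambda>\<tau> \<beta>. \<phi> \<tau> \<beta> + \<psi> \<tau> \<beta>)"
  by (simp add: multilinear_def linear_on_add)

lemma multilinear_scal: "multilinear \<phi> \<Longrightarrow> multilinear (\<lambda>\<tau> \<beta>. a * \<phi> \<tau> \<beta>)"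
  by (simp add: multilinear_def linear_on_mult_const)

lemma valid_slot:
  "valid (p @ (d, x) # q) \<beta> \<longleftrightarrow> valid (p @ (d, 0) # q) \<beta> \<and> x \<in> corner e 1 (column d)"
  by (cases d) (auto simp: valid_def)

lemma valid_bot: "valid \<tau> \<beta> \<Longrightarrow> c \<in> corner e 0 1 \<Longrightarrow> valid \<tau> (\<beta>(i := c))"
  by (simp add: valid_def)

lemma valid_delete: "valid (p @ (d, x) # q) \<beta> \<Longrightarrow> valid (p @ q) \<beta>"
  by (cases d) (auto simp: valid_def)

lemma valid_insert: "valid (p @ q) \<beta> \<Longrightarrow> valid (p @ (None, 0) # q) \<beta>"
  by (auto simp: valid_def)

lemma valid_end:
  "valid (p @ (Some i, x) # q) \<beta> \<Longrightarrow> i \<in> P \<and> i \<notin> set (ends p) \<and> i \<notin> set (ends q)"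
  by (auto simp: valid_def)

text \<open>The strand that a generator makes.\<close>

lemma put_on_valid:
  assumes "valid (p @ m @ q) \<beta>" "length m = j" "j \<le> 1" "u \<in> corner e i j" "put_on u m = (d, y)"
  shows "valid (p @ (d, 0) # q) \<beta> \<and> y \<in> corner e i (column d)"
proof (cases m)
  case Nil
  then show ?thesis using assms valid_insert by auto
next
  case (Cons a m')
  then obtain x where "m = [(d, x)]" "y = u * x" "j = 1"
    using assms by (cases a) auto
  then show ?thesis using assms(1,4) valid_slot[of p d x q \<beta>] by (auto intro: corner_mult)
qed

lemma emit_cong:
  assumes "valid (p @ (d, 0) # q) \<beta>" "y \<in> corner e i (column d)" "i \<le> 1"
    and "agree N \<phi> \<psi>" "N \<le> length p + i + length q"
  shows "emit i \<phi> p (d, y) q \<beta> = emit i \<psi> p (d, y) q \<beta>"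
proof -
  have i: "i = 0 \<or> i = 1" using assms(3) by linarith
  have v: "valid (p @ q) \<beta>" using assms(1) by (rule valid_delete)
  show ?thesis
  proof (cases "i = 0")
    case True
    then show ?thesis
      using assms v valid_bot[OF v, of y] by (cases d) (auto simp: agree_def)
  next
    case False
    then have "i = 1" using i by simp
    then show ?thesis
      using assms valid_slot[of p d y q \<beta>] by (simp add: agree_def)
  qed
qed

lemma emit_linear:
  assumes "multilinear \<phi>" "valid (p @ (d, 0) # q) \<beta>" "i \<le> 1"
  shows "linear_on (corner e i (column d)) (\<lambda>y. emit i \<phi> p (d, y) q \<beta>)"
proof -
  have i: "i = 0 \<or> i = 1" using assms(3) by linarith
  then show ?thesis
  proof
    assume "i = 1"
    then show ?thesis using multilinear_top[OF assms(1,2)] by simp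
  next
    assume i: "i = 0"
    show ?thesis
    proof (cases d)
      case None
      then show ?thesis using i by (simp add: linear_on_kappa)
    next
      case (Some k)
      have "valid (p @ q) \<beta>" using assms(2) by (rule valid_delete)
      moreover have "k \<in> P" "k \<notin> set (ends (p @ q))" using valid_end assms(2) Some by auto
      ultimately show ?thesis using i Some multilinear_bot[OF assms(1)] by simp
    qed
  qed
qed

text \<open>A strand can be cut before a generator is put on it.\<close>

lemma emit_cut:
  assumes "multilinear \<phi>" "valid (p @ (Some k, 0) # q) \<beta>" "i \<le> 1"
    and y: "y \<in> corner e i 0" and c: "c \<in> corner e 0 1"
  shows "emit i \<phi> p (Some k, y * c) q \<beta> = emit i \<phi> p (None, y) q (\<beta>(k := c))"
proof -
  have "i = 0 \<or> i = 1" using assms(3) by linarith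
  then show ?thesis
  proof
    assume "i = 1"
    then show ?thesis using multilinear_cut[OF assms(1,2)] y c by simp
  next
    assume i: "i = 0"
    have "y * c = scale (\<kappa> y) (e * c)" using kappa_corner y i by (metis scale_mult_left)
    also have "e * c = c" using corner_left[OF c] by (simp add: block_idem_def)
    finally have yc: "y * c = scale (\<kappa> y) c" .
    have "valid (p @ q) \<beta>" using assms(2) by (rule valid_delete)
    moreover have "k \<in> P" "k \<notin> set (ends (p @ q))" using valid_end assms(2) by auto
    ultimately have "\<phi> (p @ q) (\<beta>(k := scale (\<kappa> y) c)) = \<kappa> y * \<phi> (p @ q) (\<beta>(k := c))"
      using multilinear_bot[OF assms(1)] c by (simp add: linear_on_def)
    then show ?thesis using i yc by simp
  qed
qed

lemma agreeI: "(\<And>\<tau> \<beta>. valid \<tau> \<beta> \<Longrightarrow> N \<le> length \<tau> \<Longrightarrow> \<phi> \<tau> \<beta> = \<psi> \<tau> \<beta>) \<Longrightarrow> agree N \<phi> \<psi>"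
  by (simp add: agree_def)

lemma agree_refl [simp]: "agree N \<phi> \<phi>"
  by (simp add: agree_def)

lemma agree_sym: "agree N \<phi> \<psi> \<Longrightarrow> agree N \<psi> \<phi>"
  by (simp add: agree_def)

lemma agree_trans: "agree N \<phi> \<psi> \<Longrightarrow> agree N \<psi> \<chi> \<Longrightarrow> agree N \<phi> \<chi>"
  by (simp add: agree_def)

lemma split_top:
  assumes "l + j \<le> length \<tau>"
  obtains p m q where "\<tau> = p @ m @ q" "length p = l" "length m = j"
  using that[of "take l \<tau>" "take j (drop l \<tau>)" "drop (l + j) \<tau>"] assms
  by (simp add: add.commute flip: drop_drop)

lemma sem_agree:
  assumes "harr f n m" "agree (l + m + x) \<phi> \<psi>"
  shows "agree (l + n + x) (sem f l \<phi>) (sem f l \<psi>)"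
  using assms
proof (induction arbitrary: l x \<phi> \<psi> rule: arr.induct)
  case (2 i j u)
  show ?case
  proof (rule agreeI)
    fix \<tau> \<beta> assume v: "valid \<tau> \<beta>" and len: "l + j + x \<le> length \<tau>"
    then obtain p m q where t: "\<tau> = p @ m @ q" "length p = l" "length m = j"
      using split_top[of l j \<tau>] by auto
    obtain d y where dy: "put_on u m = (d, y)" by (cases "put_on u m")
    have "valid (p @ (d, 0) # q) \<beta> \<and> y \<in> corner e i (column d)"
      using put_on_valid[OF v[unfolded t(1)] t(3) 2(2,3) dy] .
    moreover have "l + i + x \<le> length p + i + length q" using len t by simp
    ultimately show "sem (Gen i j u) l \<phi> \<tau> \<beta> = sem (Gen i j u) l \<psi> \<tau> \<beta>"
      unfolding t(1) sem_Gen[OF t(2,3)] dy using emit_cong 2 by blast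
  qed
next
  case (4 f n m g n' m')
  have "agree (l + target f + n' + x) (sem g (l + target f) \<phi>) (sem g (l + target f) \<psi>)"
    using 4(5) target_arr[OF 4(1)] by (intro 4(4)) (simp add: add.assoc)
  then have "agree (l + m + (n' + x)) (sem g (l + target f) \<phi>) (sem g (l + target f) \<psi>)"
    using target_arr[OF 4(1)] by (simp add: add.assoc)
  from 4(3)[OF this] show ?case by (simp add: add.assoc)
next
  case (3 g m p f n)
  from 3(4)[OF 3(3)[OF 3(5)]] show ?case by simp
qed (auto simp: agree_def)

lemma sem_agree0:
  "harr f n m \<Longrightarrow> agree (l + m) \<phi> \<psi> \<Longrightarrow> agree (l + n) (sem f l \<phi>) (sem f l \<psi>)"
  using sem_agree[of f n m l 0] by simp

text \<open>The interchange law, for expressions side by side.\<close>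

definition commute :: "('k, 'a) expr \<Rightarrow> nat \<Rightarrow> nat \<Rightarrow> ('k, 'a) expr \<Rightarrow> nat \<Rightarrow> bool" where
  "commute f n m g n' \<longleftrightarrow> (\<forall>l d \<phi>. agree (l + n + d + n')
     (sem f l (sem g (l + m + d) \<phi>)) (sem g (l + n + d) (sem f l \<phi>)))"

lemma commute_gens:
  assumes f: "i \<le> 1" "j \<le> 1" "u \<in> corner e i j" and g: "i' \<le> 1" "j' \<le> 1" "v \<in> corner e i' j'"
  shows "commute (Gen i j u) j i (Gen i' j' v) j'"
  unfolding commute_def
proof (intro allI agreeI)
  fix l d \<tau> \<beta> and \<phi> :: "('a, 'k) observable"
  assume val: "valid \<tau> \<beta>" and len: "l + j + d + j' \<le> length \<tau>"
  obtain p m r where t: "\<tau> = p @ m @ r" "length p = l" "length m = j"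
    using split_top[of l j \<tau>] len by auto
  have "d + j' \<le> length r" using t len by simp
  then obtain q m' s where r: "r = q @ m' @ s" "length q = d" "length m' = j'"
    using split_top[of d j' r] by auto
  obtain o1 y where y: "put_on u m = (o1, y)" by (cases "put_on u m")
  obtain o2 z where z: "put_on v m' = (o2, z)" by (cases "put_on v m'")
  have v1: "valid (p @ (o1, 0) # q @ m' @ s) \<beta>"
    using put_on_valid[of p m r \<beta>, OF _ t(3) f(2,3) y] val t r by simp
  have "valid ((p @ (o1, 0) # q) @ (o2, 0) # s) \<beta>"
    using put_on_valid[of "p @ (o1, 0) # q" m' s \<beta>, OF _ r(3) g(2,3) z] v1 by simp
  then have twist: "\<phi> w (\<beta>(k := y, k' := z)) = \<phi> w (\<beta>(k' := z, k := y))"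
    if "o1 = Some k" "o2 = Some k'" for k k' w
    using that fun_upd_twist[of k k' \<beta> y z] by (auto simp: valid_def)
  have f': "sem (Gen i j u) l \<psi> (p @ m @ w) \<beta>' = emit i \<psi> p (o1, y) w \<beta>'" for w \<beta>' \<psi>
    using sem_Gen[OF t(2,3)] y by simp
  have g': "length w = k \<Longrightarrow> sem (Gen i' j' v) k \<phi> (w @ m' @ s) \<beta>' = emit i' \<phi> w (o2, z) s \<beta>'" for w k \<beta>'
    using sem_Gen[OF _ r(3)] z by simp
  have g1: "sem (Gen i' j' v) (l + 1 + d) \<phi> (p @ (o1, y) # q @ m' @ s) \<beta>' =
      emit i' \<phi> (p @ (o1, y) # q) (o2, z) s \<beta>'" for \<beta>'
    using g'[of "p @ (o1, y) # q" "l + 1 + d"] t r by simp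
  have g0: "sem (Gen i' j' v) (l + d) \<phi> (p @ q @ m' @ s) \<beta>' =
      emit i' \<phi> (p @ q) (o2, z) s \<beta>'" for \<beta>'
    using g'[of "p @ q" "l + d"] t r by simp
  have gm: "sem (Gen i' j' v) (l + j + d) \<psi> (p @ m @ q @ m' @ s) \<beta>' =
      emit i' \<psi> (p @ m @ q) (o2, z) s \<beta>'" for \<psi> \<beta>'
    using sem_Gen[of "p @ m @ q" "l + j + d" m' j' i' v \<psi> s \<beta>'] t r z by simp
  have i: "i = 0 \<or> i = 1" "i' = 0 \<or> i' = 1" using f g by linarith+
  show "sem (Gen i j u) l (sem (Gen i' j' v) (l + i + d) \<phi>) \<tau> \<beta> =
      sem (Gen i' j' v) (l + j + d) (sem (Gen i j u) l \<phi>) \<tau> \<beta>"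
    unfolding t(1) r(1) f' gm
    using i f'[of \<phi> "q @ (o2, z) # s"] f'[of \<phi> "q @ s"] g0 g1
    by (cases o1; cases o2) (auto simp: twist)
qed

lemma commute_gen_left:
  assumes f: "i \<le> 1" "j \<le> 1" "u \<in> corner e i j" and g: "harr g n' m'"
  shows "commute (Gen i j u) j i g n'"
  using g
proof (induction rule: arr.induct)
  case (2 i' j' v)
  then show ?case using commute_gens f by blast
next
  case (3 g2 m' p' g1 n')
  show ?case
    unfolding commute_def
  proof (intro allI)
    fix l d \<phi>
    have "agree (l + j + d + n') (sem (Gen i j u) l (sem g1 (l + i + d) (sem g2 (l + i + d) \<phi>)))
        (sem g1 (l + j + d) (sem (Gen i j u) l (sem g2 (l + i + d) \<phi>)))"
      using 3(4) unfolding commute_def by blast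
    moreover have "agree (l + j + d + m') (sem (Gen i j u) l (sem g2 (l + i + d) \<phi>))
        (sem g2 (l + j + d) (sem (Gen i j u) l \<phi>))"
      using 3(3) unfolding commute_def by blast
    note sem_agree0[OF 3(2) this]
    ultimately show "agree (l + j + d + n') (sem (Gen i j u) l (sem (Comp g2 g1) (l + i + d) \<phi>))
        (sem (Comp g2 g1) (l + j + d) (sem (Gen i j u) l \<phi>))"
      by (auto intro: agree_trans)
  qed
next
  case (4 g1 n1 m1 g2 n2 m2)
  show ?case
    unfolding commute_def
  proof (intro allI)
    fix l d \<phi>
    have tg: "target g1 = m1" using 4(1) by (rule target_arr)
    let ?\<phi> = "sem g2 (l + i + d + m1) \<phi>"
    have "agree (l + j + d + n1) (sem (Gen i j u) l (sem g1 (l + i + d) ?\<phi>))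
        (sem g1 (l + j + d) (sem (Gen i j u) l ?\<phi>))"
      using 4(3) unfolding commute_def by blast
    then have 1: "agree (l + j + d + (n1 + n2)) (sem (Gen i j u) l (sem g1 (l + i + d) ?\<phi>))
        (sem g1 (l + j + d) (sem (Gen i j u) l ?\<phi>))"
      by (auto simp: agree_def)
    have "agree (l + j + (d + m1) + n2) (sem (Gen i j u) l (sem g2 (l + i + (d + m1)) \<phi>))
        (sem g2 (l + j + (d + m1)) (sem (Gen i j u) l \<phi>))"
      using 4(4) unfolding commute_def by blast
    then have "agree (l + j + d + m1 + n2) (sem (Gen i j u) l ?\<phi>)
        (sem g2 (l + j + d + m1) (sem (Gen i j u) l \<phi>))"
      by (simp add: add.assoc)
    from sem_agree[OF 4(1) this]
    have 2: "agree (l + j + d + (n1 + n2)) (sem g1 (l + j + d) (sem (Gen i j u) l ?\<phi>))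
        (sem g1 (l + j + d) (sem g2 (l + j + d + m1) (sem (Gen i j u) l \<phi>)))"
      by (simp add: add.assoc)
    show "agree (l + j + d + (n1 + n2)) (sem (Gen i j u) l (sem (Tens g1 g2) (l + i + d) \<phi>))
        (sem (Tens g1 g2) (l + j + d) (sem (Gen i j u) l \<phi>))"
      using agree_trans[OF 1 2] by (simp add: tg)
  qed
qed (auto simp: commute_def agree_def sem_zero sem_add sem_scal)

lemma commute_all:
  assumes f: "harr f n m" and g: "harr g n' m'"
  shows "commute f n m g n'"
  using f
proof (induction rule: arr.induct)
  case (2 i j u)
  then show ?case using commute_gen_left g by blast
next
  case (3 f2 m p f1 n)
  show ?case
    unfolding commute_def
  proof (intro allI)
    fix l d \<phi>
    have "agree (l + m + d + n') (sem f2 l (sem g (l + p + d) \<phi>)) (sem g (l + m + d) (sem f2 l \<phi>))"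
      using 3(3) unfolding commute_def by blast
    then have "agree (l + m + (d + n')) (sem f2 l (sem g (l + p + d) \<phi>)) (sem g (l + m + d) (sem f2 l \<phi>))"
      by (simp add: add.assoc)
    from sem_agree[OF 3(2) this]
    have 1: "agree (l + n + d + n') (sem f1 l (sem f2 l (sem g (l + p + d) \<phi>)))
        (sem f1 l (sem g (l + m + d) (sem f2 l \<phi>)))"
      by (simp add: add.assoc)
    have 2: "agree (l + n + d + n') (sem f1 l (sem g (l + m + d) (sem f2 l \<phi>)))
        (sem g (l + n + d) (sem f1 l (sem f2 l \<phi>)))"
      using 3(4) unfolding commute_def by blast
    show "agree (l + n + d + n') (sem (Comp f2 f1) l (sem g (l + p + d) \<phi>))
        (sem g (l + n + d) (sem (Comp f2 f1) l \<phi>))"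
      using agree_trans[OF 1 2] by simp
  qed
next
  case (4 f1 n1 m1 f2 n2 m2)
  show ?case
    unfolding commute_def
  proof (intro allI)
    fix l d \<phi>
    have tg: "target f1 = m1" using 4(1) by (rule target_arr)
    have "agree (l + m1 + n2 + d + n') (sem f2 (l + m1) (sem g (l + m1 + m2 + d) \<phi>))
        (sem g (l + m1 + n2 + d) (sem f2 (l + m1) \<phi>))"
      using 4(4) unfolding commute_def by blast
    then have "agree (l + m1 + (n2 + d + n')) (sem f2 (l + m1) (sem g (l + m1 + m2 + d) \<phi>))
        (sem g (l + m1 + n2 + d) (sem f2 (l + m1) \<phi>))"
      by (simp add: add.assoc)
    from sem_agree[OF 4(1) this]
    have 1: "agree (l + (n1 + n2) + d + n') (sem f1 l (sem f2 (l + m1) (sem g (l + m1 + m2 + d) \<phi>)))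
        (sem f1 l (sem g (l + m1 + n2 + d) (sem f2 (l + m1) \<phi>)))"
      by (simp add: add.assoc)
    have "agree (l + n1 + (n2 + d) + n') (sem f1 l (sem g (l + m1 + (n2 + d)) (sem f2 (l + m1) \<phi>)))
        (sem g (l + n1 + (n2 + d)) (sem f1 l (sem f2 (l + m1) \<phi>)))"
      using 4(3) unfolding commute_def by blast
    then have 2: "agree (l + (n1 + n2) + d + n') (sem f1 l (sem g (l + m1 + n2 + d) (sem f2 (l + m1) \<phi>)))
        (sem g (l + (n1 + n2) + d) (sem f1 l (sem f2 (l + m1) \<phi>)))"
      by (simp add: add.assoc)
    show "agree (l + (n1 + n2) + d + n') (sem (Tens f1 f2) l (sem g (l + (m1 + m2) + d) \<phi>))
        (sem g (l + (n1 + n2) + d) (sem (Tens f1 f2) l \<phi>))"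
      using agree_trans[OF 1 2] by (simp add: tg add.assoc)
  qed
qed (auto simp: commute_def agree_def sem_zero sem_add sem_scal)

end
end

context field_corner_algebra begin

text \<open>Putting a generator on top of the state keeps an observable multilinear.\<close>

lemma emit_linear_left:
  assumes "multilinear P \<phi>" "valid P (p @ (d, 0) # q @ (d', 0) # r) \<beta>" "i \<le> 1"
    "y \<in> corner e i (column d')"
  shows "linear_on (corner e 1 (column d)) (\<lambda>x. emit i \<phi> (p @ (d, x) # q) (d', y) r \<beta>)"
proof -
  have i: "i = 0 \<or> i = 1" using assms(3) by linarith
  then show ?thesis
  proof
    assume "i = 1"
    then show ?thesis
      using multilinear_top[OF assms(1), of p d "q @ (d', y) # r" \<beta>] assms(2,4)
        valid_slot[of P "p @ (d, 0) # q" d' y r \<beta>] by simp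
  next
    assume i: "i = 0"
    have v: "valid P (p @ (d, 0) # q @ r) \<beta>"
      using valid_delete[of P "p @ (d, 0) # q"] assms(2) by simp
    show ?thesis
    proof (cases d')
      case None
      then show ?thesis using i multilinear_top[OF assms(1) v] by (simp add: linear_on_mult_const)
    next
      case (Some k)
      have "valid P (p @ (d, 0) # q @ r) (\<beta>(k := y))"
        using v assms(4) i Some by (intro valid_bot) auto
      then show ?thesis using i Some multilinear_top[OF assms(1)] by simp
    qed
  qed
qed

lemma emit_linear_right:
  assumes "multilinear P \<phi>" "valid P (p @ (d', 0) # q @ (d, 0) # r) \<beta>" "i \<le> 1"
    "y \<in> corner e i (column d')"
  shows "linear_on (corner e 1 (column d)) (\<lambda>x. emit i \<phi> p (d', y) (q @ (d, x) # r) \<beta>)"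
proof -
  have i: "i = 0 \<or> i = 1" using assms(3) by linarith
  then show ?thesis
  proof
    assume "i = 1"
    then show ?thesis
      using multilinear_top[OF assms(1), of "p @ (d', y) # q" d r \<beta>] assms(2,4)
        valid_slot[of P p d' y "q @ (d, 0) # r" \<beta>] by simp
  next
    assume i: "i = 0"
    have v: "valid P ((p @ q) @ (d, 0) # r) \<beta>"
      using valid_delete[of P p] assms(2) by simp
    show ?thesis
    proof (cases d')
      case None
      then show ?thesis using i multilinear_top[OF assms(1) v] by (simp add: linear_on_mult_const)
    next
      case (Some k)
      have "valid P ((p @ q) @ (d, 0) # r) (\<beta>(k := y))"
        using v assms(4) i Some by (intro valid_bot) auto
      from multilinear_top[OF assms(1) this] show ?thesis using i Some by simp
    qed
  qed
qed

lemma emit_linear_bot: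
  assumes "multilinear P \<phi>" "valid P (p @ (d, 0) # q) \<beta>" "i \<le> 1" "y \<in> corner e i (column d)"
    "k \<in> P" "k \<notin> set (ends (p @ (d, 0) # q))"
  shows "linear_on (corner e 0 1) (\<lambda>c. emit i \<phi> p (d, y) q (\<beta>(k := c)))"
proof -
  have i: "i = 0 \<or> i = 1" using assms(3) by linarith
  then show ?thesis
  proof
    assume "i = 1"
    moreover have "k \<notin> set (ends (p @ (d, y) # q))" using assms(6) by (cases d) auto
    ultimately show ?thesis
      using multilinear_bot[OF assms(1), of "p @ (d, y) # q" \<beta> k] assms(2,4,5)
        valid_slot[of P p d y q \<beta>] by simp
  next
    assume i: "i = 0"
    have v: "valid P (p @ q) \<beta>" using valid_delete assms(2) by blast
    show ?thesis
    proof (cases d)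
      case None
      then show ?thesis
        using i multilinear_bot[OF assms(1) v assms(5)] assms(6) by (simp add: linear_on_mult_const)
    next
      case (Some k')
      have "valid P (p @ q) (\<beta>(k' := y))"
        using v assms(4) i Some by (intro valid_bot) auto
      then have "linear_on (corner e 0 1) (\<lambda>c. \<phi> (p @ q) (\<beta>(k' := y, k := c)))"
        using multilinear_bot[OF assms(1) _ assms(5)] assms(6) Some by simp
      moreover have "k' \<noteq> k" using assms(6) Some by auto
      ultimately show ?thesis using i Some by (simp add: fun_upd_twist)
    qed
  qed
qed

lemma emit_cut_left:
  assumes "multilinear P \<phi>" "valid P (p @ (Some k, 0) # q @ (d, 0) # r) \<beta>" "i \<le> 1"
    "y \<in> corner e i (column d)" "b \<in> corner e 1 0" "c \<in> corner e 0 1"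
  shows "emit i \<phi> (p @ (Some k, b * c) # q) (d, y) r \<beta> =
    emit i \<phi> (p @ (None, b) # q) (d, y) r (\<beta>(k := c))"
proof -
  have i: "i = 0 \<or> i = 1" using assms(3) by linarith
  then show ?thesis
  proof
    assume "i = 1"
    then show ?thesis
      using multilinear_cut[OF assms(1), of p k "q @ (d, y) # r" \<beta>] assms(2,4,5,6)
        valid_slot[of P "p @ (Some k, 0) # q" d y r \<beta>] by simp
  next
    assume i: "i = 0"
    have v: "valid P (p @ (Some k, 0) # q @ r) \<beta>"
      using valid_delete[of P "p @ (Some k, 0) # q"] assms(2) by simp
    show ?thesis
    proof (cases d)
      case None
      then show ?thesis using i multilinear_cut[OF assms(1) v assms(5,6)] by simp
    next
      case (Some k')
      have "valid P (p @ (Some k, 0) # q @ r) (\<beta>(k' := y))"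
        using v assms(4) i Some by (intro valid_bot) auto
      from multilinear_cut[OF assms(1) this assms(5,6)]
      have "\<phi> (p @ (Some k, b * c) # q @ r) (\<beta>(k' := y)) =
        \<phi> (p @ (None, b) # q @ r) (\<beta>(k' := y, k := c))" .
      moreover have "k' \<noteq> k" using assms(2) Some by (auto simp: valid_def)
      ultimately show ?thesis using i Some by (simp add: fun_upd_twist)
    qed
  qed
qed

lemma emit_cut_right:
  assumes "multilinear P \<phi>" "valid P (p @ (d, 0) # q @ (Some k, 0) # r) \<beta>" "i \<le> 1"
    "y \<in> corner e i (column d)" "b \<in> corner e 1 0" "c \<in> corner e 0 1"
  shows "emit i \<phi> p (d, y) (q @ (Some k, b * c) # r) \<beta> =
    emit i \<phi> p (d, y) (q @ (None, b) # r) (\<beta>(k := c))"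
proof -
  have i: "i = 0 \<or> i = 1" using assms(3) by linarith
  then show ?thesis
  proof
    assume "i = 1"
    then show ?thesis
      using multilinear_cut[OF assms(1), of "p @ (d, y) # q" k r \<beta>] assms(2,4,5,6)
        valid_slot[of P p d y "q @ (Some k, 0) # r" \<beta>] by simp
  next
    assume i: "i = 0"
    have v: "valid P ((p @ q) @ (Some k, 0) # r) \<beta>"
      using valid_delete[of P p] assms(2) by simp
    show ?thesis
    proof (cases d)
      case None
      then show ?thesis using i multilinear_cut[OF assms(1) v assms(5,6)] by simp
    next
      case (Some k')
      have "valid P ((p @ q) @ (Some k, 0) # r) (\<beta>(k' := y))"
        using v assms(4) i Some by (intro valid_bot) auto
      from multilinear_cut[OF assms(1) this assms(5,6)]
      have "\<phi> (p @ q @ (Some k, b * c) # r) (\<beta>(k' := y)) =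
        \<phi> (p @ q @ (None, b) # r) (\<beta>(k' := y, k := c))" by simp
      moreover have "k' \<noteq> k" using assms(2) Some by (auto simp: valid_def)
      ultimately show ?thesis using i Some by (simp add: fun_upd_twist)
    qed
  qed
qed

text \<open>A position in a list that is split into three parts.\<close>

lemma split_position:
  assumes "p @ x # q = a @ m @ r" "length m \<le> 1"
  obtains (left) a2 where "a = p @ x # a2" "q = a2 @ m @ r"
    | (mid) "a = p" "m = [x]" "r = q"
    | (right) r1 where "p = a @ m @ r1" "r = r1 @ x # q"
proof -
  consider us where "p = a @ us" "us @ x # q = m @ r" | us where "p @ us = a" "x # q = us @ m @ r"
    using assms(1) by (auto simp: append_eq_append_conv2)
  then show thesis
  proof cases
    case (1 us)
    show thesis
    proof (cases m)
      case Nil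
      then show thesis using 1 right[of us] by simp
    next
      case (Cons y m')
      then have "m = [y]" using assms(2) by simp
      then show thesis using 1 mid right by (cases us) auto
    qed
  next
    case (2 us)
    show thesis
    proof (cases us)
      case Nil
      show thesis
      proof (cases m)
        case Nil
        then show thesis using 2 \<open>us = []\<close> right[of "[]"] by simp
      next
        case (Cons y m')
        then show thesis using 2 \<open>us = []\<close> mid assms(2) by simp
      qed
    next
      case (Cons y us')
      then show thesis using 2 left[of us'] by auto
    qed
  qed
qed

lemma multilinear_sem_Gen:
  assumes \<phi>: "multilinear P \<phi>" and u: "i \<le> 1" "j \<le> 1" "u \<in> corner e i j"
  shows "multilinear P (sem (Gen i j u) l \<phi>)"
  unfolding multilinear_def
proof (intro conjI allI impI)
  fix p d q \<beta> assume v: "valid P (p @ (d, 0) # q) \<beta>"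
  show "linear_on (corner e 1 (column d)) (\<lambda>x. sem (Gen i j u) l \<phi> (p @ (d, x) # q) \<beta>)"
  proof (cases "l + j \<le> length (p @ (d, 0 :: 'a) # q)")
    case False
    then show ?thesis by (simp add: sem_Gen_short linear_on_zero)
  next
    case True
    then obtain a m r where t: "p @ (d, 0) # q = a @ m @ r" "length a = l" "length m = j"
      by (rule split_top)
    have "length m \<le> 1" using t u by simp
    from t(1) this show ?thesis
    proof (cases rule: split_position)
      case (left a2)
      obtain d' y where y: "put_on u m = (d', y)" by (cases "put_on u m")
      have "valid P (a @ (d', 0) # r) \<beta> \<and> y \<in> corner e i (column d')"
        using put_on_valid[OF v[unfolded t(1)] t(3) u(2,3) y] .
      then have "linear_on (corner e 1 (column d)) (\<lambda>x. emit i \<phi> (p @ (d, x) # a2) (d', y) r \<beta>)"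
        using left(1) by (intro emit_linear_left[OF \<phi> _ u(1)]) auto
      moreover have "sem (Gen i j u) l \<phi> (p @ (d, x) # q) \<beta> = emit i \<phi> (p @ (d, x) # a2) (d', y) r \<beta>" for x
        using sem_Gen[of "p @ (d, x) # a2" l m j i u \<phi> r \<beta>] t left y by simp
      ultimately show ?thesis by simp
    next
      case mid
      then have j: "j = 1" using t by simp
      have "linear_on (corner e i (column d)) (\<lambda>y. emit i \<phi> p (d, y) q \<beta>)"
        using emit_linear[OF \<phi> v u(1)] .
      from linear_on_lmult[OF this]
      have "linear_on (corner e 1 (column d)) (\<lambda>x. emit i \<phi> p (d, u * x) q \<beta>)" using u j by simp
      moreover have "sem (Gen i j u) l \<phi> (p @ (d, x) # q) \<beta> = emit i \<phi> p (d, u * x) q \<beta>" for x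
        using sem_Gen[of p l "[(d, x)]" j i u \<phi> q \<beta>] t mid j by simp
      ultimately show ?thesis by simp
    next
      case (right r1)
      obtain d' y where y: "put_on u m = (d', y)" by (cases "put_on u m")
      have "valid P (a @ (d', 0) # r) \<beta> \<and> y \<in> corner e i (column d')"
        using put_on_valid[OF v[unfolded t(1)] t(3) u(2,3) y] .
      then have "linear_on (corner e 1 (column d)) (\<lambda>x. emit i \<phi> a (d', y) (r1 @ (d, x) # q) \<beta>)"
        using right(2) by (intro emit_linear_right[OF \<phi> _ u(1)]) auto
      moreover have "sem (Gen i j u) l \<phi> (p @ (d, x) # q) \<beta> = emit i \<phi> a (d', y) (r1 @ (d, x) # q) \<beta>" for x
        using sem_Gen[of a l m j i u \<phi> "r1 @ (d, x) # q" \<beta>] t right y by simp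
      ultimately show ?thesis by simp
    qed
  qed
next
  fix \<tau> \<beta> k assume v: "valid P \<tau> \<beta>" and k: "k \<in> P - set (ends \<tau>)"
  show "linear_on (corner e 0 1) (\<lambda>c. sem (Gen i j u) l \<phi> \<tau> (\<beta>(k := c)))"
  proof (cases "l + j \<le> length \<tau>")
    case False
    then show ?thesis by (simp add: sem_Gen_short linear_on_zero)
  next
    case True
    then obtain a m r where t: "\<tau> = a @ m @ r" "length a = l" "length m = j"
      by (rule split_top)
    obtain d y where y: "put_on u m = (d, y)" by (cases "put_on u m")
    have vy: "valid P (a @ (d, 0) # r) \<beta> \<and> y \<in> corner e i (column d)"
      using put_on_valid[OF v[unfolded t(1)] t(3) u(2,3) y] .
    have "k \<notin> set (ends (a @ (d, 0) # r))"
    proof (cases m)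
      case Nil
      then show ?thesis using k y t by auto
    next
      case (Cons x m')
      then show ?thesis using k y t u by (cases x; cases d) auto
    qed
    then have "linear_on (corner e 0 1) (\<lambda>c. emit i \<phi> a (d, y) r (\<beta>(k := c)))"
      using vy k by (intro emit_linear_bot[OF \<phi> _ u(1)]) auto
    then show ?thesis using sem_Gen[OF t(2,3)] y by (simp add: t(1))
  qed
next
  fix p k b c q \<beta>
  assume v: "valid P (p @ (Some k, 0) # q) \<beta>" and b: "b \<in> corner e 1 0" and c: "c \<in> corner e 0 1"
  show "sem (Gen i j u) l \<phi> (p @ (Some k, b * c) # q) \<beta> =
    sem (Gen i j u) l \<phi> (p @ (None, b) # q) (\<beta>(k := c))"
  proof (cases "l + j \<le> length (p @ (Some k, 0 :: 'a) # q)")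
    case False
    then show ?thesis by (simp add: sem_Gen_short)
  next
    case True
    then obtain a m r where t: "p @ (Some k, 0) # q = a @ m @ r" "length a = l" "length m = j"
      by (rule split_top)
    have "length m \<le> 1" using t u by simp
    from t(1) this show ?thesis
    proof (cases rule: split_position)
      case (left a2)
      obtain d' y where y: "put_on u m = (d', y)" by (cases "put_on u m")
      have vy: "valid P (a @ (d', 0) # r) \<beta> \<and> y \<in> corner e i (column d')"
        using put_on_valid[OF v[unfolded t(1)] t(3) u(2,3) y] .
      have "sem (Gen i j u) l \<phi> (p @ x # q) \<beta>' = emit i \<phi> (p @ x # a2) (d', y) r \<beta>'" for x \<beta>'
        using sem_Gen[of "p @ x # a2" l m j i u \<phi> r \<beta>'] t left y by simp
      then show ?thesis
        using emit_cut_left[OF \<phi>, of p k a2 d' r \<beta> i y b c] vy left(1) u b c by simp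
    next
      case mid
      then have j: "j = 1" using t by simp
      have "emit i \<phi> p (Some k, u * b * c) q \<beta> = emit i \<phi> p (None, u * b) q (\<beta>(k := c))"
        using u j b c v by (intro emit_cut[OF \<phi>] corner_mult[of u i 1]) auto
      moreover have "sem (Gen i j u) l \<phi> (p @ (d, x) # q) \<beta>' = emit i \<phi> p (d, u * x) q \<beta>'" for d x \<beta>'
        using sem_Gen[of p l "[(d, x)]" j i u \<phi> q \<beta>'] t mid j by simp
      ultimately show ?thesis by (simp add: mult.assoc)
    next
      case (right r1)
      obtain d' y where y: "put_on u m = (d', y)" by (cases "put_on u m")
      have vy: "valid P (a @ (d', 0) # r) \<beta> \<and> y \<in> corner e i (column d')"
        using put_on_valid[OF v[unfolded t(1)] t(3) u(2,3) y] .
      have "sem (Gen i j u) l \<phi> (p @ x # q) \<beta>' = emit i \<phi> a (d', y) (r1 @ x # q) \<beta>'" for x \<beta>'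
        using sem_Gen[of a l m j i u \<phi> "r1 @ x # q" \<beta>'] t right y by simp
      then show ?thesis
        using emit_cut_right[OF \<phi>, of a d' r1 k q \<beta> i y b c] vy right(2) u b c by simp
    qed
  qed
qed

lemma multilinear_sem: "harr f n m \<Longrightarrow> multilinear P \<phi> \<Longrightarrow> multilinear P (sem f l \<phi>)"
  by (induction arbitrary: l \<phi> rule: arr.induct)
    (simp_all add: multilinear_sem_Gen multilinear_zero multilinear_add multilinear_scal)

text \<open>The relations that come from \<open>A\<close>.\<close>

lemma sem_gen_mult:
  assumes \<phi>: "multilinear P \<phi>" and ijk: "i \<le> 1" "j \<le> 1" "k \<le> 1"
    and u: "u \<in> corner e i j" and v: "v \<in> corner e j k"
  shows "agree P (l + k) (sem (Comp (Gen i j u) (Gen j k v)) l \<phi>) (sem (Gen i k (u * v)) l \<phi>)"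
proof (rule agreeI)
  fix \<tau> \<beta> assume val: "valid P \<tau> \<beta>" and len: "l + k \<le> length \<tau>"
  then obtain p m q where t: "\<tau> = p @ m @ q" "length p = l" "length m = k"
    using split_top[of l k \<tau>] by auto
  obtain d y where y: "put_on v m = (d, y)" by (cases "put_on v m")
  have vy: "valid P (p @ (d, 0) # q) \<beta> \<and> y \<in> corner e j (column d)"
    using put_on_valid[OF val[unfolded t(1)] t(3) ijk(3) v y] .
  have uy: "put_on (u * v) m = (d, u * y)" using y by (cases m) (auto simp: mult.assoc)
  have left: "sem (Comp (Gen i j u) (Gen j k v)) l \<phi> \<tau> \<beta> = emit j (sem (Gen i j u) l \<phi>) p (d, y) q \<beta>"
    and right: "sem (Gen i k (u * v)) l \<phi> \<tau> \<beta> = emit i \<phi> p (d, u * y) q \<beta>"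
    using sem_Gen[OF t(2,3)] y uy t(1) by simp_all
  have "j = 0 \<or> j = 1" using ijk(2) by linarith
  then have "emit j (sem (Gen i j u) l \<phi>) p (d, y) q \<beta> = emit i \<phi> p (d, u * y) q \<beta>"
  proof
    assume j: "j = 1"
    then show ?thesis using sem_Gen[of p l "[(d, y)]" 1 i u \<phi> q \<beta>] t(2) by simp
  next
    assume j: "j = 0"
    have sem0: "sem (Gen i 0 u) l \<phi> (p @ q) \<beta>' = emit i \<phi> p (None, u) q \<beta>'" for \<beta>'
      using sem_Gen[of p l "[]" 0 i u \<phi> q \<beta>'] t(2) by simp
    show ?thesis
    proof (cases d)
      case None
      have "u * y = u * scale (\<kappa> y) e" using kappa_corner[of y] vy None j by simp
      also have "\<dots> = scale (\<kappa> y) u"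
        using corner_right[OF u] j by (simp add: scale_mult_right block_idem_def)
      finally have "emit i \<phi> p (d, u * y) q \<beta> = \<kappa> y * emit i \<phi> p (d, u) q \<beta>"
        using emit_linear[OF \<phi>, of p d q \<beta> i] vy ijk(1) u j None by (simp add: linear_on_def)
      then show ?thesis using sem0 None j by simp
    next
      case (Some i')
      then show ?thesis using sem0 j emit_cut[OF \<phi>, of p i' q \<beta> i u y] vy ijk(1) u by simp
    qed
  qed
  then show "sem (Comp (Gen i j u) (Gen j k v)) l \<phi> \<tau> \<beta> = sem (Gen i k (u * v)) l \<phi> \<tau> \<beta>"
    using left right by simp
qed

lemma sem_gen_linear:
  assumes \<phi>: "multilinear P \<phi>" and ij: "i \<le> 1" "j \<le> 1"
    and val: "valid P \<tau> \<beta>" and len: "l + j \<le> length \<tau>"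
  shows "linear_on (corner e i j) (\<lambda>u. sem (Gen i j u) l \<phi> \<tau> \<beta>)"
proof -
  obtain p m q where t: "\<tau> = p @ m @ q" "length p = l" "length m = j"
    using split_top[of l j \<tau>] len by auto
  have sem: "sem (Gen i j u) l \<phi> \<tau> \<beta> = emit i \<phi> p (put_on u m) q \<beta>" for u
    using sem_Gen[OF t(2,3)] t(1) by simp
  show ?thesis
  proof (cases m)
    case Nil
    have "valid P (p @ (None, 0) # q) \<beta>" using val t(1) Nil by (auto intro: valid_insert)
    from emit_linear[OF \<phi> this ij(1)] show ?thesis unfolding sem using t Nil by simp
  next
    case (Cons a m')
    then obtain d x where m: "m = [(d, x)]" "j = 1" using t ij(2) by (cases a) auto
    have v: "valid P (p @ (d, 0) # q) \<beta>" "x \<in> corner e 1 (column d)"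
      using val t(1) m valid_slot[of P p d x q \<beta>] by auto
    from emit_linear[OF \<phi> v(1) ij(1)] show ?thesis
      unfolding sem using m v(2) corner_mult[of _ i 1 x "column d"]
      by (simp add: linear_on_def distrib_right scale_mult_left)
  qed
qed

text \<open>Equivalent expressions act in the same way on multilinear observables.\<close>

theorem sem_sound:
  assumes "heq n m f g" "multilinear P \<phi>"
  shows "agree P (l + n) (sem f l \<phi>) (sem g l \<phi>)"
  using assms
proof (induction arbitrary: l \<phi> rule: hom_eq.induct)
  case (sym n m f g)
  then show ?case by (blast intro: agree_sym)
next
  case (trans n m f g h)
  then show ?case by (blast intro: agree_trans)
next
  case (comp_cong m p g g' n f f')
  have f: "harr f n m" "harr f' n m" and g: "harr g m p" using comp_cong heq_arr by blast+
  have "agree P (l + n) (sem f l (sem g l \<phi>)) (sem f' l (sem g l \<phi>))"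
    using multilinear_sem[OF g comp_cong.prems] by (rule comp_cong.IH)
  moreover have "agree P (l + n) (sem f' l (sem g l \<phi>)) (sem f' l (sem g' l \<phi>))"
    using comp_cong.IH(1)[OF comp_cong.prems] by (rule sem_agree0[OF f(2)])
  ultimately show ?case by (auto intro: agree_trans)
next
  case (tens_cong n m f f' n' m' g g')
  have f: "harr f n m" "harr f' n m" and g: "harr g n' m'" using tens_cong heq_arr by blast+
  have tg: "target f = m" "target f' = m" using f by (auto intro: target_arr)
  have "agree P (l + n) (sem f l (sem g (l + m) \<phi>)) (sem f' l (sem g (l + m) \<phi>))"
    using multilinear_sem[OF g tens_cong.prems] by (rule tens_cong.IH)
  then have "agree P (l + (n + n')) (sem f l (sem g (l + m) \<phi>)) (sem f' l (sem g (l + m) \<phi>))"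
    by (auto simp: agree_def)
  moreover have "agree P (l + n + n') (sem f' l (sem g (l + m) \<phi>)) (sem f' l (sem g' (l + m) \<phi>))"
    using tens_cong.IH(2)[OF tens_cong.prems] by (rule sem_agree[OF f(2)])
  ultimately show ?case using tg by (auto intro: agree_trans simp: add.assoc)
next
  case (tens_assoc f n m g n' m' h n'' m'')
  then show ?case by (simp add: target_arr add.assoc)
next
  case (interchange g m p f n g' m' p' f' n')
  have tg: "target g = p" "target f = m" using interchange by (auto intro: target_arr)
  have "agree P (l + m + 0 + n') (sem g l (sem f' (l + p + 0) (sem g' (l + p) \<phi>)))
      (sem f' (l + m + 0) (sem g l (sem g' (l + p) \<phi>)))"
    using commute_all[OF interchange(1,4)] unfolding commute_def by blast
  then have "agree P (l + m + n') (sem g l (sem f' (l + p) (sem g' (l + p) \<phi>)))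
      (sem f' (l + m) (sem g l (sem g' (l + p) \<phi>)))"
    by simp
  from sem_agree[OF interchange(2) this] show ?case using tg by (simp add: add.assoc)
next
  case (gen_add i j u v)
  show ?case
  proof (rule agreeI)
    fix \<tau> \<beta> assume "valid P \<tau> \<beta>" "l + j \<le> length \<tau>"
    from sem_gen_linear[OF gen_add(5,1,2) this] gen_add(3,4)
    show "sem (Gen i j (u + v)) l \<phi> \<tau> \<beta> = sem (Add (Gen i j u) (Gen i j v)) l \<phi> \<tau> \<beta>"
      by (simp add: linear_on_def)
  qed
next
  case (gen_scal i j u c)
  show ?case
  proof (rule agreeI)
    fix \<tau> \<beta> assume "valid P \<tau> \<beta>" "l + j \<le> length \<tau>"
    from sem_gen_linear[OF gen_scal(4,1,2) this] gen_scal(3)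
    show "sem (Gen i j (scale c u)) l \<phi> \<tau> \<beta> = sem (Scal c (Gen i j u)) l \<phi> \<tau> \<beta>"
      by (simp add: linear_on_def)
  qed
next
  case (gen_mult i j k u v)
  then show ?case by (intro sem_gen_mult)
next
  case gen_id_X
  show ?case
  proof (rule agreeI)
    fix \<tau> \<beta> assume val: "valid P \<tau> \<beta>" and len: "l + 1 \<le> length \<tau>"
    then obtain p m q where t: "\<tau> = p @ m @ q" "length p = l" "length m = 1"
      using split_top[of l 1 \<tau>] by auto
    obtain d x where m: "m = [(d, x)]" using t(3) by (cases m) auto
    have "x \<in> corner e 1 (column d)"
      using val t(1) m valid_slot[of P p d x q \<beta>] by auto
    then have "(1 - e) * x = x" using corner_left[of x 1] by (simp add: block_idem_def)
    then show "sem (Gen 1 1 (1 - e)) l \<phi> \<tau> \<beta> = sem (Id 1) l \<phi> \<tau> \<beta>"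
      using sem_Gen[OF t(2,3)] t(1) m by simp
  qed
next
  case (gen_id_unit c)
  show ?case
  proof (rule agreeI)
    fix \<tau> \<beta> assume val: "valid P \<tau> \<beta>" and len: "l + 0 \<le> length \<tau>"
    then obtain p m q where t: "\<tau> = p @ m @ q" "length p = l" "length m = 0"
      using split_top[of l 0 \<tau>] by auto
    then show "sem (Gen 0 0 (scale c e)) l \<phi> \<tau> \<beta> = sem (Scal c (Id 0)) l \<phi> \<tau> \<beta>"
      using sem_Gen[OF t(2,3)] by (simp add: kappa_scale kappa_e)
  qed
next
  case (tens_add_left f n m f' g n' m')
  then have "target f = m" "target f' = m" by (auto intro: target_arr)
  then show ?case by simp
qed (auto simp: agree_def sem_add sem_scal algebra_simps)

end

section \<open>Words as states\<close>

text \<open>The state that a word describes, when its bottom points are numbered from \<open>k\<close>: the strands at its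
  top points, and the labels of its short bottom strands, which are entered into \<open>\<beta>\<close>.\<close>

fun word_letters :: "'a strand list \<Rightarrow> nat \<Rightarrow> 'a letter list" where
  "word_letters [] k = []"
| "word_letters (Top b # w) k = (None, b) # word_letters w k"
| "word_letters (Thru a # w) k = (Some k, a) # word_letters w (Suc k)"
| "word_letters (Bot c # w) k = word_letters w (Suc k)"

fun word_bots :: "'a strand list \<Rightarrow> nat \<Rightarrow> (nat \<Rightarrow> 'a) \<Rightarrow> nat \<Rightarrow> 'a" where
  "word_bots [] k \<beta> = \<beta>"
| "word_bots (Top b # w) k \<beta> = word_bots w k \<beta>"
| "word_bots (Thru a # w) k \<beta> = word_bots w (Suc k) \<beta>"
| "word_bots (Bot c # w) k \<beta> = word_bots w (Suc k) (\<beta>(k := c))"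

lemma word_bots_less: "i < k \<Longrightarrow> word_bots w k \<beta> i = \<beta> i"
  by (induction w arbitrary: k \<beta> rule: word_induct) auto

lemma ends_word_letters: "set (ends (word_letters w k)) \<subseteq> {k..<k + word_bot w}"
proof (induction w arbitrary: k rule: word_induct)
  case (Thru a w)
  show ?case using Thru[of "Suc k"] by auto
next
  case (Bot c w)
  show ?case using Bot[of "Suc k"] by auto
qed auto

text \<open>The partial bijection of a word can be read off from the bottom ends of its top points.\<close>

fun map_of_columns :: "nat option list \<Rightarrow> nat \<Rightarrow> nat \<rightharpoonup> nat" where
  "map_of_columns [] j = Map.empty"
| "map_of_columns (None # ds) j = map_of_columns ds (Suc j)"
| "map_of_columns (Some k # ds) j = (map_of_columns ds (Suc j))(k \<mapsto> j)"

lemma word_map_eq_columns: "word_map w k j = map_of_columns (map fst (word_letters w k)) j"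
  by (induction w arbitrary: k j rule: word_induct) auto

text \<open>The state of the identity diagram on the bottom points \<open>k, \<dots>, k + n - 1\<close>.\<close>

definition identity_state :: "'a::ring_1 \<Rightarrow> nat \<Rightarrow> nat \<Rightarrow> 'a letter list" where
  "identity_state e k n = map (\<lambda>i. (Some i, 1 - e)) [k..<k + n]"

lemma identity_state_0 [simp]: "identity_state e k 0 = []"
  by (simp add: identity_state_def)

lemma identity_state_Suc [simp]:
  "identity_state e k (1 + n) = (Some k, 1 - e) # identity_state e (Suc k) n"
  unfolding identity_state_def upt_Cons by simp

lemma length_identity_state [simp]: "length (identity_state e k n) = n"
  by (simp add: identity_state_def)

lemma ends_identity_state: "ends (identity_state e k n) = [k..<k + n]"
proof (induction n arbitrary: k)
  case (Suc n)
  have "identity_state e k (Suc n) = (Some k, 1 - e) # identity_state e (Suc k) n"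
    using identity_state_Suc[of e k n] by (simp only: plus_1_eq_Suc)
  moreover have "[k..<k + Suc n] = k # [Suc k..<Suc k + n]"
    using upt_Cons[of k n] by (simp only: plus_1_eq_Suc)
  ultimately show ?case using Suc[of "Suc k"] by simp
qed simp

context field_corner_algebra begin

lemma valid_identity_state: "valid {1..n} (identity_state e 1 n) (\<lambda>_. 0)"
proof -
  have "(1 - e) \<in> corner e 1 1" by (rule unit_in_corner)
  then show ?thesis
    unfolding valid_def ends_identity_state by (auto simp: identity_state_def)
qed

text \<open>A word sends the identity state to the state that the word describes.\<close>

lemma sem_word:
  assumes "good_word w"
  shows "sem (word_expr w) (length p) \<phi> (p @ identity_state e k (word_bot w)) \<beta> =
    \<phi> (p @ word_letters w k) (word_bots w k \<beta>)"
  using assms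
proof (induction w arbitrary: p k \<beta> rule: word_induct)
  case (Top b w)
  have "sem (word_expr (Top b # w)) (length p) \<phi> (p @ identity_state e k (word_bot (Top b # w))) \<beta> =
      sem (word_expr w) (length (p @ [(None, b)])) \<phi> ((p @ [(None, b)]) @ identity_state e k (word_bot w)) \<beta>"
    using sem_Gen[of p "length p" "[]" 0 1 b] by (simp add: Suc_eq_plus1)
  also have "\<dots> = \<phi> (p @ word_letters (Top b # w) k) (word_bots (Top b # w) k \<beta>)"
    using Top.IH[of "p @ [(None, b)]"] Top.prems by simp
  finally show ?case .
next
  case (Thru a w)
  have "a * (1 - e) = a"
    using Thru.prems corner_right[of a 1 1] by (simp add: block_idem_def)
  then have "sem (word_expr (Thru a # w)) (length p) \<phi> (p @ identity_state e k (word_bot (Thru a # w))) \<beta> =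
      sem (word_expr w) (length (p @ [(Some k, a)])) \<phi> ((p @ [(Some k, a)]) @ identity_state e (Suc k) (word_bot w)) \<beta>"
    using sem_Gen[of p "length p" "[(Some k, 1 - e)]" 1 1 a] by (simp add: Suc_eq_plus1)
  also have "\<dots> = \<phi> (p @ word_letters (Thru a # w) k) (word_bots (Thru a # w) k \<beta>)"
    using Thru.IH[of "p @ [(Some k, a)]" "Suc k"] Thru.prems by simp
  finally show ?case .
next
  case (Bot c w)
  have "c * (1 - e) = c"
    using Bot.prems corner_right[of c 0 1] by (simp add: block_idem_def)
  then have "sem (word_expr (Bot c # w)) (length p) \<phi> (p @ identity_state e k (word_bot (Bot c # w))) \<beta> =
      sem (word_expr w) (length p) \<phi> (p @ identity_state e (Suc k) (word_bot w)) (\<beta>(k := c))"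
    using sem_Gen[of p "length p" "[(Some k, 1 - e)]" 1 0 c] by simp
  also have "\<dots> = \<phi> (p @ word_letters w (Suc k)) (word_bots w (Suc k) (\<beta>(k := c)))"
    using Bot.prems by (intro Bot.IH) simp
  finally show ?case by (simp only: word_letters.simps word_bots.simps)
qed simp

end

section \<open>Coordinates of diagrams\<close>

context vector_space begin

text \<open>The coordinate of \<open>u\<^sub>1 \<otimes> \<dots> \<otimes> u\<^sub>r\<close> at the element \<open>v\<^sub>1 \<otimes> \<dots> \<otimes> v\<^sub>r\<close> of the product basis.\<close>

fun list_coord :: "'b set list \<Rightarrow> 'b list \<Rightarrow> 'b list \<Rightarrow> 'a" where
  "list_coord [] [] [] = 1"
| "list_coord (B # Bs) (v # vs) (u # us) = representation B u v * list_coord Bs vs us"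
| "list_coord _ _ _ = 0"

end

text \<open>The products \<open>b * c\<close> together with \<open>B11\<close> form a basis of \<open>(1-e)A(1-e)\<close>: this is what the
  decomposition \<open>A' \<oplus> A''\<close> and the injectivity of the multiplication map give.\<close>

definition (in strand_bases) corner_basis :: "'a set" where
  "corner_basis = {b * c | b c. b \<in> B10 \<and> c \<in> B01} \<union> B11"

locale dual_strand_bases = strand_bases scale e \<kappa> B10 B01 B11
  for scale :: "'k::field \<Rightarrow> 'a::ring_1 \<Rightarrow> 'a" and e \<kappa> B10 B01 B11 +
  assumes indep_B10: "independent B10" and indep_B01: "independent B01"
    and indep_corner_basis: "independent corner_basis"
    and mult_inj: "b \<in> B10 \<Longrightarrow> c \<in> B01 \<Longrightarrow> b' \<in> B10 \<Longrightarrow> c' \<in> B01 \<Longrightarrow> b * c = b' * c' \<Longrightarrow> b = b' \<and> c = c'"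
    and mult_not_B11: "b \<in> B10 \<Longrightarrow> c \<in> B01 \<Longrightarrow> b * c \<notin> B11"
begin

lemma span_corner_basis: "span corner_basis = corner e 1 1"
  using span_B11 by (simp add: corner_basis_def)

lemma linear_on_representation:
  "independent B \<Longrightarrow> span B = U \<Longrightarrow> linear_on U (\<lambda>x. representation B x b)"
  by (auto simp: linear_on_def representation_add representation_scale)

lemma linear_on_span_eq:
  assumes f: "linear_on (span B) f" and g: "linear_on (span B) g"
    and eq: "\<And>b. b \<in> B \<Longrightarrow> f b = g b" and x: "x \<in> span B"
  shows "f x = g x"
  using x
proof -
  have zero: "h 0 = 0" if "linear_on (span B) h" for h
  proof -
    have "h (scale 0 0) = 0 * h 0" using that span_zero[of B] unfolding linear_on_def by blast
    then show ?thesis by simp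
  qed
  have "x \<in> span B \<and> f x = g x"
    using x
  proof (induction rule: span_induct_alt)
    case base
    show ?case using zero[OF f] zero[OF g] span_zero by simp
  next
    case (step c x y)
    have x: "x \<in> span B" "scale c x \<in> span B" using step by (auto intro: span_base span_scale)
    have h: "h (scale c x + y) = c * h x + h y" if "linear_on (span B) h" for h
      using that x step by (simp add: linear_on_def)
    show ?case using h[OF f] h[OF g] eq step x by (simp add: span_add)
  qed
  then show ?thesis ..
qed

lemma linear_on_rmult:
  "linear_on (corner e i k) f \<Longrightarrow> y \<in> corner e j k \<Longrightarrow> linear_on (corner e i j) (\<lambda>x. f (x * y))"
  by (simp add: linear_on_def distrib_right scale_mult_left corner_mult[of _ i j y k])

lemma linear_on_mult_const2: "linear_on U f \<Longrightarrow> linear_on U (\<lambda>x. f x * s)"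
  by (simp add: linear_on_def algebra_simps)

lemma bilinear_span_eq:
  assumes F: "linear_on (corner e 1 1) F" and f: "linear_on (corner e 1 0) f" and g: "linear_on (corner e 0 1) g"
    and eq: "\<And>b c. b \<in> B10 \<Longrightarrow> c \<in> B01 \<Longrightarrow> F (b * c) = f b * g c"
    and x: "x \<in> corner e 1 0" and y: "y \<in> corner e 0 1"
  shows "F (x * y) = f x * g y"
proof -
  have 1: "F (b * y) = f b * g y" if b: "b \<in> B10" for b
  proof (rule linear_on_span_eq[of B01 "\<lambda>y. F (b * y)" "\<lambda>y. f b * g y"])
    show "linear_on (span B01) (\<lambda>y. F (b * y))"
      unfolding span_B01 using b B10_subset by (intro linear_on_lmult[OF F]) auto
    show "linear_on (span B01) (\<lambda>y. f b * g y)"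
      unfolding span_B01 by (rule linear_on_mult_const[OF g])
  qed (use b eq y span_B01 in auto)
  show ?thesis
  proof (rule linear_on_span_eq[of B10 "\<lambda>x. F (x * y)" "\<lambda>x. f x * g y"])
    show "linear_on (span B10) (\<lambda>x. F (x * y))"
      unfolding span_B10 by (rule linear_on_rmult[OF F y])
    show "linear_on (span B10) (\<lambda>x. f x * g y)"
      unfolding span_B10 by (rule linear_on_mult_const2[OF f])
  qed (use 1 x span_B10 in auto)
qed

lemmas linear_coordinate =
  linear_on_representation[OF indep_B10 span_B10] linear_on_representation[OF indep_B01 span_B01]
  linear_on_representation[OF indep_corner_basis span_corner_basis]

lemma mult_in_corner_basis: "b \<in> B10 \<Longrightarrow> c \<in> B01 \<Longrightarrow> b * c \<in> corner_basis"
  by (auto simp: corner_basis_def)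

lemma representation_mult_B11:
  assumes x: "x \<in> corner e 1 0" and y: "y \<in> corner e 0 1" and a: "a \<in> B11"
  shows "representation corner_basis (x * y) a = 0"
proof -
  have "representation corner_basis (x * y) a = 0 * 0"
  proof (rule bilinear_span_eq[OF linear_coordinate(3) linear_on_zero linear_on_zero _ x y])
    fix b c assume bc: "b \<in> B10" "c \<in> B01"
    then have "a \<noteq> b * c" using mult_not_B11 a by auto
    then show "representation corner_basis (b * c) a = 0 * 0"
      by (simp add: representation_basis[OF indep_corner_basis mult_in_corner_basis[OF bc]])
  qed
  then show ?thesis by simp
qed

lemma representation_mult:
  assumes x: "x \<in> corner e 1 0" and y: "y \<in> corner e 0 1" and b: "b \<in> B10" and c: "c \<in> B01"
  shows "representation corner_basis (x * y) (b * c) = representation B10 x b * representation B01 y c"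
proof (rule bilinear_span_eq[OF linear_coordinate(3,1,2) _ x y])
  fix b' c' assume bc: "b' \<in> B10" "c' \<in> B01"
  have "b * c = b' * c' \<longleftrightarrow> b = b' \<and> c = c'" using mult_inj[OF b c bc] by auto
  then show "representation corner_basis (b' * c') (b * c) = representation B10 b' b * representation B01 c' c"
    by (simp add: representation_basis[OF indep_corner_basis mult_in_corner_basis[OF bc]]
        representation_basis[OF indep_B10 bc(1)] representation_basis[OF indep_B01 bc(2)])
qed

lemma representation_corner_basis_B11:
  assumes "a \<in> span B11"
  shows "representation corner_basis a = representation B11 a"
  using representation_extend[OF indep_corner_basis assms] by (simp add: corner_basis_def)

lemma representation_A''_mult:
  assumes "a \<in> span B11" "b \<in> B10" "c \<in> B01"
  shows "representation corner_basis a (b * c) = 0"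
  using representation_corner_basis_B11[OF assms(1)] mult_not_B11[OF assms(2,3)] representation_ne_zero by metis

text \<open>The coordinate of a state at a basis diagram. The latter has the letters \<open>w0\<close> at its top points
  and, where \<open>G i\<close> is not \<open>None\<close>, the label \<open>G i\<close> at its short bottom strands. A long strand of
  the state that the basis diagram does not contain has to be cut, so that the coordinate at a
  product \<open>b * c\<close> matters.\<close>

fun letter_coord :: "(nat \<Rightarrow> 'a option) \<Rightarrow> 'a letter \<Rightarrow> 'a letter \<Rightarrow> 'k" where
  "letter_coord G (None, b0) (None, b) = representation B10 b b0"
| "letter_coord G (None, b0) (Some i, a) =
     (case G i of None \<Rightarrow> 0 | Some c0 \<Rightarrow> representation corner_basis a (b0 * c0))"
| "letter_coord G (Some k, a0) (None, b) = 0"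
| "letter_coord G (Some k, a0) (Some i, a) = (if k = i then representation corner_basis a a0 else 0)"

fun row_coord :: "(nat \<Rightarrow> 'a option) \<Rightarrow> 'a letter list \<Rightarrow> 'a letter list \<Rightarrow> 'k" where
  "row_coord G [] [] = 1"
| "row_coord G (L0 # w0) (L # w) = letter_coord G L0 L * row_coord G w0 w"
| "row_coord G _ _ = 0"

text \<open>The factor of a short bottom strand at \<open>i\<close>; it is 0 if the basis diagram has a long strand there.\<close>

definition bot_coord :: "(nat \<Rightarrow> 'a option) \<Rightarrow> nat \<Rightarrow> 'a \<Rightarrow> 'k" where
  "bot_coord G i c = (case G i of None \<Rightarrow> 0 | Some c0 \<Rightarrow> representation B01 c c0)"

definition state_coord :: "nat set \<Rightarrow> (nat \<Rightarrow> 'a option) \<Rightarrow> 'a letter list \<Rightarrow> ('a, 'k) observable" where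
  "state_coord P G w0 \<tau> \<beta> = row_coord G w0 \<tau> * (\<Prod>i\<in>P - set (ends \<tau>). bot_coord G i (\<beta> i))"

text \<open>As a function of a single letter, a row coordinate is a multiple of a letter coordinate.\<close>

lemma row_coord_split:
  "\<exists>s L0. \<forall>L. row_coord G w0 (p @ L # q) = s * letter_coord G L0 L \<and> (s \<noteq> 0 \<longrightarrow> L0 \<in> set w0)"
proof (induction p arbitrary: w0)
  case Nil
  show ?case
  proof (cases w0)
    case Nil
    then show ?thesis by (auto intro!: exI[of _ 0])
  next
    case (Cons L0 w)
    then show ?thesis by (intro exI[of _ "row_coord G w q"] exI[of _ L0]) simp
  qed
next
  case (Cons M p)
  show ?case
  proof (cases w0)
    case Nil
    then show ?thesis by (auto intro!: exI[of _ 0])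
  next
    case (Cons M0 w)
    obtain s L0 where "\<forall>L. row_coord G w (p @ L # q) = s * letter_coord G L0 L \<and> (s \<noteq> 0 \<longrightarrow> L0 \<in> set w)"
      using Cons.IH by blast
    then show ?thesis
      using Cons by (intro exI[of _ "letter_coord G M0 M * s"] exI[of _ L0]) auto
  qed
qed

lemma linear_letter_coord: "linear_on (corner e 1 (column d)) (\<lambda>x. letter_coord G L0 (d, x))"
proof (cases L0)
  case (Pair d0 b0)
  then show ?thesis
    using linear_coordinate linear_on_zero
    by (cases d0; cases d; cases "G (the d)"; cases "d0 = d") auto
qed

lemma linear_bot_coord: "linear_on (corner e 0 1) (bot_coord G i)"
  unfolding bot_coord_def using linear_coordinate linear_on_zero by (cases "G i") auto

text \<open>The coordinates of states respect cutting, since the coordinate of \<open>b * c\<close> at an element of \<open>B11\<close> is 0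
  and its coordinate at a product of basis elements is the product of the coordinates.\<close>

lemma multilinear_state_coord:
  assumes P: "finite P" and G: "\<And>i c. G i = Some c \<Longrightarrow> c \<in> B01"
    and w0: "\<And>d x. (d, x) \<in> set w0 \<Longrightarrow> x \<in> (if d = None then B10 else B11)"
  shows "multilinear P (state_coord P G w0)"
  unfolding multilinear_def
proof (intro conjI allI impI)
  fix p d q \<beta>
  obtain s L0 where s: "row_coord G w0 (p @ L # q) = s * letter_coord G L0 L" for L
    using row_coord_split[of G w0 p q] by blast
  have ends: "set (ends (p @ (d, x) # q)) = set (ends (p @ (d, 0) # q))" for x :: 'a
    by (cases d) auto
  have "state_coord P G w0 (p @ (d, x) # q) \<beta> =
      s * letter_coord G L0 (d, x) * (\<Prod>i\<in>P - set (ends (p @ (d, 0) # q)). bot_coord G i (\<beta> i))" for x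
    unfolding state_coord_def s by (simp only: ends[of x])
  then show "linear_on (corner e 1 (column d)) (\<lambda>x. state_coord P G w0 (p @ (d, x) # q) \<beta>)"
    by (auto intro!: linear_on_mult_const2 linear_on_mult_const linear_letter_coord)
next
  fix \<tau> :: "'a letter list" and \<beta> k assume k: "k \<in> P - set (ends \<tau>)"
  have "state_coord P G w0 \<tau> (\<beta>(k := c)) = row_coord G w0 \<tau> *
      (bot_coord G k c * (\<Prod>i\<in>P - set (ends \<tau>) - {k}. bot_coord G i (\<beta> i)))" for c
    using P k by (simp add: state_coord_def prod.remove[of _ k])
  then show "linear_on (corner e 0 1) (\<lambda>c. state_coord P G w0 \<tau> (\<beta>(k := c)))"
    using linear_bot_coord by (auto intro!: linear_on_mult_const2 linear_on_mult_const)
next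
  fix p k b c q \<beta>
  assume v: "valid P (p @ (Some k, 0) # q) \<beta>" and b: "b \<in> corner e 1 0" and c: "c \<in> corner e 0 1"
  obtain s L0 where s: "row_coord G w0 (p @ L # q) = s * letter_coord G L0 L"
    and L0: "s \<noteq> 0 \<Longrightarrow> L0 \<in> set w0" for L
    using row_coord_split[of G w0 p q] by blast
  let ?E = "set (ends (p @ q))"
  have k: "k \<in> P" "k \<notin> ?E" using valid_end[OF v] by auto
  have eq: "s * letter_coord G L0 (Some k, b * c) = s * letter_coord G L0 (None, b) * bot_coord G k c"
  proof (cases "s = 0")
    case False
    obtain d0 x0 where x0: "L0 = (d0, x0)" by (cases L0)
    then have "x0 \<in> (if d0 = None then B10 else B11)" using L0[OF False] w0 by simp
    then have "letter_coord G L0 (Some k, b * c) = letter_coord G L0 (None, b) * bot_coord G k c"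
      using G representation_mult[OF b c] representation_mult_B11[OF b c] x0
      by (cases d0) (auto simp: bot_coord_def split: option.split)
    then show ?thesis by simp
  qed simp
  have "(\<Prod>i\<in>P - ?E. bot_coord G i ((\<beta>(k := c)) i)) =
      bot_coord G k ((\<beta>(k := c)) k) * (\<Prod>i\<in>P - ?E - {k}. bot_coord G i ((\<beta>(k := c)) i))"
    by (rule prod.remove) (use P k in auto)
  also have "(\<Prod>i\<in>P - ?E - {k}. bot_coord G i ((\<beta>(k := c)) i)) =
      (\<Prod>i\<in>P - insert k ?E. bot_coord G i (\<beta> i))"
    by (rule prod.cong) auto
  finally have prod: "(\<Prod>i\<in>P - ?E. bot_coord G i ((\<beta>(k := c)) i)) =
      bot_coord G k c * (\<Prod>i\<in>P - insert k ?E. bot_coord G i (\<beta> i))"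
    by simp
  have "set (ends (p @ (Some k, b * c) # q)) = insert k ?E" "set (ends (p @ (None, b) # q)) = ?E"
    by auto
  then show "state_coord P G w0 (p @ (Some k, b * c) # q) \<beta> =
      state_coord P G w0 (p @ (None, b) # q) (\<beta>(k := c))"
    unfolding state_coord_def s by (simp only: prod eq mult.assoc)
qed

text \<open>The labels of the short bottom strands of a basis word, as goals for \<open>bot_coord\<close>.\<close>

fun word_goals :: "'a strand list \<Rightarrow> nat \<Rightarrow> nat \<Rightarrow> 'a option" where
  "word_goals [] k = (\<lambda>_. None)"
| "word_goals (Top b # w) k = word_goals w k"
| "word_goals (Thru a # w) k = word_goals w (Suc k)"
| "word_goals (Bot c # w) k = (word_goals w (Suc k))(k := Some c)"

lemma row_coord_same_shape:
  assumes "shape w0 = shape w" "set (thru_labels w) \<subseteq> span B11"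
  shows "row_coord G (word_letters w0 k) (word_letters w k) =
    list_coord (replicate (length (top_labels w)) B10) (top_labels w0) (top_labels w) *
    list_coord (replicate (length (thru_labels w)) B11) (thru_labels w0) (thru_labels w)"
  using assms
proof (induction w arbitrary: w0 k rule: word_induct)
  case (Top b w)
  then obtain b0 w1 where w0: "w0 = strand.Top b0 # w1" "shape w1 = shape w"
    by (cases w0; cases "hd w0") auto
  then show ?case using Top.IH[OF w0(2)] Top.prems by simp
next
  case (Thru a w)
  then obtain a0 w1 where w0: "w0 = strand.Thru a0 # w1" "shape w1 = shape w"
    by (cases w0; cases "hd w0") auto
  then show ?case using Thru.IH[OF w0(2), of "Suc k"] Thru.prems by (simp add: representation_corner_basis_B11)
next
  case (Bot c w)
  then obtain c0 w1 where w0: "w0 = strand.Bot c0 # w1" "shape w1 = shape w"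
    by (cases w0; cases "hd w0") auto
  then show ?case using Bot.IH[OF w0(2), of "Suc k"] Bot.prems by simp
qed simp

lemma bot_coord_same_shape:
  assumes "shape w0 = shape w"
  shows "(\<Prod>i\<in>{k..<k + word_bot w} - set (ends (word_letters w k)).
      bot_coord (word_goals w0 k) i (word_bots w k \<beta> i)) =
    list_coord (replicate (length (bot_labels w)) B01) (bot_labels w0) (bot_labels w)"
  using assms
proof (induction w arbitrary: w0 k \<beta> rule: word_induct)
  case (Top b w)
  then obtain b0 w1 where w0: "w0 = strand.Top b0 # w1" "shape w1 = shape w"
    by (cases w0; cases "hd w0") auto
  then show ?case using Top.IH[OF w0(2)] by simp
next
  case (Thru a w)
  then obtain a0 w1 where w0: "w0 = strand.Thru a0 # w1" "shape w1 = shape w"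
    by (cases w0; cases "hd w0") auto
  have "{k..<k + word_bot (strand.Thru a # w)} - set (ends (word_letters (strand.Thru a # w) k)) =
      {Suc k..<Suc k + word_bot w} - set (ends (word_letters w (Suc k)))"
    by auto
  then show ?case using Thru.IH[OF w0(2), of "Suc k"] w0(1) by simp
next
  case (Bot c w)
  then obtain c0 w1 where w0: "w0 = strand.Bot c0 # w1" "shape w1 = shape w"
    by (cases w0; cases "hd w0") auto
  let ?J = "{Suc k..<Suc k + word_bot w} - set (ends (word_letters w (Suc k)))"
  have "k \<notin> set (ends (word_letters w (Suc k)))" using ends_word_letters[of w "Suc k"] by auto
  then have J: "{k..<k + word_bot (strand.Bot c # w)} - set (ends (word_letters (strand.Bot c # w) k)) =
      insert k ?J"
    by auto
  have "(\<Prod>i\<in>?J. bot_coord (word_goals w0 k) i (word_bots (strand.Bot c # w) k \<beta> i)) =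
      (\<Prod>i\<in>?J. bot_coord (word_goals w1 (Suc k)) i (word_bots w (Suc k) (\<beta>(k := c)) i))"
    by (rule prod.cong) (auto simp: w0(1) bot_coord_def)
  moreover have "bot_coord (word_goals w0 k) k (word_bots (strand.Bot c # w) k \<beta> k) = representation B01 c c0"
    by (simp add: w0(1) bot_coord_def word_bots_less)
  moreover have "(\<Prod>i\<in>insert k ?J. bot_coord (word_goals w0 k) i (word_bots (strand.Bot c # w) k \<beta> i)) =
      bot_coord (word_goals w0 k) k (word_bots (strand.Bot c # w) k \<beta> k) *
      (\<Prod>i\<in>?J. bot_coord (word_goals w0 k) i (word_bots (strand.Bot c # w) k \<beta> i))"
    by (rule prod.insert) simp_all
  ultimately show ?case
    unfolding J by (simp only: Bot.IH[OF w0(2)] w0(1) bot_labels.simps length_Cons replicate_Suc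
        list_coord.simps)
qed simp

lemma list_coord_append:
  "length Bs = length us \<Longrightarrow> length vs = length us \<Longrightarrow>
    list_coord (Bs @ Bs') (vs @ vs') (us @ us') = list_coord Bs vs us * list_coord Bs' vs' us'"
proof (induction us arbitrary: Bs vs)
  case (Cons u us)
  then obtain B Bs1 v vs1 where "Bs = B # Bs1" "vs = v # vs1" by (metis length_Suc_conv)
  then show ?case using Cons by simp
qed simp

lemma length_labels_shape:
  fixes v w :: "'a strand list"
  assumes "shape v = shape w"
  shows "length (top_labels v) = length (top_labels w)" "length (thru_labels v) = length (thru_labels w)"
    "length (bot_labels v) = length (bot_labels w)"
proof -
  have "length (top_labels (shape u)) = length (top_labels u) \<and>
      length (thru_labels (shape u)) = length (thru_labels u) \<and>
      length (bot_labels (shape u)) = length (bot_labels u)" for u :: "'a strand list"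
    by (induction u rule: word_induct) auto
  from this[of v] this[of w] assms
  show "length (top_labels v) = length (top_labels w)" "length (thru_labels v) = length (thru_labels w)"
    "length (bot_labels v) = length (bot_labels w)"
    by auto
qed

text \<open>The coordinate of a morphism at a word.\<close>

definition word_coord :: "'a strand list \<Rightarrow> ('k, 'a) expr \<Rightarrow> 'k" where
  "word_coord w0 f = sem f 0
     (state_coord {1..word_bot w0} (word_goals w0 1) (word_letters w0 1))
     (identity_state e 1 (word_bot w0)) (\<lambda>_. 0)"

lemma word_goals_in: "basis_word w \<Longrightarrow> word_goals w k i = Some c \<Longrightarrow> c \<in> B01"
  by (induction w arbitrary: k rule: word_induct) (auto split: if_splits)

lemma word_letters_in:
  "basis_word w \<Longrightarrow> (d, x) \<in> set (word_letters w k) \<Longrightarrow> x \<in> (if d = None then B10 else B11)"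
  by (induction w arbitrary: k rule: word_induct) auto

lemma word_coord_heq:
  assumes w0: "basis_word w0" and h: "heq (word_bot w0) m f g"
  shows "word_coord w0 f = word_coord w0 g"
proof -
  have "multilinear {1..word_bot w0} (state_coord {1..word_bot w0} (word_goals w0 1) (word_letters w0 1))"
    using word_goals_in[OF w0] word_letters_in[OF w0] by (intro multilinear_state_coord) auto
  from sem_sound[OF h this, of 0] show ?thesis
    unfolding agree_def word_coord_def using valid_identity_state by simp
qed

lemma word_coord_simps:
  "word_coord w0 (Add f g) = word_coord w0 f + word_coord w0 g"
  "word_coord w0 (Scal a f) = a * word_coord w0 f"
  by (simp_all add: word_coord_def)

lemma word_coord_word:
  assumes "good_word w" "word_bot w = word_bot w0"
  shows "word_coord w0 (word_expr w) =
    state_coord {1..word_bot w} (word_goals w0 1) (word_letters w0 1) (word_letters w 1) (word_bots w 1 (\<lambda>_. 0))"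
  using sem_word[OF assms(1), of "[]"] assms(2) by (simp add: word_coord_def)

text \<open>The bases of the factors that belong to \<open>f\<close>.\<close>

abbreviation basis_list :: "nat \<Rightarrow> nat \<Rightarrow> (nat \<rightharpoonup> nat) \<Rightarrow> 'a set list" where
  "basis_list m n f \<equiv>
  replicate (m - width f) B10 @ replicate (width f) B11 @ replicate (n - width f) B01"

lemma word_coord_same_shape:
  assumes w: "word_in (corner e 1 0) (span B11) (corner e 0 1) w" and good: "good_word w"
    and shape: "shape w0 = shape w"
    and f: "word_map w 1 1 = f" "word_bot w = n" "word_top w = m"
    and l: "word_labels w = (bs, as, cs)" and l0: "word_labels w0 = (bs0, as0, cs0)"
  shows "word_coord w0 (word_expr w) = list_coord (basis_list m n f) (bs0 @ as0 @ cs0) (bs @ as @ cs)"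
proof -
  have n: "word_bot w0 = n"
    using word_bot_shape[of w0] word_bot_shape[of w] shape f by simp
  have ll: "top_labels w = bs" "thru_labels w = as" "bot_labels w = cs"
    "top_labels w0 = bs0" "thru_labels w0 = as0" "bot_labels w0 = cs0"
    using l l0 by (auto simp: word_labels_def)
  have len: "length bs = m - width f" "length as = width f" "length cs = n - width f"
    using width_word_map[of w 1 1] word_top_eq[of w] word_bot_eq[of w] f ll by auto
  have len0: "length bs0 = length bs" "length as0 = length as" "length cs0 = length cs"
    using length_labels_shape[OF shape] ll by auto
  have P: "{1..n} = {1..<1 + n}" by auto
  have "word_coord w0 (word_expr w) = list_coord (replicate (length bs) B10) bs0 bs *
      list_coord (replicate (length as) B11) as0 as * list_coord (replicate (length cs) B01) cs0 cs"
    using word_coord_word[OF good, of w0] row_coord_same_shape[OF shape, of "word_goals w0 1" 1]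
      bot_coord_same_shape[OF shape, of 1 "\<lambda>_. 0"] w n f(2) ll
    unfolding state_coord_def by (simp add: P word_in_iff)
  then show ?thesis
    using len len0 by (simp add: list_coord_append mult.assoc)
qed

text \<open>If the long strands of a state have labels in the span of \<open>B11\<close>, then cutting one of them contributes
  nothing, because the coordinates at the products \<open>b * c\<close> vanish. So a nonzero coordinate requires the
  same bottom ends at the top points.\<close>

lemma row_coord_columns:
  assumes "row_coord (word_goals w0 k) v0 v \<noteq> 0" "\<And>i c. word_goals w0 k i = Some c \<Longrightarrow> c \<in> B01"
    "\<And>x. (None, x) \<in> set v0 \<Longrightarrow> x \<in> B10" "\<And>i x. (Some i, x) \<in> set v \<Longrightarrow> x \<in> span B11"
  shows "map fst v0 = map fst v"
  using assms(1,3,4)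
proof (induction "word_goals w0 k" v0 v rule: row_coord.induct)
  case (2 L0 v0 L v)
  obtain d0 x0 d x where L: "L0 = (d0, x0)" "L = (d, x)" by (cases L0, cases L)
  have "letter_coord (word_goals w0 k) L0 L \<noteq> 0" using "2.prems"(1) by auto
  then have "d0 = d"
    using L "2.prems"(2)[of x0] "2.prems"(3)[of _ x] assms(2) representation_A''_mult[of x x0]
    by (cases d0; cases d) (auto split: option.splits if_splits)
  moreover have "map fst v0 = map fst v"
  proof (rule "2.hyps")
    show "row_coord (word_goals w0 k) v0 v \<noteq> 0" using "2.prems"(1) by auto
    show "\<And>x. (None, x) \<in> set v0 \<Longrightarrow> x \<in> B10" using "2.prems"(2) by simp
    show "x \<in> span B11" if "(Some i, x) \<in> set v" for i x using "2.prems"(3)[of i x] that by simp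
  qed
  ultimately show ?case using L by simp
qed auto

lemma word_coord_other_map:
  assumes w: "word_in (corner e 1 0) (span B11) (corner e 0 1) w" and good: "good_word w"
    and w0: "basis_word w0" and n: "word_bot w = word_bot w0"
    and ne: "word_map w 1 1 \<noteq> word_map w0 1 1"
  shows "word_coord w0 (word_expr w) = 0"
proof (rule ccontr)
  assume "word_coord w0 (word_expr w) \<noteq> 0"
  then have "row_coord (word_goals w0 1) (word_letters w0 1) (word_letters w 1) \<noteq> 0"
    using word_coord_word[OF good n] by (auto simp: state_coord_def)
  moreover have "x \<in> span B11" if "(Some i, x) \<in> set (word_letters w 1)" for i x
  proof -
    have "(Some i, x) \<in> set (word_letters w k) \<Longrightarrow> x \<in> set (thru_labels w)" for k
      by (induction w arbitrary: k rule: word_induct) auto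
    then show ?thesis using that w by (auto simp: word_in_iff)
  qed
  moreover have "x \<in> B10" if "(None, x) \<in> set (word_letters w0 1)" for x
    using word_letters_in[OF w0 that] by simp
  ultimately have "map fst (word_letters w0 1) = map fst (word_letters w 1)"
    using word_goals_in[OF w0] by (intro row_coord_columns[of w0 1])
  then show False using ne by (simp add: word_map_eq_columns)
qed

end

section \<open>Tensor products\<close>

text \<open>The linear map on the free vector space on a set that is given by \<open>F\<close> on the set.\<close>

definition linear_extension :: "('k::field \<Rightarrow> 'v::ab_group_add \<Rightarrow> 'v) \<Rightarrow> ('b \<Rightarrow> 'v) \<Rightarrow> ('b \<Rightarrow>\<^sub>0 'k) \<Rightarrow> 'v" where
  "linear_extension s F p = (\<Sum>b\<in>Poly_Mapping.keys p. s (Poly_Mapping.lookup p b) (F b))"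

lemma lookup_free_scale [simp]: "Poly_Mapping.lookup (free_scale a p) b = a * Poly_Mapping.lookup p b"
  by (simp add: free_scale_def Poly_Mapping.map.rep_eq when_def)

lemma keys_free_scale: "Poly_Mapping.keys (free_scale a p) \<subseteq> Poly_Mapping.keys p"
  by (auto simp: in_keys_iff)

lemma vector_space_free_scale: "vector_space (free_scale :: 'k::field \<Rightarrow> ('b \<Rightarrow>\<^sub>0 'k) \<Rightarrow> _)"
  by unfold_locales (auto intro!: poly_mapping_eqI simp: lookup_add algebra_simps)

interpretation free: vector_space "free_scale :: 'k::field \<Rightarrow> ('b \<Rightarrow>\<^sub>0 'k) \<Rightarrow> _"
  by (rule vector_space_free_scale)

context vector_space begin

lemma linear_extension_superset:
  assumes "finite A" "Poly_Mapping.keys p \<subseteq> A"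
  shows "linear_extension scale F p = (\<Sum>b\<in>A. scale (Poly_Mapping.lookup p b) (F b))"
  unfolding linear_extension_def
  using assms by (intro sum.mono_neutral_left) (auto simp: in_keys_iff)

lemma linear_extension_add:
  "linear_extension scale F (p + q) = linear_extension scale F p + linear_extension scale F q"
proof -
  let ?A = "Poly_Mapping.keys p \<union> Poly_Mapping.keys q"
  have "finite ?A" "Poly_Mapping.keys (p + q) \<subseteq> ?A" using Poly_Mapping.keys_add[of p q] by auto
  then show ?thesis
    using linear_extension_superset[of ?A]
    by (simp add: lookup_add scale_left_distrib sum.distrib)
qed

lemma linear_extension_scale:
  "linear_extension scale F (free_scale a p) = scale a (linear_extension scale F p)"
  using linear_extension_superset[of "Poly_Mapping.keys p" "free_scale a p" F] keys_free_scale[of a p]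
  by (simp add: linear_extension_def scale_sum_right)

lemma linear_extension_diff:
  "linear_extension scale F (p - q) = linear_extension scale F p - linear_extension scale F q"
proof -
  have d: "p - q = p + free_scale (- 1) q" by (intro poly_mapping_eqI) (simp add: lookup_add lookup_minus)
  show ?thesis unfolding d linear_extension_add linear_extension_scale by simp
qed

lemma linear_extension_single:
  "linear_extension scale F (Poly_Mapping.single b a) = scale a (F b)"
  using linear_extension_superset[of "{b}" "Poly_Mapping.single b a" F] by simp

lemma linear_extension_0: "linear_extension scale F 0 = 0"
  by (simp add: linear_extension_def)

lemma list_coord_prod:
  "length Bs = length us \<Longrightarrow> length vs = length us \<Longrightarrow>
    list_coord Bs vs us = (\<Prod>i<length us. representation (Bs ! i) (us ! i) (vs ! i))"
proof (induction us arbitrary: Bs vs)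
  case (Cons u us)
  then obtain B Bs1 v vs1 where "Bs = B # Bs1" "vs = v # vs1" by (metis length_Suc_conv)
  then show ?case using Cons by (simp add: prod.lessThan_Suc_shift del: prod.lessThan_Suc)
qed simp

end

lemma listset_nth: "us \<in> listset Us \<longleftrightarrow> length us = length Us \<and> (\<forall>i<length Us. us ! i \<in> Us ! i)"
proof (induction Us arbitrary: us)
  case (Cons U Us)
  show ?case
  proof (cases us)
    case (Cons u us')
    then show ?thesis using Cons.IH[of us'] by (auto simp: set_Cons_def nth_Cons split: nat.splits)
  qed (auto simp: set_Cons_def)
qed auto

lemma listset_update:
  "us \<in> listset Us \<Longrightarrow> x \<in> Us ! i \<Longrightarrow> us[i := x] \<in> listset Us"
  by (cases "i < length us") (auto simp: listset_nth nth_list_update)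

text \<open>A multilinear function on tuples, extended linearly, vanishes on the relators.\<close>

lemma (in vector_space) linear_extension_relators:
  fixes s :: "'a \<Rightarrow> 'c::ab_group_add \<Rightarrow> 'c"
  assumes s: "vector_space s"
    and add: "\<And>us i x y. us \<in> listset Us \<Longrightarrow> i < length Us \<Longrightarrow> x \<in> Us ! i \<Longrightarrow> y \<in> Us ! i \<Longrightarrow>
        F (us[i := x + y]) = F (us[i := x]) + F (us[i := y])"
    and scale: "\<And>us i a x. us \<in> listset Us \<Longrightarrow> i < length Us \<Longrightarrow> x \<in> Us ! i \<Longrightarrow>
        F (us[i := scale a x]) = s a (F (us[i := x]))"
    and p: "p \<in> free.span (multilinear_relators scale Us)"
  shows "linear_extension s F p = 0"
  using p
proof (induction rule: free.span_induct_alt)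
  case base
  interpret s: vector_space s by fact
  show ?case by (rule s.linear_extension_0)
next
  case (step a r q)
  interpret s: vector_space s by fact
  have "linear_extension s F r = 0"
    using step(1) add scale
    by (auto simp: multilinear_relators_def s.linear_extension_diff s.linear_extension_single)
  then show ?case using step by (simp add: s.linear_extension_add s.linear_extension_scale)
qed

text \<open>Subspaces \<open>Us ! i\<close> with bases \<open>Bs ! i\<close>, the factors of a tensor product.\<close>

locale tensor_factors = vector_space scale
  for scale :: "'k::field \<Rightarrow> 'a::ab_group_add \<Rightarrow> 'a" +
  fixes Us Bs :: "'a set list"
  assumes same_length: "length Bs = length Us"
    and independent_factor: "i < length Us \<Longrightarrow> independent (Bs ! i)"
    and span_factor: "i < length Us \<Longrightarrow> span (Bs ! i) = Us ! i"
begin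

lemma factor_zero: "i < length Us \<Longrightarrow> 0 \<in> Us ! i"
  using span_factor span_zero by metis

lemma factor_add: "i < length Us \<Longrightarrow> x \<in> Us ! i \<Longrightarrow> y \<in> Us ! i \<Longrightarrow> x + y \<in> Us ! i"
  using span_factor span_add by metis

lemma factor_scale: "i < length Us \<Longrightarrow> x \<in> Us ! i \<Longrightarrow> scale a x \<in> Us ! i"
  using span_factor span_scale by metis

lemma basis_subset: "listset Bs \<subseteq> listset Us"
proof
  fix us assume us: "us \<in> listset Bs"
  have "us ! i \<in> Us ! i" if "i < length Us" for i
    using us that same_length span_factor[OF that] span_base[of "us ! i" "Bs ! i"] by (auto simp: listset_nth)
  then show "us \<in> listset Us" using us same_length by (auto simp: listset_nth)
qed

lemma list_coord_update:
  assumes "us \<in> listset Us" "vs \<in> listset Bs" "i < length Us"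
  shows "list_coord Bs vs (us[i := x]) = representation (Bs ! i) x (vs ! i) *
    (\<Prod>k\<in>{..<length Us} - {i}. representation (Bs ! k) (us ! k) (vs ! k))"
proof -
  have len: "length us = length Us" "length vs = length Us" using assms same_length by (auto simp: listset_nth)
  then have "list_coord Bs vs (us[i := x]) =
      (\<Prod>k<length Us. representation (Bs ! k) (us[i := x] ! k) (vs ! k))"
    using same_length by (subst list_coord_prod) auto
  also have "\<dots> = representation (Bs ! i) (us[i := x] ! i) (vs ! i) *
      (\<Prod>k\<in>{..<length Us} - {i}. representation (Bs ! k) (us[i := x] ! k) (vs ! k))"
    using assms(3) by (intro prod.remove) auto
  also have "(\<Prod>k\<in>{..<length Us} - {i}. representation (Bs ! k) (us[i := x] ! k) (vs ! k)) =
      (\<Prod>k\<in>{..<length Us} - {i}. representation (Bs ! k) (us ! k) (vs ! k))"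
    by (intro prod.cong) auto
  finally show ?thesis using assms(3) len by simp
qed

lemma list_coord_basis:
  assumes us: "us \<in> listset Bs" and vs: "vs \<in> listset Bs"
  shows "list_coord Bs vs us = (if us = vs then 1 else 0)"
proof -
  have len: "length us = length Us" "length vs = length Us" using assms same_length by (auto simp: listset_nth)
  have rep: "representation (Bs ! i) (us ! i) (vs ! i) = (if vs ! i = us ! i then 1 else 0)"
    if "i < length Us" for i
    using representation_basis[OF independent_factor[OF that], of "us ! i"] us that same_length
    by (auto simp: listset_nth)
  have "list_coord Bs vs us = (\<Prod>i<length Us. if vs ! i = us ! i then 1 else 0)"
    using len same_length rep by (subst list_coord_prod) auto
  also have "\<dots> = (if us = vs then 1 else 0)"
  proof (cases "us = vs")
    case False
    then obtain i where "i < length Us" "vs ! i \<noteq> us ! i" using len by (metis nth_equalityI)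
    then show ?thesis using False by (auto intro!: prod_zero)
  qed simp
  finally show ?thesis .
qed

lemma list_coord_relators:
  assumes vs: "vs \<in> listset Bs" and p: "p \<in> free.span (multilinear_relators scale Us)"
  shows "linear_extension (*) (list_coord Bs vs) p = 0"
proof (rule linear_extension_relators[OF _ _ _ p])
  show "vector_space ((*) :: 'k \<Rightarrow> 'k \<Rightarrow> 'k)"
    by unfold_locales (auto simp: algebra_simps)
  fix us i x y a assume us: "us \<in> listset Us" "i < length Us" "x \<in> Us ! i"
  show "list_coord Bs vs (us[i := scale a x]) = a * list_coord Bs vs (us[i := x])"
    unfolding list_coord_update[OF us(1) vs us(2)]
    using representation_scale[OF independent_factor[OF us(2)], of x a] us span_factor by simp
  assume "y \<in> Us ! i"
  then show "list_coord Bs vs (us[i := x + y]) = list_coord Bs vs (us[i := x]) + list_coord Bs vs (us[i := y])"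
    unfolding list_coord_update[OF us(1) vs us(2)]
    using representation_add[OF independent_factor[OF us(2)], of y x] us span_factor
    by (simp add: algebra_simps)
qed

abbreviation "tuples \<equiv> {p :: 'a list \<Rightarrow>\<^sub>0 'k. Poly_Mapping.keys p \<subseteq> listset Us}"

sublocale tensor: pre_vectorspace tuples "tensor_rel scale Us" "(+)" 0 free_scale
proof
  have sp: "x - z \<in> free.span R" if "x - y \<in> free.span R" "y - z \<in> free.span R" for x y z :: "'a list \<Rightarrow>\<^sub>0 'k" and R
    using free.span_add[OF that] by simp
  have neg: "y - x \<in> free.span R" if "x - y \<in> free.span R" for x y :: "'a list \<Rightarrow>\<^sub>0 'k" and R
    using free.span_neg[OF that] by simp
  show "equiv tuples (tensor_rel scale Us)"
    by (rule equivI)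
      (auto simp: refl_on_def sym_def trans_def tensor_rel_def free.span_zero intro: sp neg)
  fix x y z x' y' :: "'a list \<Rightarrow>\<^sub>0 'k" and a b :: 'k
  have keys: "x + y \<in> tuples" if "x \<in> tuples" "y \<in> tuples" for x y
    using that Poly_Mapping.keys_add[of x y] by auto
  have keys': "free_scale a x \<in> tuples" if "x \<in> tuples" for a x
    using that keys_free_scale[of a x] by auto
  have refl: "x \<in> tuples \<Longrightarrow> (x, x) \<in> tensor_rel scale Us" for x
    by (simp add: tensor_rel_def free.span_zero)
  show "x \<in> tuples \<Longrightarrow> y \<in> tuples \<Longrightarrow> x + y \<in> tuples" by (rule keys)
  show "x \<in> tuples \<Longrightarrow> free_scale a x \<in> tuples" by (rule keys')
  show "(0 :: 'a list \<Rightarrow>\<^sub>0 'k) \<in> tuples" by simp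
  show "(x + y, x' + y') \<in> tensor_rel scale Us"
    if "(x, x') \<in> tensor_rel scale Us" "(y, y') \<in> tensor_rel scale Us"
    using that keys[of x y] keys[of x' y'] free.span_add[of "x - x'" _ "y - y'"]
    by (auto simp: tensor_rel_def algebra_simps)
  show "(free_scale a x, free_scale a x') \<in> tensor_rel scale Us" if "(x, x') \<in> tensor_rel scale Us"
    using that keys'[of x a] keys'[of x' a] free.span_scale[of "x - x'" _ a]
    by (auto simp: tensor_rel_def free.scale_right_diff_distrib)
  show "x \<in> tuples \<Longrightarrow> y \<in> tuples \<Longrightarrow> z \<in> tuples \<Longrightarrow> (x + y + z, x + (y + z)) \<in> tensor_rel scale Us"
    using keys refl by (simp add: add.assoc)
  show "x \<in> tuples \<Longrightarrow> y \<in> tuples \<Longrightarrow> (x + y, y + x) \<in> tensor_rel scale Us"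
    using refl[OF keys, of x y] by (simp add: add.commute)
  show "x \<in> tuples \<Longrightarrow> (x + 0, x) \<in> tensor_rel scale Us" using refl by simp
  show "x \<in> tuples \<Longrightarrow> (free_scale 0 x, 0) \<in> tensor_rel scale Us" using refl[of 0] by simp
  show "x \<in> tuples \<Longrightarrow> (free_scale 1 x, x) \<in> tensor_rel scale Us" using refl by simp
  show "x \<in> tuples \<Longrightarrow> (free_scale (a * b) x, free_scale a (free_scale b x)) \<in> tensor_rel scale Us"
    using refl[OF keys', of x "a * b"] by simp
  show "x \<in> tuples \<Longrightarrow> y \<in> tuples \<Longrightarrow>
      (free_scale a (x + y), free_scale a x + free_scale a y) \<in> tensor_rel scale Us"
    using refl[OF keys'[OF keys], of x y a] by (simp add: free.scale_right_distrib)
  show "x \<in> tuples \<Longrightarrow> (free_scale (a + b) x, free_scale a x + free_scale b x) \<in> tensor_rel scale Us"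
    using refl[OF keys', of x "a + b"] by (simp add: free.scale_left_distrib)
qed

lemma tensor_space_eq: "tensor_space scale Us = tensor.Q"
  by (simp add: tensor_space_def)

lemma single_in_tuples: "us \<in> listset Us \<Longrightarrow> Poly_Mapping.single us a \<in> tuples"
  by simp

lemma pure_tensor_in: "us \<in> listset Us \<Longrightarrow> pure_tensor scale Us us \<in> carrier tensor.Q"
  unfolding pure_tensor_def by (intro tensor.cls_in single_in_tuples)

lemma pure_tensor_add:
  assumes "us \<in> listset Us" "i < length Us" "x \<in> Us ! i" "y \<in> Us ! i"
  shows "pure_tensor scale Us (us[i := x + y]) =
    pure_tensor scale Us (us[i := x]) \<oplus>\<^bsub>tensor.Q\<^esub> pure_tensor scale Us (us[i := y])"
proof -
  have in': "us[i := x + y] \<in> listset Us" "us[i := x] \<in> listset Us" "us[i := y] \<in> listset Us"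
    using assms by (auto intro: listset_update factor_add)
  have "Poly_Mapping.single (us[i := x + y]) 1 - Poly_Mapping.single (us[i := x]) (1 :: 'k)
      - Poly_Mapping.single (us[i := y]) 1 \<in> multilinear_relators scale Us"
    unfolding multilinear_relators_def using assms by blast
  then have "Poly_Mapping.single (us[i := x + y]) 1 -
      (Poly_Mapping.single (us[i := x]) (1 :: 'k) + Poly_Mapping.single (us[i := y]) 1)
      \<in> free.span (multilinear_relators scale Us)"
    by (simp add: free.span_base diff_diff_eq)
  moreover have "Poly_Mapping.single (us[i := x]) (1 :: 'k) + Poly_Mapping.single (us[i := y]) 1 \<in> tuples"
    using in' by (intro tensor.add_in single_in_tuples)
  ultimately have "(Poly_Mapping.single (us[i := x + y]) 1,
      Poly_Mapping.single (us[i := x]) (1 :: 'k) + Poly_Mapping.single (us[i := y]) 1) \<in> tensor_rel scale Us"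
    using in' by (simp add: tensor_rel_def)
  then show ?thesis
    unfolding pure_tensor_def using in' by (simp add: tensor.add_cls tensor.cls_eq)
qed

lemma pure_tensor_scale:
  assumes "us \<in> listset Us" "i < length Us" "x \<in> Us ! i"
  shows "pure_tensor scale Us (us[i := scale a x]) = a \<odot>\<^bsub>tensor.Q\<^esub> pure_tensor scale Us (us[i := x])"
proof -
  have in': "us[i := scale a x] \<in> listset Us" "us[i := x] \<in> listset Us"
    using assms by (auto intro: listset_update factor_scale)
  have "Poly_Mapping.single (us[i := scale a x]) 1 - Poly_Mapping.single (us[i := x]) a
      \<in> multilinear_relators scale Us"
    unfolding multilinear_relators_def using assms by blast
  then have "(Poly_Mapping.single (us[i := scale a x]) 1, Poly_Mapping.single (us[i := x]) a)
      \<in> tensor_rel scale Us"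
    using in' by (simp add: tensor_rel_def free.span_base)
  moreover have "free_scale a (Poly_Mapping.single (us[i := x]) 1) = Poly_Mapping.single (us[i := x]) a"
    by (intro poly_mapping_eqI) (simp add: lookup_single when_def)
  ultimately show ?thesis
    unfolding pure_tensor_def using in' by (simp add: tensor.smult_cls tensor.cls_eq)
qed

text \<open>The coordinates with respect to the pure tensors of basis vectors. Any representative of the class
  may be chosen, since the product of coordinates is multilinear.\<close>

definition tensor_coord :: "('a list \<Rightarrow>\<^sub>0 'k) set \<Rightarrow> 'a list \<Rightarrow> 'k" where
  "tensor_coord X vs = (if vs \<in> listset Bs
     then linear_extension (*) (list_coord Bs vs) (SOME p. p \<in> X) else 0)"

lemma tensor_coord_cls:
  assumes "p \<in> tuples" "vs \<in> listset Bs"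
  shows "tensor_coord (tensor_rel scale Us `` {p}) vs = linear_extension (*) (list_coord Bs vs) p"
proof -
  interpret k: vector_space "(*) :: 'k \<Rightarrow> 'k \<Rightarrow> 'k" by unfold_locales (auto simp: algebra_simps)
  have "p \<in> tensor_rel scale Us `` {p}" using assms(1) tensor.equiv by (rule equiv_class_self[rotated])
  then have "(SOME q. q \<in> tensor_rel scale Us `` {p}) \<in> tensor_rel scale Us `` {p}" by (rule someI)
  then have "p - (SOME q. q \<in> tensor_rel scale Us `` {p}) \<in> free.span (multilinear_relators scale Us)"
    by (auto simp: tensor_rel_def)
  from list_coord_relators[OF assms(2) this] show ?thesis
    using assms(2) by (simp add: tensor_coord_def k.linear_extension_diff)
qed

lemma tensor_coord_pure:
  assumes "us \<in> listset Us" "vs \<in> listset Bs"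
  shows "tensor_coord (pure_tensor scale Us us) vs = list_coord Bs vs us"
proof -
  interpret k: vector_space "(*) :: 'k \<Rightarrow> 'k \<Rightarrow> 'k" by unfold_locales (auto simp: algebra_simps)
  show ?thesis
    unfolding pure_tensor_def using tensor_coord_cls[OF single_in_tuples[OF assms(1)] assms(2)]
    by (simp add: k.linear_extension_single)
qed

text \<open>Pure tensors are expanded in the bases of the factors, one factor after the other.\<close>

lemma pure_tensor_closed:
  assumes us: "us \<in> listset Us"
    and basis: "\<And>vs. vs \<in> listset Bs \<Longrightarrow> Q (pure_tensor scale Us vs)"
    and zero: "Q \<zero>\<^bsub>tensor.Q\<^esub>"
    and add: "\<And>X Y. Q X \<Longrightarrow> Q Y \<Longrightarrow> Q (X \<oplus>\<^bsub>tensor.Q\<^esub> Y)"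
    and scale: "\<And>a X. Q X \<Longrightarrow> Q (a \<odot>\<^bsub>tensor.Q\<^esub> X)"
  shows "Q (pure_tensor scale Us us)"
proof -
  have "Q (pure_tensor scale Us us)"
    if "us \<in> listset Us" "\<forall>j. k \<le> j \<longrightarrow> j < length Us \<longrightarrow> us ! j \<in> Bs ! j" "k \<le> length Us" for k us
    using that
  proof (induction k arbitrary: us)
    case 0
    then show ?case using same_length by (intro basis) (auto simp: listset_nth)
  next
    case (Suc k)
    have k: "k < length Us" and len: "length us = length Us" using Suc.prems by (auto simp: listset_nth)
    have "x \<in> Us ! k \<and> Q (pure_tensor scale Us (us[k := x]))" if "x \<in> span (Bs ! k)" for x
      using that
    proof (induction rule: span_induct_alt)
      case base
      have z: "0 \<in> Us ! k" using k by (rule factor_zero)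
      have "pure_tensor scale Us (us[k := 0]) = 0 \<odot>\<^bsub>tensor.Q\<^esub> pure_tensor scale Us (us[k := 0])"
        using pure_tensor_scale[OF Suc.prems(1) k z, of 0] by simp
      also have "\<dots> = \<zero>\<^bsub>tensor.Q\<^esub>"
        unfolding pure_tensor_def
        using listset_update[OF Suc.prems(1) z] tensor.smult_cls[OF single_in_tuples, of "us[k := 0]" 0 1]
          tensor.zero_cls by simp
      finally show ?case using z zero by simp
    next
      case (step a x y)
      have x: "x \<in> Us ! k" using step(1) span_factor[OF k] span_base by blast
      have "us[k := x] \<in> listset Us" using Suc.prems(1) x by (rule listset_update)
      moreover have "\<forall>j. k \<le> j \<longrightarrow> j < length Us \<longrightarrow> us[k := x] ! j \<in> Bs ! j"
        using Suc.prems(2) step(1) len by (auto simp: nth_list_update)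
      ultimately have "Q (pure_tensor scale Us (us[k := x]))" using Suc.IH k by simp
      then show ?case
        using step x k Suc.prems(1) factor_scale[OF k x, of a]
        by (simp add: pure_tensor_add pure_tensor_scale factor_add add scale)
    qed
    from this[of "us ! k"] show ?case
      using Suc.prems(1) k span_factor[OF k] by (simp add: listset_nth)
  qed
  from this[of us "length Us"] us show ?thesis by simp
qed

sublocale tensor: dual_family tensor.Q "listset Bs" "pure_tensor scale Us" tensor_coord
proof (intro dual_family.intro tensor.vectorspace_quotient dual_family_axioms.intro)
  interpret k: vector_space "(*) :: 'k \<Rightarrow> 'k \<Rightarrow> 'k" by unfold_locales (auto simp: algebra_simps)
  interpret Q: vectorspace class_ring tensor.Q by (rule tensor.vectorspace_quotient)
  show v: "us \<in> listset Bs \<Longrightarrow> pure_tensor scale Us us \<in> carrier tensor.Q" for us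
    using basis_subset by (intro pure_tensor_in) auto
  show "tensor_coord (X \<oplus>\<^bsub>tensor.Q\<^esub> Y) vs = tensor_coord X vs + tensor_coord Y vs"
    if "X \<in> carrier tensor.Q" "Y \<in> carrier tensor.Q" for X Y vs
  proof (cases "vs \<in> listset Bs")
    case True
    then show ?thesis
      using that by (elim tensor.cls_cases)
        (simp add: tensor.add_cls tensor_coord_cls tensor.add_in k.linear_extension_add del: mem_Collect_eq)
  qed (simp add: tensor_coord_def)
  show "tensor_coord (a \<odot>\<^bsub>tensor.Q\<^esub> X) vs = a * tensor_coord X vs" if "X \<in> carrier tensor.Q" for X a vs
  proof (cases "vs \<in> listset Bs")
    case True
    then show ?thesis
      using that by (elim tensor.cls_cases)
        (simp add: tensor.smult_cls tensor_coord_cls tensor.smult_in k.linear_extension_scale del: mem_Collect_eq)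
  qed (simp add: tensor_coord_def)
  show "tensor_coord (pure_tensor scale Us us) vs = (if us = vs then 1 else 0)"
    if "us \<in> listset Bs" "vs \<in> listset Bs" for us vs
    using that basis_subset by (subst tensor_coord_pure) (auto simp: list_coord_basis)
  show "tensor_coord X vs = 0" if "vs \<notin> listset Bs" for X vs
    using that by (simp add: tensor_coord_def)
  let ?V = "pure_tensor scale Us ` listset Bs"
  have sub: "?V \<subseteq> carrier tensor.Q" using v by auto
  have sm: "submodule class_ring (Q.span ?V) tensor.Q" using Q.span_is_submodule[OF sub] .
  have "tensor_rel scale Us `` {p} \<in> Q.span ?V" if "p \<in> tuples" for p
  proof -
    have pure: "pure_tensor scale Us us \<in> Q.span ?V" if "us \<in> listset Us" for us
      using that
    proof (rule pure_tensor_closed)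
      show "pure_tensor scale Us vs \<in> Q.span ?V" if "vs \<in> listset Bs" for vs
        using that Q.in_own_span[OF sub] by auto
    qed (use sm in \<open>auto intro: submodule.zero_closed submodule.m_closed submodule.smult_closed\<close>)
    have monomials: "finite K \<Longrightarrow> K \<subseteq> listset Us \<Longrightarrow>
        (\<Sum>us\<in>K. Poly_Mapping.single us (Poly_Mapping.lookup p us)) \<in> tuples \<and>
        tensor_rel scale Us `` {\<Sum>us\<in>K. Poly_Mapping.single us (Poly_Mapping.lookup p us)} \<in> Q.span ?V" for K
    proof (induction K rule: finite_induct)
      case empty
      show ?case using submodule.zero_closed[OF sm] tensor.zero_cls by simp
    next
      case (insert us K)
      let ?q = "\<Sum>us\<in>K. Poly_Mapping.single us (Poly_Mapping.lookup p us)"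
      let ?s = "Poly_Mapping.single us (Poly_Mapping.lookup p us)"
      have q: "?q \<in> tuples" "tensor_rel scale Us `` {?q} \<in> Q.span ?V" and us: "us \<in> listset Us"
        using insert by auto
      have "free_scale (Poly_Mapping.lookup p us) (Poly_Mapping.single us 1) = ?s"
        by (intro poly_mapping_eqI) (simp add: lookup_single when_def)
      then have "tensor_rel scale Us `` {?s} = Poly_Mapping.lookup p us \<odot>\<^bsub>tensor.Q\<^esub> pure_tensor scale Us us"
        unfolding pure_tensor_def using tensor.smult_cls[OF single_in_tuples[OF us]] by simp
      then have "tensor_rel scale Us `` {?s} \<in> Q.span ?V"
        using pure[OF us] submodule.smult_closed[OF sm] by simp
      then have "tensor_rel scale Us `` {?s} \<oplus>\<^bsub>tensor.Q\<^esub> tensor_rel scale Us `` {?q} \<in> Q.span ?V"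
        using q(2) submodule.m_closed[OF sm] by blast
      then have "tensor_rel scale Us `` {?s + ?q} \<in> Q.span ?V"
        using tensor.add_cls[OF single_in_tuples[OF us] q(1)] by simp
      then show ?case
        using insert tensor.add_in[OF single_in_tuples[OF us] q(1)] by simp
    qed
    have "(\<Sum>us\<in>Poly_Mapping.keys p. Poly_Mapping.single us (Poly_Mapping.lookup p us)) = p"
      by (intro poly_mapping_eqI) (simp add: lookup_sum lookup_single when_def in_keys_iff)
    then show ?thesis
      using that monomials[of "Poly_Mapping.keys p"] by (simp only: mem_Collect_eq finite_keys)
  qed
  then show "carrier tensor.Q \<subseteq> Q.span ?V"
    by (metis subsetI tensor.cls_cases)
qed

end

section \<open>The basis of diagrams\<close>

lemma labels_iff:
  "(bs, as, cs) \<in> labels m n f P Q R \<longleftrightarrow>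
     length bs = m - width f \<and> set bs \<subseteq> P \<and> length as = width f \<and> set as \<subseteq> Q \<and>
     length cs = n - width f \<and> set cs \<subseteq> R"
  by (auto simp: labels_def mem_listset_replicate)

lemma labels_mono:
  "l \<in> labels m n f P Q R \<Longrightarrow> P \<subseteq> P' \<Longrightarrow> Q \<subseteq> Q' \<Longrightarrow> R \<subseteq> R' \<Longrightarrow> l \<in> labels m n f P' Q' R'"
  by (cases l) (auto simp: labels_iff)

text \<open>The labels of a diagram, in the order of the factors of the tensor product.\<close>

abbreviation join_labels :: "'a list \<times> 'a list \<times> 'a list \<Rightarrow> 'a list" where
  "join_labels l \<equiv> (case l of (bs, as, cs) \<Rightarrow> bs @ as @ cs)"

lemma listset_append:
  "us \<in> listset (As @ Bs) \<longleftrightarrow> (\<exists>v w. us = v @ w \<and> v \<in> listset As \<and> w \<in> listset Bs)"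
proof (induction As arbitrary: us)
  case (Cons A As)
  show ?case
    by (cases us) (auto simp: set_Cons_def Cons.IH Cons_eq_append_conv)
qed simp

lemma bij_join_labels:
  "bij_betw join_labels (labels m n f P Q R)
     (listset (replicate (m - width f) P @ replicate (width f) Q @ replicate (n - width f) R))"
proof (rule bij_betwI')
  fix l l' assume "l \<in> labels m n f P Q R" "l' \<in> labels m n f P Q R"
  then show "join_labels l = join_labels l' \<longleftrightarrow> l = l'"
    by (cases l; cases l') (auto simp: labels_iff)
next
  fix l assume "l \<in> labels m n f P Q R"
  then show "join_labels l \<in> listset (replicate (m - width f) P @ replicate (width f) Q @ replicate (n - width f) R)"
    by (cases l) (auto simp: listset_append labels_iff mem_listset_replicate)
next
  fix us assume "us \<in> listset (replicate (m - width f) P @ replicate (width f) Q @ replicate (n - width f) R)"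
  then obtain bs as cs where "us = bs @ as @ cs" "(bs, as, cs) \<in> labels m n f P Q R"
    by (auto simp: listset_append labels_iff mem_listset_replicate)
  then show "\<exists>l\<in>labels m n f P Q R. us = join_labels l"
    by (intro bexI[of _ "(bs, as, cs)"]) auto
qed

context dual_strand_bases begin

lemma indep_B11: "independent B11"
  using independent_mono[OF indep_corner_basis] by (auto simp: corner_basis_def)

lemma span_B11_subset: "span B11 \<subseteq> corner e 1 1"
  using span_mono[of B11 corner_basis] span_corner_basis by (auto simp: corner_basis_def)

abbreviation "Hom n m \<equiv> hom_space scale e n m"
abbreviation "basis_labels m n f \<equiv> labels m n f B10 B11 B01"
abbreviation "all_labels m n f \<equiv> labels m n f (corner e 1 0) (span B11) (corner e 0 1)"
abbreviation "diagram_index m n \<equiv> SIGMA f : PB m n. basis_labels m n f"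

lemma basis_labels_subset: "basis_labels m n f \<subseteq> all_labels m n f"
proof
  fix l assume "l \<in> basis_labels m n f"
  then show "l \<in> all_labels m n f" using B10_subset span_superset B01_subset by (rule labels_mono)
qed

lemma tensor_factors_strands:
  "tensor_factors scale (strand_spaces e (span B11) m n f) (basis_list m n f)"
proof
  let ?Us = "strand_spaces e (span B11) m n f"
  show "length (basis_list m n f) = length ?Us" by (simp add: strand_spaces_def)
  have "list_all2 (\<lambda>U B. independent B \<and> span B = U) ?Us (basis_list m n f)"
    unfolding strand_spaces_def
    by (intro list_all2_appendI)
      (auto simp: list_all2_conv_all_nth indep_B10 indep_B11 indep_B01 span_B10 span_B01)
  then show "independent (basis_list m n f ! i)" "span (basis_list m n f ! i) = ?Us ! i"
    if "i < length ?Us" for i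
    using that by (auto simp: list_all2_conv_all_nth)
qed

lemma list_coord_labels:
  assumes "l \<in> basis_labels m n f" "l' \<in> basis_labels m n f"
  shows "list_coord (basis_list m n f) (join_labels l') (join_labels l) = (if l = l' then 1 else 0)"
proof -
  interpret T: tensor_factors scale "strand_spaces e (span B11) m n f" "basis_list m n f"
    by (rule tensor_factors_strands)
  have "join_labels l \<in> listset (basis_list m n f)" "join_labels l' \<in> listset (basis_list m n f)"
    using bij_join_labels[of m n f B10 B11 B01] assms by (auto simp: bij_betw_def)
  moreover have "join_labels l = join_labels l' \<longleftrightarrow> l = l'"
    using bij_join_labels[of m n f B10 B11 B01] assms by (auto simp: bij_betw_def inj_on_def)
  ultimately show ?thesis using T.list_coord_basis by simp
qed

lemma diagram_eq_cls: "diagram scale e m n f l = hom.cls n m (diagram_expr m n f l)"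
  by (simp add: diagram_def)

lemma good_word_of_labels:
  assumes "word_in (corner e 1 0) (span B11) (corner e 0 1) w"
  shows "good_word w"
  using assms span_B11_subset by (rule word_in_mono[OF _ subset_refl _ subset_refl])

text \<open>The labelled diagrams form a basis with explicit dual functionals. Those are also computed on diagrams
  with arbitrary labels from the three spaces, where they are products of coordinates of the labels.\<close>

theorem hom_dual_family:
  obtains c where
    "dual_family (Hom n m) (diagram_index m n) (\<lambda>(f, l). diagram scale e m n f l) c"
    "\<And>f l f' l'. f \<in> PB m n \<Longrightarrow> l \<in> all_labels m n f \<Longrightarrow> (f', l') \<in> diagram_index m n \<Longrightarrow>
       c (diagram scale e m n f l) (f', l') =
         (if f = f' then list_coord (basis_list m n f) (join_labels l') (join_labels l) else 0)"
    "\<And>f l. f \<in> PB m n \<Longrightarrow> l \<in> all_labels m n f \<Longrightarrow> diagram scale e m n f l \<in> carrier (Hom n m)"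
proof -
  \<comment> \<open>for each \<open>f\<close> one shape is chosen, for basis labels as well as for arbitrary labels\<close>
  have "\<exists>s :: unit strand list. \<forall>P Q R (l :: 'a list \<times> 'a list \<times> 'a list). l \<in> labels m n f P Q R \<longrightarrow>
      (\<exists>w. shape w = s \<and> word_map w 1 1 = f \<and> word_labels w = l \<and> word_in P Q R w \<and>
        word_bot w = n \<and> word_top w = m)" if "f \<in> PB m n" for f
    using PB_shape[OF that] by metis
  then obtain S :: "(nat \<rightharpoonup> nat) \<Rightarrow> unit strand list" where
    S: "\<And>f P Q R (l :: 'a list \<times> 'a list \<times> 'a list). f \<in> PB m n \<Longrightarrow> l \<in> labels m n f P Q R \<Longrightarrow>
      \<exists>w. shape w = S f \<and> word_map w 1 1 = f \<and> word_labels w = l \<and> word_in P Q R w \<and>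
        word_bot w = n \<and> word_top w = m"
    by metis
  obtain W where W: "\<And>f l. (f, l) \<in> diagram_index m n \<Longrightarrow>
      shape (W (f, l)) = S f \<and> word_map (W (f, l)) 1 1 = f \<and> word_labels (W (f, l)) = l \<and>
      basis_word (W (f, l)) \<and> word_bot (W (f, l)) = n \<and> word_top (W (f, l)) = m"
  proof -
    have "\<forall>d\<in>diagram_index m n. \<exists>w. shape w = S (fst d) \<and> word_map w 1 1 = fst d \<and>
        word_labels w = snd d \<and> basis_word w \<and> word_bot w = n \<and> word_top w = m"
      using S by fastforce
    from bchoice[OF this] obtain W where "\<forall>d\<in>diagram_index m n. shape (W d) = S (fst d) \<and>
        word_map (W d) 1 1 = fst d \<and> word_labels (W d) = snd d \<and> basis_word (W d) \<and>
        word_bot (W d) = n \<and> word_top (W d) = m" ..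
    then show thesis by (intro that[of W]) fastforce
  qed
  define c where "c X d = (if d \<in> diagram_index m n then word_coord (W d) (SOME t. t \<in> X) else 0)" for X d
  have c_cls: "c (hom.cls n m t) d = word_coord (W d) t" if t: "harr t n m" and d: "d \<in> diagram_index m n" for t d
  proof -
    have "t \<in> hom.cls n m t" using t hom_eq.refl by (auto simp: hom_rel_def)
    then have "(SOME t'. t' \<in> hom.cls n m t) \<in> hom.cls n m t" by (rule someI)
    then have "heq n m t (SOME t'. t' \<in> hom.cls n m t)" by (simp add: hom_rel_def)
    then show ?thesis
      using word_coord_heq[of "W d" m t] W[of "fst d" "snd d"] d by (simp add: c_def)
  qed
  have diag: "harr (diagram_expr m n f l) n m \<and> (\<forall>f' l'. (f', l') \<in> diagram_index m n \<longrightarrow>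
      c (diagram scale e m n f l) (f', l') =
        (if f = f' then list_coord (basis_list m n f) (join_labels l') (join_labels l) else 0))"
    if f: "f \<in> PB m n" and l: "l \<in> all_labels m n f" for f l
  proof -
    obtain w where w: "shape w = S f" "word_map w 1 1 = f" "word_labels w = l"
      "word_in (corner e 1 0) (span B11) (corner e 0 1) w" "word_bot w = n" "word_top w = m"
      using S[OF f l] by blast
    have good: "good_word w" using w(4) by (rule good_word_of_labels)
    have h: "heq n m (diagram_expr m n f l) (word_expr w)"
      using word_heq_diagram[OF good w(5,6)] w(2,3) by simp
    have ar: "harr (diagram_expr m n f l) n m" using h by (rule heq_arr1)
    have "c (diagram scale e m n f l) (f', l') =
        (if f = f' then list_coord (basis_list m n f) (join_labels l') (join_labels l) else 0)"
      if d: "(f', l') \<in> diagram_index m n" for f' l'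
    proof -
      note W' = W[OF d]
      have "c (diagram scale e m n f l) (f', l') = word_coord (W (f', l')) (word_expr w)"
        unfolding diagram_eq_cls c_cls[OF ar d] using word_coord_heq[of "W (f', l')" m] W' h by simp
      also have "\<dots> = (if f = f' then list_coord (basis_list m n f) (join_labels l') (join_labels l) else 0)"
      proof (cases "f = f'")
        case True
        obtain bs as cs where l1: "l = (bs, as, cs)" by (cases l)
        obtain bs0 as0 cs0 where l0: "l' = (bs0, as0, cs0)" by (cases l')
        have "word_coord (W (f', l')) (word_expr w) =
            list_coord (basis_list m n f) (bs0 @ as0 @ cs0) (bs @ as @ cs)"
          using w W' True l1 l0 good by (intro word_coord_same_shape) auto
        then show ?thesis using True l1 l0 by simp
      next
        case False
        then show ?thesis
          using word_coord_other_map[OF w(4) good, of "W (f', l')"] W' w by auto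
      qed
      finally show ?thesis .
    qed
    then show ?thesis using ar by blast
  qed
  show thesis
  proof (rule that)
    show "diagram scale e m n f l \<in> carrier (Hom n m)" if "f \<in> PB m n" "l \<in> all_labels m n f" for f l
      unfolding diagram_eq_cls hom_space_eq using diag[OF that] by (intro hom.cls_in) simp
    show "c (diagram scale e m n f l) (f', l') =
         (if f = f' then list_coord (basis_list m n f) (join_labels l') (join_labels l) else 0)"
      if "f \<in> PB m n" "l \<in> all_labels m n f" "(f', l') \<in> diagram_index m n" for f l f' l'
      using diag[OF that(1,2)] that(3) by blast
    interpret H: vectorspace class_ring "hom.Q n m" by (rule hom.vectorspace_quotient)
    let ?v = "\<lambda>(f, l). diagram scale e m n f l"
    have v: "?v d \<in> carrier (hom.Q n m)" if d: "d \<in> diagram_index m n" for d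
    proof -
      have "harr (diagram_expr m n (fst d) (snd d)) n m"
        using diag[of "fst d" "snd d"] d basis_labels_subset[of m n "fst d"] by fastforce
      then show ?thesis by (simp add: split_beta diagram_eq_cls hom.cls_in)
    qed
    show "dual_family (Hom n m) (diagram_index m n) ?v c"
      unfolding hom_space_eq
    proof (intro dual_family.intro hom.vectorspace_quotient dual_family_axioms.intro)
      show "?v d \<in> carrier (hom.Q n m)" if "d \<in> diagram_index m n" for d using v[OF that] .
      show "c (X \<oplus>\<^bsub>hom.Q n m\<^esub> Y) d = c X d + c Y d"
        if X: "X \<in> carrier (hom.Q n m)" and Y: "Y \<in> carrier (hom.Q n m)" for X Y d
      proof (cases "d \<in> diagram_index m n")
        case True
        obtain s where "X = hom.cls n m s" "harr s n m"
          using X by (elim hom.cls_cases) simp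
        moreover obtain t where "Y = hom.cls n m t" "harr t n m"
          using Y by (elim hom.cls_cases) simp
        ultimately show ?thesis
          using True by (simp add: hom.add_cls c_cls arr.intros(6) word_coord_simps)
      qed (simp add: c_def)
      show "c (a \<odot>\<^bsub>hom.Q n m\<^esub> X) d = a * c X d" if X: "X \<in> carrier (hom.Q n m)" for X a d
      proof (cases "d \<in> diagram_index m n")
        case True
        obtain s where "X = hom.cls n m s" "harr s n m"
          using X by (elim hom.cls_cases) simp
        then show ?thesis
          using True by (simp add: hom.smult_cls c_cls arr.intros(7) word_coord_simps)
      qed (simp add: c_def)
      show "c (?v d) d' = (if d = d' then 1 else 0)"
        if d: "d \<in> diagram_index m n" and d': "d' \<in> diagram_index m n" for d d'
      proof -
        have l: "fst d \<in> PB m n" "snd d \<in> basis_labels m n (fst d)" "snd d' \<in> basis_labels m n (fst d')"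
          using d d' by auto
        have dd: "(fst d', snd d') \<in> diagram_index m n" using d' by simp
        have "c (diagram scale e m n (fst d) (snd d)) (fst d', snd d') =
            (if fst d = fst d' then list_coord (basis_list m n (fst d)) (join_labels (snd d')) (join_labels (snd d)) else 0)"
          using diag[OF l(1) subsetD[OF basis_labels_subset l(2)]] dd by blast
        moreover have "fst d = fst d' \<Longrightarrow>
            list_coord (basis_list m n (fst d)) (join_labels (snd d')) (join_labels (snd d)) =
              (if snd d = snd d' then 1 else 0)"
          using l by (intro list_coord_labels) simp_all
        moreover have "d = d' \<longleftrightarrow> fst d = fst d' \<and> snd d = snd d'" by (rule prod_eq_iff)
        moreover have "?v d = diagram scale e m n (fst d) (snd d)" by (simp add: split_beta)
        ultimately show ?thesis unfolding prod.collapse by presburger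
      qed
      show "c X d = 0" if "d \<notin> diagram_index m n" for X d using that by (simp add: c_def)
      let ?V = "?v ` diagram_index m n"
      have sub: "?V \<subseteq> carrier (hom.Q n m)" by (intro image_subsetI v)
      have sm: "submodule class_ring (H.span ?V) (hom.Q n m)" using H.span_is_submodule[OF sub] .
      have "hom.cls n m t \<in> H.span ?V" if "harr t n m" for t
        using wspan_arr[OF that]
      proof induction
        case (base s)
        obtain w where w: "s = word_expr w" "basis_word w" "word_bot w = n" "word_top w = m"
          using base(1) unfolding basis_words_def by blast
        have idx: "(word_map w 1 1, word_labels w) \<in> diagram_index m n"
          using word_map_in_PB[OF w(3,4)] word_labels_in[OF w(2,3,4)] by (intro SigmaI)
        have "diagram scale e m n (word_map w 1 1) (word_labels w) \<in> H.span ?V"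
          by (rule subsetD[OF H.in_own_span[OF sub]], rule image_eqI[OF _ idx]) simp
        moreover have "hom.cls n m s = diagram scale e m n (word_map w 1 1) (word_labels w)"
          unfolding diagram_eq_cls w(1)
          using word_heq_diagram[OF good_basis_word[OF w(2)] w(3,4)]
          by (intro hom.cls_eq[symmetric]) (simp add: hom_rel_def)
        ultimately show ?case by simp
      next
        case zero
        show ?case using submodule.zero_closed[OF sm] by (simp add: hom.zero_cls)
      next
        case (add f g)
        then show ?case
          using submodule.m_closed[OF sm add.IH] by (simp add: hom.add_cls hom_span_arr)
      next
        case (scal f a)
        then show ?case
          using submodule.smult_closed[OF sm _ scal.IH, of a] by (simp add: hom.smult_cls hom_span_arr)
      next
        case (heq f g)
        then show ?case using hom.cls_eq[of f g n m] by (simp add: hom_rel_def)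
      qed
      then show "carrier (hom.Q n m) \<subseteq> H.span ?V"
        by (metis hom.cls_cases mem_Collect_eq subsetI)
    qed
  qed
qed

end

context dual_strand_bases begin

text \<open>Both spaces have coordinates indexed by the labelled diagrams, and the coordinates of a pure tensor
  are those of the diagram with the same labels.\<close>

theorem hom_direct_sum_iso:
  fixes m n :: nat
  defines "Us \<equiv> strand_spaces e (span B11) m n"
  defines "V \<equiv> \<lambda>f. tensor_space scale (Us f)"
  shows "\<exists>\<Phi>. linear_map class_ring (direct_sum_space (PB m n) V) (Hom n m) \<Phi> \<and>
    bij_betw \<Phi> (carrier (direct_sum_space (PB m n) V)) (carrier (Hom n m)) \<and>
    (\<forall>f\<in>PB m n. \<forall>l\<in>all_labels m n f.
       \<Phi> (summand_inj (PB m n) V f (pure_tensor scale (Us f) (join_labels l))) = diagram scale e m n f l)"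
proof -
  let ?I = "diagram_index m n"
  obtain c where c: "dual_family (Hom n m) ?I (\<lambda>(f, l). diagram scale e m n f l) c"
    "\<And>f l f' l'. f \<in> PB m n \<Longrightarrow> l \<in> all_labels m n f \<Longrightarrow> (f', l') \<in> ?I \<Longrightarrow>
       c (diagram scale e m n f l) (f', l') =
         (if f = f' then list_coord (basis_list m n f) (join_labels l') (join_labels l) else 0)"
    "\<And>f l. f \<in> PB m n \<Longrightarrow> l \<in> all_labels m n f \<Longrightarrow> diagram scale e m n f l \<in> carrier (Hom n m)"
    by (rule hom_dual_family[of n m]) (rule that; assumption)
  interpret F: dual_family "Hom n m" ?I "\<lambda>(f, l). diagram scale e m n f l" c by (rule c(1))
  have V: "vectorspace class_ring (V f)" for f
  proof -
    interpret T: tensor_factors scale "Us f" "basis_list m n f"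
      unfolding Us_def by (rule tensor_factors_strands)
    show ?thesis unfolding V_def T.tensor_space_eq by (rule T.tensor.vectorspace_quotient)
  qed
  have pure_in: "pure_tensor scale (Us f) us \<in> carrier (V f)" if "us \<in> listset (Us f)" for f us
  proof -
    interpret T: tensor_factors scale "Us f" "basis_list m n f"
      unfolding Us_def by (rule tensor_factors_strands)
    show ?thesis unfolding V_def T.tensor_space_eq using that by (rule T.pure_tensor_in)
  qed
  have "\<forall>f. \<exists>t. coordinate_map (V f) (listset (basis_list m n f)) t \<and>
      (\<forall>us\<in>listset (Us f). \<forall>vs\<in>listset (basis_list m n f).
         t (pure_tensor scale (Us f) us) vs = list_coord (basis_list m n f) vs us)"
  proof
    fix f :: "nat \<rightharpoonup> nat"
    interpret T: tensor_factors scale "Us f" "basis_list m n f"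
      unfolding Us_def by (rule tensor_factors_strands)
    show "\<exists>t. coordinate_map (V f) (listset (basis_list m n f)) t \<and>
      (\<forall>us\<in>listset (Us f). \<forall>vs\<in>listset (basis_list m n f).
         t (pure_tensor scale (Us f) us) vs = list_coord (basis_list m n f) vs us)"
      unfolding V_def T.tensor_space_eq
      by (intro exI[of _ T.tensor_coord] conjI ballI T.tensor.coordinate_map T.tensor_coord_pure)
  qed
  from choice[OF this] obtain t where "\<forall>f. coordinate_map (V f) (listset (basis_list m n f)) (t f) \<and>
      (\<forall>us\<in>listset (Us f). \<forall>vs\<in>listset (basis_list m n f).
         t f (pure_tensor scale (Us f) us) vs = list_coord (basis_list m n f) vs us)" ..
  then have t: "\<And>f. coordinate_map (V f) (listset (basis_list m n f)) (t f)"
    and t_pure: "\<And>f us vs. us \<in> listset (Us f) \<Longrightarrow> vs \<in> listset (basis_list m n f) \<Longrightarrow>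
         t f (pure_tensor scale (Us f) us) vs = list_coord (basis_list m n f) vs us"
    by blast+
  define N where "N = (\<lambda>x (f, l). if f \<in> PB m n then
      (if l \<in> basis_labels m n f then t f (x f) (join_labels l) else 0) else 0)"
  have N: "coordinate_map (direct_sum_space (PB m n) V) ?I N"
    unfolding N_def
    by (rule coordinate_map_direct_sum[where c = "\<lambda>f x l. if l \<in> basis_labels m n f then t f x (join_labels l) else 0"])
      (rule V, rule coordinate_map_reindex[OF t bij_join_labels])
  note iso = linear_map_of_coordinates[OF vectorspace_direct_sum[OF V] vectorspace_hom N F.coordinate_map]
  have "inv_into (carrier (Hom n m)) c (N (summand_inj (PB m n) V f (pure_tensor scale (Us f) (join_labels l)))) =
      diagram scale e m n f l" if f: "f \<in> PB m n" and l: "l \<in> all_labels m n f" for f l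
  proof (rule iso(3))
    let ?x = "summand_inj (PB m n) V f (pure_tensor scale (Us f) (join_labels l))"
    have us: "join_labels l \<in> listset (Us f)"
      unfolding Us_def strand_spaces_def by (rule bij_betw_apply[OF bij_join_labels l])
    have "?x f' \<in> carrier (V f')" if "f' \<in> PB m n" for f'
    proof -
      interpret W: vectorspace class_ring "V f'" by (rule V)
      show ?thesis using that pure_in[OF us] by (simp add: summand_inj_def)
    qed
    moreover have "{f' \<in> PB m n. ?x f' \<noteq> \<zero>\<^bsub>V f'\<^esub>} \<subseteq> {f}"
      by (auto simp: summand_inj_def)
    then have "finite {f' \<in> PB m n. ?x f' \<noteq> \<zero>\<^bsub>V f'\<^esub>}" by (rule finite_subset) simp
    ultimately show "?x \<in> carrier (direct_sum_space (PB m n) V)"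
      unfolding direct_sum_simps(1) by (auto simp: summand_inj_def)
    show D: "diagram scale e m n f l \<in> carrier (Hom n m)" using f l by (rule c(3))
    show "N ?x = c (diagram scale e m n f l)"
    proof (rule ext)
      fix d :: "(nat \<Rightarrow> nat option) \<times> 'a list \<times> 'a list \<times> 'a list"
      obtain f' l' where d: "d = (f', l')" by (cases d)
      show "N ?x d = c (diagram scale e m n f l) d"
      proof (cases "d \<in> ?I")
        case True
        then have l': "f' \<in> PB m n" "l' \<in> basis_labels m n f'" by (auto simp: d)
        have vs: "join_labels l' \<in> listset (basis_list m n f')"
          using bij_betw_apply[OF bij_join_labels l'(2)] .
        have "N ?x d = t f' (?x f') (join_labels l')" using l' by (simp add: N_def d)
        also have "\<dots> = (if f = f' then list_coord (basis_list m n f) (join_labels l') (join_labels l) else 0)"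
        proof (cases "f = f'")
          case True
          then show ?thesis
            using t_pure[OF us, of "join_labels l'"] vs l'(1) by (simp add: summand_inj_def)
        next
          case False
          then show ?thesis
            using l'(1) coordinate_map_zero[OF V t] by (simp add: summand_inj_def)
        qed
        finally show ?thesis using c(2)[OF f l, of f' l'] True by (simp add: d)
      next
        case False
        then have "N ?x d = 0" by (auto simp: N_def d)
        then show ?thesis using F.c_outside[OF D False] by simp
      qed
    qed
  qed
  with iso(1,2) show ?thesis by blast
qed

end

section \<open>A basis of the corner at \<open>1 - e\<close>\<close>

lemma prod_list_update:
  fixes us :: "'a::monoid_mult list"
  shows "i < length us \<Longrightarrow> prod_list (us[i := x]) = prod_list (take i us) * x * prod_list (drop (Suc i) us)"
  by (simp add: upd_conv_take_nth_drop mult.assoc)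

text \<open>The multiplication map is well defined, since the product is multilinear.\<close>

lemma (in k_algebra) mult_map_tensor_rel:
  assumes p: "Poly_Mapping.keys p \<subseteq> listset Us"
  shows "mult_map scale (tensor_rel scale Us `` {p}) = linear_extension scale prod_list p"
proof -
  have eq: "linear_extension scale prod_list q = linear_extension scale prod_list p"
    if "(p, q) \<in> tensor_rel scale Us" for q
  proof -
    have "linear_extension scale prod_list (p - q) = 0"
    proof (rule linear_extension_relators[OF vector_space_axioms])
      show "p - q \<in> free.span (multilinear_relators scale Us)" using that by (simp add: tensor_rel_def)
    qed (auto simp: listset_nth prod_list_update distrib_left distrib_right scale_mult_left scale_mult_right)
    then show ?thesis by (simp add: linear_extension_diff)
  qed
  have "(p, p) \<in> tensor_rel scale Us" using p free.span_zero by (simp add: tensor_rel_def)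
  then have "linear_extension scale prod_list p \<in> linear_extension scale prod_list ` (tensor_rel scale Us `` {p})"
    by (intro imageI ImageI[where a = p]) simp_all
  then have "linear_extension scale prod_list ` (tensor_rel scale Us `` {p}) = {linear_extension scale prod_list p}"
    using eq by blast
  then show ?thesis by (simp add: mult_map_def linear_extension_def[abs_def])
qed

lemma (in k_algebra) span_products:
  assumes x: "x \<in> span B" and y: "y \<in> span C"
  shows "x * y \<in> span {b * c | b c. b \<in> B \<and> c \<in> C}"
  using x
proof (induction rule: span_induct_alt)
  case base
  show ?case by (simp add: span_zero)
next
  case (step a b x)
  have "b * y \<in> span {b * c | b c. b \<in> B \<and> c \<in> C}"
    using y
  proof (induction rule: span_induct_alt)
    case base
    show ?case by (simp add: span_zero)
  next
    case (step a c y)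
    then have "b * c \<in> span {b * c | b c. b \<in> B \<and> c \<in> C}" using \<open>b \<in> B\<close> by (intro span_base) blast
    then show ?case using step by (simp add: distrib_left scale_mult_right span_add span_scale)
  qed
  then show ?case using step by (simp add: distrib_right scale_mult_left span_add span_scale)
qed

text \<open>The inverse of \<open>k \<cong> eAe\<close> is extended to a functional on \<open>A\<close>.\<close>

lemma (in idempotent_algebra) field_corner_functional:
  assumes "corner_iso_field scale e"
  obtains \<kappa> where "field_corner_algebra scale e \<kappa>"
proof -
  obtain \<phi> :: "'k \<Rightarrow> 'a" where \<phi>: "bij_betw \<phi> UNIV (corner e 0 0)" "\<phi> 1 = e" "\<And>a x. \<phi> (a * x) = scale a (\<phi> x)"
    using assms by (auto simp: corner_iso_field_def)
  have \<phi>_eq: "\<phi> a = scale a e" for a using \<phi>(3)[of a 1] \<phi>(2) by simp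
  have "e \<noteq> 0"
  proof
    assume "e = 0"
    then have "\<phi> 0 = \<phi> 1" by (simp add: \<phi>_eq)
    then show False using \<phi>(1) by (auto simp: bij_betw_def inj_eq)
  qed
  then have ind: "independent {e}" by simp
  let ?B = "extend_basis {e}"
  have B: "independent ?B" "span ?B = UNIV" "e \<in> ?B"
    using independent_extend_basis[OF ind] span_extend_basis[OF ind] extend_basis_superset[OF ind] by simp_all
  define \<kappa> :: "'a \<Rightarrow> 'k" where "\<kappa> x = representation ?B x e" for x
  have e: "\<kappa> e = 1" using B by (simp add: \<kappa>_def representation_basis)
  have sc: "\<kappa> (scale a x) = a * \<kappa> x" for a x using B by (simp add: \<kappa>_def representation_scale)
  have "field_corner_algebra scale e \<kappa>"
  proof
    show "\<kappa> (x + y) = \<kappa> x + \<kappa> y" for x y using B by (simp add: \<kappa>_def representation_add)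
    show "scale (\<kappa> x) e = x" if x: "x \<in> corner e 0 0" for x
    proof -
      have "x \<in> range \<phi>" using x \<phi>(1) unfolding bij_betw_def by metis
      then obtain a where "x = scale a e" using \<phi>_eq by blast
      then show ?thesis by (simp add: sc e)
    qed
  qed (fact e sc)+
  then show thesis by (rule that)
qed

text \<open>A combination of the tensors \<open>b \<otimes> c\<close> whose product lies in \<open>A''\<close> has product 0, as \<open>A' \<inter> A'' = 0\<close>,
  and hence is 0, as the multiplication map is injective. Everything about the products \<open>b * c\<close> follows
  from this: they are distinct, they are not in \<open>B11\<close>, and they are independent modulo \<open>A''\<close>.\<close>

lemma (in field_corner_algebra) dual_strand_basesI:
  assumes inj: "inj_on (mult_map scale) (carrier (corner_tensor scale e))"
    and sum: "{x + y | x y. x \<in> mult_map scale ` carrier (corner_tensor scale e) \<and> y \<in> span B11} = corner e 1 1"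
    and inter: "mult_map scale ` carrier (corner_tensor scale e) \<inter> span B11 = {0}"
    and B10: "independent B10" "span B10 = corner e 1 0"
    and B01: "independent B01" "span B01 = corner e 0 1"
    and B11: "independent B11"
  shows "dual_strand_bases scale e \<kappa> B10 B01 B11"
proof -
  let ?Us = "[corner e 1 0, corner e 0 1]" and ?Bs = "[B10, B01]"
  let ?E = "linear_extension scale prod_list" and ?P = "{b * c | b c. b \<in> B10 \<and> c \<in> B01}"
  interpret T: tensor_factors scale ?Us ?Bs
    by unfold_locales (auto simp: less_Suc_eq nth_Cons' B10 B01)
  have keys0: "p = 0" if p: "Poly_Mapping.keys p \<subseteq> listset ?Bs" and E: "?E p \<in> span B11" for p
  proof -
    have pU: "p \<in> T.tuples" using p T.basis_subset by auto
    have X: "T.tensor.cls p \<in> carrier T.tensor.Q" "T.tensor.cls 0 \<in> carrier T.tensor.Q"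
      by (rule T.tensor.cls_in[OF pU], rule T.tensor.cls_in[OF T.tensor.zero_in])
    have E1: "mult_map scale (T.tensor.cls p) = ?E p" using pU by (intro mult_map_tensor_rel) simp
    have E0: "mult_map scale (T.tensor.cls 0) = 0"
      using mult_map_tensor_rel[of 0 ?Us] by (simp add: linear_extension_0)
    have "?E p \<in> mult_map scale ` carrier (corner_tensor scale e)"
      unfolding T.tensor_space_eq E1[symmetric] using X(1) by (rule imageI)
    then have "?E p = 0" using E inter by blast
    then have "mult_map scale (T.tensor.cls p) = mult_map scale (T.tensor.cls 0)" using E1 E0 by simp
    then have cls: "T.tensor.cls p = T.tensor.cls 0"
      using inj_onD[OF inj[unfolded T.tensor_space_eq] _ X] by blast
    have "Poly_Mapping.lookup p vs = 0" if vs: "vs \<in> listset ?Bs" for vs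
    proof -
      have "linear_extension (*) (list_coord ?Bs vs) p = linear_extension (*) (list_coord ?Bs vs) 0"
        using T.tensor_coord_cls[OF pU vs] T.tensor_coord_cls[OF T.tensor.zero_in vs] cls by simp
      moreover have "linear_extension (*) (list_coord ?Bs vs) p =
          (\<Sum>us\<in>Poly_Mapping.keys p. if us = vs then Poly_Mapping.lookup p us else 0)"
        unfolding linear_extension_def
      proof (rule sum.cong[OF HOL.refl])
        fix us assume "us \<in> Poly_Mapping.keys p"
        then have "us \<in> listset ?Bs" using p by (rule subsetD[rotated])
        then show "Poly_Mapping.lookup p us * list_coord ?Bs vs us = (if us = vs then Poly_Mapping.lookup p us else 0)"
          by (simp only: T.list_coord_basis[OF _ vs]) simp
      qed
      ultimately show ?thesis by (simp add: linear_extension_def in_keys_iff split: if_splits)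
    qed
    then have "Poly_Mapping.keys p = {}" using p by (intro equals0I) (meson in_keys_iff subsetD)
    then show "p = 0" by simp
  qed
  have pair: "[b, c] \<in> listset ?Bs" if "b \<in> B10" "c \<in> B01" for b c :: 'a
    using that by (simp add: set_Cons_def)
  have minj: "b = b' \<and> c = c'" if b: "b \<in> B10" "c \<in> B01" "b' \<in> B10" "c' \<in> B01" and eq: "b * c = b' * c'" for b c b' c' :: 'a
  proof -
    let ?p = "Poly_Mapping.single [b, c] (1 :: 'k) - Poly_Mapping.single [b', c'] 1"
    have "?p = 0"
    proof (rule keys0)
      show "Poly_Mapping.keys ?p \<subseteq> listset ?Bs"
      proof -
        have "Poly_Mapping.keys ?p \<subseteq> {[b, c], [b', c']}"
          using keys_diff[of "Poly_Mapping.single [b, c] (1 :: 'k)" "Poly_Mapping.single [b', c'] 1"]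
          by (simp add: insert_commute)
        then show ?thesis using pair[OF b(1,2)] pair[OF b(3,4)] by blast
      qed
      show "?E ?p \<in> span B11"
        using eq by (simp add: linear_extension_diff linear_extension_single span_zero)
    qed
    then have "Poly_Mapping.lookup (Poly_Mapping.single [b, c] (1 :: 'k)) [b, c] =
        Poly_Mapping.lookup (Poly_Mapping.single [b', c'] (1 :: 'k)) [b, c]" by simp
    then show ?thesis by (simp add: lookup_single when_def split: if_splits)
  qed
  have mnot: "b * c \<notin> B11" if b: "b \<in> B10" "c \<in> B01" for b c :: 'a
  proof
    assume bc: "b * c \<in> B11"
    let ?p = "Poly_Mapping.single [b, c] (1 :: 'k)"
    have "?p = 0"
      by (rule keys0) (use pair[OF b] span_base[OF bc] in \<open>simp_all add: linear_extension_single\<close>)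
    from arg_cong[OF this, of "\<lambda>p. Poly_Mapping.lookup p [b, c]"] show False by simp
  qed
  have span: "span (?P \<union> B11) = corner e 1 1"
  proof (intro equalityI subsetI)
    fix x assume "x \<in> span (?P \<union> B11)"
    moreover have "?P \<subseteq> corner e 1 1"
    proof clarify
      fix b c assume bc: "b \<in> B10" "c \<in> B01"
      have "b \<in> corner e 1 0" "c \<in> corner e 0 1"
        using span_base[OF bc(1)] span_base[OF bc(2)] unfolding B10(2) B01(2) .
      then show "b * c \<in> corner e 1 1" by (rule corner_mult)
    qed
    moreover have "B11 \<subseteq> corner e 1 1"
    proof
      fix y assume "y \<in> B11"
      then have "y \<in> span B11" by (rule span_base)
      moreover have "0 \<in> mult_map scale ` carrier (corner_tensor scale e)" using inter by blast
      ultimately have "0 + y \<in> corner e 1 1" unfolding sum[symmetric] by blast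
      then show "y \<in> corner e 1 1" by simp
    qed
    ultimately show "x \<in> corner e 1 1"
      using span_minimal[OF _ subspace_corner, of "?P \<union> B11" 1 1] by blast
  next
    fix x assume "x \<in> corner e 1 1"
    then obtain X z where x: "x = mult_map scale X + z" "X \<in> carrier T.tensor.Q" "z \<in> span B11"
      unfolding sum[symmetric] T.tensor_space_eq by blast
    obtain p where p: "p \<in> T.tuples" "X = T.tensor.cls p" using x(2) by (rule T.tensor.cls_cases)
    have "mult_map scale X = ?E p" unfolding p(2) using p(1) by (intro mult_map_tensor_rel) simp
    also have "\<dots> \<in> span ?P"
      unfolding linear_extension_def
    proof (intro span_sum span_scale)
      fix us assume "us \<in> Poly_Mapping.keys p"
      then have "us \<in> listset ?Us" using p(1) by auto
      then obtain x y where "us = [x, y]" "x \<in> corner e 1 0" "y \<in> corner e 0 1"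
        by (auto simp: set_Cons_def)
      then show "prod_list us \<in> span ?P" using span_products[of x B10 y B01] B10(2) B01(2) by simp
    qed
    finally have "mult_map scale X \<in> span (?P \<union> B11)" using span_mono[of ?P "?P \<union> B11"] by blast
    moreover have "z \<in> span (?P \<union> B11)" using x(3) span_mono[of B11 "?P \<union> B11"] by blast
    ultimately show "x \<in> span (?P \<union> B11)" unfolding x(1) by (rule span_add)
  qed
  interpret S: strand_bases scale e \<kappa> B10 B01 B11
    by unfold_locales (fact B10(2) B01(2) span)+
  have "independent (?P \<union> B11)"
  proof
    assume "dependent (?P \<union> B11)"
    then obtain S u where S: "finite S" "S \<subseteq> ?P \<union> B11" "(\<Sum>v\<in>S. scale (u v) v) = 0" "\<exists>v\<in>S. u v \<noteq> 0"
      unfolding dependent_explicit by blast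
    define S1 where "S1 = S \<inter> ?P"
    define S2 where "S2 = S - S1"
    have S1: "finite S1" "S1 \<subseteq> ?P" and S2: "finite S2" "S2 \<subseteq> B11"
      using S(1,2) by (auto simp: S1_def S2_def)
    have SS: "S = S1 \<union> S2" "S1 \<inter> S2 = {}" by (auto simp: S1_def S2_def)
    have sum12: "(\<Sum>v\<in>S1. scale (u v) v) + (\<Sum>v\<in>S2. scale (u v) v) = 0"
      using S(3) sum.union_disjoint[OF S1(1) S2(1) SS(2), of "\<lambda>v. scale (u v) v"] SS(1) by simp
    have "\<forall>v\<in>S1. \<exists>w. w \<in> listset ?Bs \<and> prod_list w = v"
    proof
      fix v assume "v \<in> S1"
      then obtain b c where "v = b * c" "b \<in> B10" "c \<in> B01" using S1(2) by blast
      then show "\<exists>w. w \<in> listset ?Bs \<and> prod_list w = v" using pair by (intro exI[of _ "[b, c]"]) simp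
    qed
    from bchoice[OF this] obtain h where h: "\<And>v. v \<in> S1 \<Longrightarrow> h v \<in> listset ?Bs \<and> prod_list (h v) = v"
      by blast
    define p where "p = (\<Sum>v\<in>S1. Poly_Mapping.single (h v) (u v))"
    have "?E p = (\<Sum>v\<in>S1. scale (u v) v)"
    proof -
      have "(\<Sum>v\<in>S1. ?E (Poly_Mapping.single (h v) (u v))) = ?E p"
        unfolding p_def
        using sum_comp_morphism[of ?E "\<lambda>v. Poly_Mapping.single (h v) (u v)" S1]
        by (simp add: linear_extension_0 linear_extension_add comp_def)
      moreover have "(\<Sum>v\<in>S1. ?E (Poly_Mapping.single (h v) (u v))) = (\<Sum>v\<in>S1. scale (u v) v)"
        using h by (intro sum.cong HOL.refl) (simp add: linear_extension_single)
      ultimately show ?thesis by simp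
    qed
    also have "\<dots> = - (\<Sum>v\<in>S2. scale (u v) v)" using sum12 by (simp add: eq_neg_iff_add_eq_0)
    also have "\<dots> \<in> span B11"
      using S2(2) by (intro span_neg span_sum span_scale span_base) blast
    finally have Ep: "?E p \<in> span B11" .
    have "Poly_Mapping.keys p \<subseteq> (\<Union>v\<in>S1. Poly_Mapping.keys (Poly_Mapping.single (h v) (u v)))"
      unfolding p_def by (rule keys_sum)
    also have "\<dots> \<subseteq> listset ?Bs" using h by (auto simp del: listset.simps split: if_splits)
    finally have "p = 0" using Ep by (rule keys0)
    have u1: "u v = 0" if v: "v \<in> S1" for v
    proof -
      have "Poly_Mapping.lookup p (h v) = (\<Sum>w\<in>S1. if w = v then u w else 0)"
        unfolding p_def lookup_sum
      proof (intro sum.cong HOL.refl)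
        fix w assume w: "w \<in> S1"
        have "h w = h v \<longleftrightarrow> w = v" using h[OF w] h[OF v] by metis
        then show "Poly_Mapping.lookup (Poly_Mapping.single (h w) (u w)) (h v) = (if w = v then u w else 0)"
          by (simp add: lookup_single when_def)
      qed
      also have "\<dots> = u v" using S1(1) v by simp
      finally show ?thesis using \<open>p = 0\<close> by simp
    qed
    then have "(\<Sum>v\<in>S2. scale (u v) v) = 0" using sum12 by simp
    then have "\<forall>v\<in>S2. u v = 0" using independentD[OF B11 S2] by blast
    then show False using S(4) u1 SS(1) by blast
  qed
  then have "independent S.corner_basis" by (simp add: S.corner_basis_def)
  then show ?thesis
    using minj mnot B10(1) B01(1)
    by (intro dual_strand_bases.intro dual_strand_bases_axioms.intro S.strand_bases_axioms) blast+
qed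

section \<open>Hom spaces of the category\<close>

theorem theorem2p1:
  fixes scale :: "'k::field \<Rightarrow> 'a::ring_1 \<Rightarrow> 'a"
    and e :: 'a
    and A' A'' B10 B01 B11 :: "'a set"
    and m n :: nat
  assumes "k_algebra scale"
    and "e * e = e"
    and "corner_iso_field scale e"
    and "inj_on (mult_map scale) (carrier (corner_tensor scale e))"
    and "A' = mult_map scale ` carrier (corner_tensor scale e)"
    and "Modules.module.subspace scale A''"
    and "{x + y | x y. x \<in> A' \<and> y \<in> A''} = corner e 1 1"
    and "A' \<inter> A'' = {0}"
    and "basis_of scale B10 (corner e 1 0)"
    and "basis_of scale B01 (corner e 0 1)"
    and "basis_of scale B11 A''"
  shows
    "vectorspace class_ring (hom_space scale e n m)
     \<and> inj_on (\<lambda>(f, l). diagram scale e m n f l) (SIGMA f : PB m n. labels m n f B10 B11 B01)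
     \<and> disjoint_family_on (diagrams_of scale e B10 B11 B01 m n) (PB m n)
     \<and> vectorspace.basis class_ring (hom_space scale e n m)
         (\<Union>f\<in>PB m n. diagrams_of scale e B10 B11 B01 m n f)
     \<and> (\<exists>\<Phi>. linear_map class_ring
              (direct_sum_space (PB m n) (\<lambda>f. tensor_space scale (strand_spaces e A'' m n f)))
              (hom_space scale e n m) \<Phi>
          \<and> bij_betw \<Phi>
              (carrier (direct_sum_space (PB m n)
                 (\<lambda>f. tensor_space scale (strand_spaces e A'' m n f))))
              (carrier (hom_space scale e n m))
          \<and> (\<forall>f\<in>PB m n. \<forall>(bs, as, cs)\<in>labels m n f (corner e 1 0) A'' (corner e 0 1).
               \<Phi> (summand_inj (PB m n) (\<lambda>f. tensor_space scale (strand_spaces e A'' m n f)) f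
                     (pure_tensor scale (strand_spaces e A'' m n f) (bs @ as @ cs)))
               = diagram scale e m n f (bs, as, cs)))"
proof -
  interpret k_algebra scale by fact
  interpret idempotent_algebra scale e by unfold_locales fact
  obtain \<kappa> where "field_corner_algebra scale e \<kappa>" using assms(3) by (rule field_corner_functional)
  then interpret field_corner_algebra scale e \<kappa> .
  have B10: "independent B10" "span B10 = corner e 1 0" and B01: "independent B01" "span B01 = corner e 0 1"
    and B11: "independent B11" and A'': "A'' = span B11"
    using assms(9-11) by (simp_all add: basis_of_def)
  have "dual_strand_bases scale e \<kappa> B10 B01 B11"
    using assms(4,5,7,8) unfolding A'' by (intro dual_strand_basesI B10 B01 B11) simp_all
  then interpret dual_strand_bases scale e \<kappa> B10 B01 B11 .
  obtain c where "dual_family (Hom n m) (diagram_index m n) (\<lambda>(f, l). diagram scale e m n f l) c"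
    by (rule hom_dual_family[of n m]) (rule that; assumption)
  then interpret F: dual_family "Hom n m" "diagram_index m n" "\<lambda>(f, l). diagram scale e m n f l" c .
  have "disjoint_family_on (diagrams_of scale e B10 B11 B01 m n) (PB m n)"
  proof (unfold disjoint_family_on_def, intro ballI impI equals0I)
    fix f f' X
    assume f: "f \<in> PB m n" "f' \<in> PB m n" "f \<noteq> f'"
      and "X \<in> diagrams_of scale e B10 B11 B01 m n f \<inter> diagrams_of scale e B10 B11 B01 m n f'"
    then obtain l l' where l: "l \<in> basis_labels m n f" "l' \<in> basis_labels m n f'"
      "diagram scale e m n f l = diagram scale e m n f' l'"
      by (auto simp: diagrams_of_def)
    then have "(f, l) = (f', l')" using f by (intro inj_onD[OF F.inj_on_v]) auto
    then show False using f(3) by simp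
  qed
  moreover have "(\<lambda>(f, l). diagram scale e m n f l) ` diagram_index m n =
      (\<Union>f\<in>PB m n. diagrams_of scale e B10 B11 B01 m n f)"
    by (force simp: diagrams_of_def)
  then have "F.basis (\<Union>f\<in>PB m n. diagrams_of scale e B10 B11 B01 m n f)"
    using F.basis_v by simp
  moreover have "\<exists>\<Phi>. linear_map class_ring
              (direct_sum_space (PB m n) (\<lambda>f. tensor_space scale (strand_spaces e A'' m n f)))
              (Hom n m) \<Phi>
          \<and> bij_betw \<Phi>
              (carrier (direct_sum_space (PB m n)
                 (\<lambda>f. tensor_space scale (strand_spaces e A'' m n f))))
              (carrier (Hom n m))
          \<and> (\<forall>f\<in>PB m n. \<forall>(bs, as, cs)\<in>labels m n f (corner e 1 0) A'' (corner e 0 1).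
               \<Phi> (summand_inj (PB m n) (\<lambda>f. tensor_space scale (strand_spaces e A'' m n f)) f
                     (pure_tensor scale (strand_spaces e A'' m n f) (bs @ as @ cs)))
               = diagram scale e m n f (bs, as, cs))"
    using hom_direct_sum_iso[of m n] unfolding A'' by (force simp: split_beta)
  ultimately show ?thesis using vectorspace_hom F.inj_on_v by (intro conjI)
qed

end
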